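(* It is undecidable whether a word-hyperbolic semigroup is automatic (respectively, asynchronously automatic, biautomatic, asynchronously biautomatic). That is, for each of these four properties, there is no algorithm that takes as input an interpreted word-hyperbolic structure for a semigroup $S$ and decides whether $S$ has that property.
   Context: Maps are written on the right. For a word $u=a_1\cdots a_n$, $u^{\mathrm{rev}}=a_n\cdots a_1$, and $L^{\mathrm{rev}}=\{w^{\mathrm{rev}} : w\in L\}$. $A^+$ is the set of non-empty words over $A$; $\varepsilon$ is the empty word. Word-hyperbolic structures. A pre-word-hyperbolic structure $\Sigma$ consists of: a finite alphabet $A(\Sigma)$; a regular language $L(\Sigma)$ over $A(\Sigma)$ not containing the empty word; and a context-free language $M(\Sigma)$ over $A(\Sigma)\cup\{\#_1,\#_2\}$, where $\#_1,\#_2$ are new symbols not in $A(\Sigma)$, such that $M(\Sigma)\subseteq L(\Sigma)\#_1L(\Sigma)\#_2L(\Sigma)^{\mathrm{rev}}$. An interpretation of $\Sigma$ with respect to a semigroup $S$ is a homomorphism $\phi:A(\Sigma)^+\to S$ such that $\phi|_{A(\Sigma)}$ is injective, $(L(\Sigma))\phi=S$, and $M(\Sigma)=\{u\#_1v\#_2w^{\mathrm{rev}} : u,v,w\in L(\Sigma),\ (u\phi)(v\phi)=w\phi\}$. If $\Sigma$ admits an interpretation with respect to $S$, then $\Sigma$ is a word-hyperbolic structure for $S$, and it describes $S$ uniquely up to isomorphism. An assignment of generators for $\Sigma$ is a map $\alpha:A(\Sigma)\to L(\Sigma)$ such that there is some interpretation $\phi$ with $a\alpha\phi=a\phi$ for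 all $a\in A(\Sigma)$. An interpreted word-hyperbolic structure is one equipped with an assignment of generators; by convention $A(\Sigma)\subseteq L(\Sigma)$ and the assignment is the embedding map. As algorithmic input it is given by the alphabet, a finite automaton for $L(\Sigma)$, and a context-free grammar for $M(\Sigma)$. Automaticity. Let $\$$ be a symbol not in $A$. Define $\delta_{\mathrm R}:A^*\times A^*\to((A\cup\{\$\})\times(A\cup\{\$\}))^*$ by padding the shorter of the two words on the right with symbols $\$$ until both have equal length and then reading the pair of words letter by letter as a word of pairs; $\delta_{\mathrm L}$ is defined in the same way but padding the shorter word on the left. Let $S$ be a semigroup, $A$ a finite alphabet representing a generating set for $S$, with $\overline{u}$ the element represented by $u$, and let $L$ be a regular language of words over $A$ such that every element of $S$ has at least one representative in $L$. For $a\in A\cup\{\varepsilon\}$ let $L_a=\{(u,v): u,v\in L,\ \overline{ua}=\overline{v}\}$ and ${}_aL=\{(u,v):u,v\in L,\ \overline{au}=\overline{v}\}$. The pair $(A,L)$ is: an automatic structure if $L_a\delta_{\mathrm R}$ is regular for all $a\in A\cup\{\varepsilon\}$; an asynchronous automatic structure if $L_a$ is a rational relation for all $a\in A\cup\{\varepsilon\}$; a biautomatic structure if $L_a\delta_{\mathrm R}$, ${}_aL\delta_{\mathrm R}$, $L_a\delta_{\mathrm L}$, ${}_aL\delta_{\mathrm L}$ are regular for all $a\in A\cup\{\varepsilon\}$; an asynchronous biautomatic structure if $L_a$ and ${}_aL$ are rational relations for all $a\in A\cup\{\varepsilon\}$. $S$ is automatic (respectively asynchronously automatic, biautomatic, asynchronously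 biautomatic) if it admits a structure of the corresponding type with respect to some finite generating set. *)

theory Defs
  imports Main "HOL-Library.Nat_Bijection"
begin

section \<open>Partial recursive functions\<close>

datatype recf = Zero | Succ | Proj nat | Comp recf "recf list" | PrimRec recf recf | Mu recf

text \<open>\<open>rec_eval f xs y\<close>: the partial recursive function denoted by \<open>f\<close> is defined at the
  argument tuple \<open>xs\<close> and has value \<open>y\<close> there.\<close>

inductive rec_eval :: "recf \<Rightarrow> nat list \<Rightarrow> nat \<Rightarrow> bool" where
  zero: "rec_eval Zero xs 0"
| succ: "rec_eval Succ [x] (Suc x)"
| proj: "i < length xs \<Longrightarrow> rec_eval (Proj i) xs (xs ! i)"
| comp: "list_all2 (\<lambda>g y. rec_eval g xs y) gs ys \<Longrightarrow> rec_eval f ys z \<Longrightarrow> rec_eval (Comp f gs) xs z"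
| primrec_0: "rec_eval g xs z \<Longrightarrow> rec_eval (PrimRec g h) (0 # xs) z"
| primrec_Suc: "rec_eval (PrimRec g h) (n # xs) r \<Longrightarrow> rec_eval h (n # r # xs) z
    \<Longrightarrow> rec_eval (PrimRec g h) (Suc n # xs) z"
| mu: "rec_eval f (n # xs) 0 \<Longrightarrow> (\<forall>m<n. \<exists>y. rec_eval f (m # xs) (Suc y))
    \<Longrightarrow> rec_eval (Mu f) xs n"

inductive_cases rec_eval_ZeroE: "rec_eval Zero xs y"
inductive_cases rec_eval_SuccE: "rec_eval Succ xs y"
inductive_cases rec_eval_ProjE: "rec_eval (Proj i) xs y"
inductive_cases rec_eval_CompE: "rec_eval (Comp f gs) xs y"
inductive_cases rec_eval_PrimRec0E: "rec_eval (PrimRec g h) (0 # xs) y"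
inductive_cases rec_eval_PrimRecSucE: "rec_eval (PrimRec g h) (Suc n # xs) y"
inductive_cases rec_eval_MuE: "rec_eval (Mu f) xs y"

lemma rec_eval_deterministic: "rec_eval f xs y \<Longrightarrow> rec_eval f xs z \<Longrightarrow> y = z"
proof (induction arbitrary: z rule: rec_eval.induct)
  case (comp xs gs ys f z')
  from comp.prems obtain ys' where ys': "list_all2 (\<lambda>g y. rec_eval g xs y) gs ys'"
    and z: "rec_eval f ys' z" by (rule rec_eval_CompE)
  have "ys = ys'"
    using comp.IH(1) ys' by (auto simp: list_all2_conv_all_nth intro!: nth_equalityI)
  with comp.IH(2) z show ?case by simp
next
  case (primrec_Suc g h n xs r z')
  then show ?case by (metis rec_eval_PrimRecSucE)
next
  case (mu f n xs)
  from mu.prems have z: "rec_eval f (z # xs) 0"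
    and lt: "\<And>m. m < z \<Longrightarrow> \<exists>y. rec_eval f (m # xs) (Suc y)"
    by (auto elim: rec_eval_MuE)
  have "\<not> n < z" using lt mu.IH(1) by fastforce
  moreover have "\<not> z < n" using mu.IH(2) z by fastforce
  ultimately show ?case by simp
next
  case (zero xs)
  then show ?case by (rule rec_eval_ZeroE) simp
next
  case (succ x)
  then show ?case by (rule rec_eval_SuccE) simp
next
  case (proj i xs)
  from proj.prems show ?case by (rule rec_eval_ProjE) simp
next
  case (primrec_0 g xs z' h)
  from primrec_0.prems have "rec_eval g xs z" by (rule rec_eval_PrimRec0E)
  then show ?case by (rule primrec_0.IH)
qed

section \<open>Automata, regular languages and rational relations\<close>

record 'l nfa =
  nfa_init :: "nat list"
  nfa_final :: "nat list"
  nfa_trans :: "(nat \<times> 'l \<times> nat) list"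

inductive nfa_path :: "'l nfa \<Rightarrow> nat \<Rightarrow> 'l list \<Rightarrow> nat \<Rightarrow> bool" for M where
  "nfa_path M p [] p"
| "(p, a, q) \<in> set (nfa_trans M) \<Longrightarrow> nfa_path M q w r \<Longrightarrow> nfa_path M p (a # w) r"

definition nfa_lang :: "'l nfa \<Rightarrow> 'l list set" where
  "nfa_lang M = {w. \<exists>p \<in> set (nfa_init M). \<exists>q \<in> set (nfa_final M). nfa_path M p w q}"

definition regular_lang :: "'l list set \<Rightarrow> bool" where
  "regular_lang L \<longleftrightarrow> (\<exists>M. L = nfa_lang M)"

text \<open>A finite transducer is a finite automaton whose transitions are labelled with pairs of
  words; the labels along a path are multiplied in the product of the two free monoids.\<close>

definition rational_rel :: "('a list \<times> 'b list) set \<Rightarrow> bool" where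
  "rational_rel R \<longleftrightarrow>
    (\<exists>T :: ('a list \<times> 'b list) nfa.
      R = {(concat (map fst w), concat (map snd w)) | w. w \<in> nfa_lang T})"

section \<open>Context-free grammars\<close>

text \<open>Nonterminals are natural numbers, tagged with \<open>Inl\<close>; terminals are tagged with \<open>Inr\<close>.\<close>

record 't cfg =
  cfg_start :: nat
  cfg_prods :: "(nat \<times> (nat + 't) list) list"

definition cfg_step :: "'t cfg \<Rightarrow> (nat + 't) list \<Rightarrow> (nat + 't) list \<Rightarrow> bool" where
  "cfg_step G x y \<longleftrightarrow>
    (\<exists>u v N r. (N, r) \<in> set (cfg_prods G) \<and> x = u @ Inl N # v \<and> y = u @ r @ v)"

definition cfg_lang :: "'t cfg \<Rightarrow> 't list set" where
  "cfg_lang G = {w. (cfg_step G)\<^sup>*\<^sup>* [Inl (cfg_start G)] (map Inr w)}"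

section \<open>Semigroups and homomorphisms from free semigroups\<close>

record 'a sgp =
  sg_carrier :: "'a set"
  sg_mult :: "'a \<Rightarrow> 'a \<Rightarrow> 'a"

definition is_semigroup :: "'a sgp \<Rightarrow> bool" where
  "is_semigroup S \<longleftrightarrow>
    sg_carrier S \<noteq> {} \<and>
    (\<forall>x\<in>sg_carrier S. \<forall>y\<in>sg_carrier S. sg_mult S x y \<in> sg_carrier S) \<and>
    (\<forall>x\<in>sg_carrier S. \<forall>y\<in>sg_carrier S. \<forall>z\<in>sg_carrier S.
      sg_mult S (sg_mult S x y) z = sg_mult S x (sg_mult S y z))"

definition plus_words :: "'l set \<Rightarrow> 'l list set" where
  "plus_words A = lists A - {[]}"

definition free_hom :: "'l set \<Rightarrow> 'a sgp \<Rightarrow> ('l list \<Rightarrow> 'a) \<Rightarrow> bool" where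
  "free_hom A S \<phi> \<longleftrightarrow>
    \<phi> ` plus_words A \<subseteq> sg_carrier S \<and>
    (\<forall>u\<in>plus_words A. \<forall>v\<in>plus_words A. \<phi> (u @ v) = sg_mult S (\<phi> u) (\<phi> v))"

section \<open>Word-hyperbolic structures\<close>

datatype hsym = Letter nat | Hash1 | Hash2

text \<open>The alphabet is the set of entries of the list \<open>wh_alphabet\<close>; its letters are named by
  natural numbers.\<close>

record wh_struct =
  wh_alphabet :: "nat list"
  wh_aut :: "nat nfa"
  wh_gram :: "hsym cfg"

definition wh_A :: "wh_struct \<Rightarrow> nat set" where
  "wh_A \<Sigma> = set (wh_alphabet \<Sigma>)"

definition wh_L :: "wh_struct \<Rightarrow> nat list set" where
  "wh_L \<Sigma> = nfa_lang (wh_aut \<Sigma>)"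

definition wh_M :: "wh_struct \<Rightarrow> hsym list set" where
  "wh_M \<Sigma> = cfg_lang (wh_gram \<Sigma>)"

definition hword :: "nat list \<Rightarrow> nat list \<Rightarrow> nat list \<Rightarrow> hsym list" where
  "hword u v w = map Letter u @ [Hash1] @ map Letter v @ [Hash2] @ map Letter (rev w)"

definition pre_word_hyperbolic :: "wh_struct \<Rightarrow> bool" where
  "pre_word_hyperbolic \<Sigma> \<longleftrightarrow>
    (\<forall>(p, a, q) \<in> set (nfa_trans (wh_aut \<Sigma>)). a \<in> wh_A \<Sigma>) \<and>
    (\<forall>(N, r) \<in> set (cfg_prods (wh_gram \<Sigma>)).
      \<forall>t. Inr t \<in> set r \<longrightarrow> t \<in> Letter ` wh_A \<Sigma> \<union> {Hash1, Hash2}) \<and>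
    [] \<notin> wh_L \<Sigma> \<and>
    wh_M \<Sigma> \<subseteq> {hword u v w | u v w. u \<in> wh_L \<Sigma> \<and> v \<in> wh_L \<Sigma> \<and> w \<in> wh_L \<Sigma>}"

definition wh_interpretation :: "wh_struct \<Rightarrow> 'a sgp \<Rightarrow> (nat list \<Rightarrow> 'a) \<Rightarrow> bool" where
  "wh_interpretation \<Sigma> S \<phi> \<longleftrightarrow>
    free_hom (wh_A \<Sigma>) S \<phi> \<and>
    inj_on (\<lambda>a. \<phi> [a]) (wh_A \<Sigma>) \<and>
    \<phi> ` wh_L \<Sigma> = sg_carrier S \<and>
    wh_M \<Sigma> = {hword u v w | u v w. u \<in> wh_L \<Sigma> \<and> v \<in> wh_L \<Sigma> \<and> w \<in> wh_L \<Sigma> \<and>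
      sg_mult S (\<phi> u) (\<phi> v) = \<phi> w}"

definition assignment_of_generators :: "wh_struct \<Rightarrow> 'a sgp \<Rightarrow> (nat \<Rightarrow> nat list) \<Rightarrow> bool" where
  "assignment_of_generators \<Sigma> S \<alpha> \<longleftrightarrow>
    \<alpha> ` wh_A \<Sigma> \<subseteq> wh_L \<Sigma> \<and>
    (\<exists>\<phi>. wh_interpretation \<Sigma> S \<phi> \<and> (\<forall>a\<in>wh_A \<Sigma>. \<phi> (\<alpha> a) = \<phi> [a]))"

text \<open>By convention the assignment of generators of an interpreted word-hyperbolic structure is
  the embedding map of the alphabet into the language of representatives.\<close>

definition interpreted_wh_structure :: "wh_struct \<Rightarrow> 'a sgp \<Rightarrow> bool" where
  "interpreted_wh_structure \<Sigma> S \<longleftrightarrow>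
    is_semigroup S \<and> pre_word_hyperbolic \<Sigma> \<and> assignment_of_generators \<Sigma> S (\<lambda>a. [a])"

section \<open>Automaticity\<close>

text \<open>The padding symbol is \<open>None\<close>.\<close>

definition deltaR :: "'l list \<times> 'l list \<Rightarrow> ('l option \<times> 'l option) list" where
  "deltaR = (\<lambda>(u, v).
    zip (map Some u @ replicate (length v - length u) None)
        (map Some v @ replicate (length u - length v) None))"

definition deltaL :: "'l list \<times> 'l list \<Rightarrow> ('l option \<times> 'l option) list" where
  "deltaL = (\<lambda>(u, v).
    zip (replicate (length v - length u) None @ map Some u)
        (replicate (length u - length v) None @ map Some v))"

text \<open>The map \<open>\<rho>\<close> sends a word to the element it represents. A word \<open>x\<close> that is a letter or
  empty plays the part of the index \<open>a\<close> ranging over letters and the empty word.\<close>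

definition rel_right :: "('l list \<Rightarrow> 'a) \<Rightarrow> 'l list set \<Rightarrow> 'l list \<Rightarrow> ('l list \<times> 'l list) set" where
  "rel_right \<rho> L x = {(u, v). u \<in> L \<and> v \<in> L \<and> \<rho> (u @ x) = \<rho> v}"

definition rel_left :: "('l list \<Rightarrow> 'a) \<Rightarrow> 'l list set \<Rightarrow> 'l list \<Rightarrow> ('l list \<times> 'l list) set" where
  "rel_left \<rho> L x = {(u, v). u \<in> L \<and> v \<in> L \<and> \<rho> (x @ u) = \<rho> v}"

definition letters_eps :: "'l set \<Rightarrow> 'l list set" where
  "letters_eps A = insert [] ((\<lambda>a. [a]) ` A)"

text \<open>The words in \<open>L\<close> are non-empty, since the empty word represents no element of a
  semigroup.\<close>

definition rep_language :: "'a sgp \<Rightarrow> 'l set \<Rightarrow> ('l list \<Rightarrow> 'a) \<Rightarrow> 'l list set \<Rightarrow> bool" where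
  "rep_language S A \<rho> L \<longleftrightarrow>
    finite A \<and> free_hom A S \<rho> \<and> \<rho> ` plus_words A = sg_carrier S \<and>
    regular_lang L \<and> L \<subseteq> plus_words A \<and> (\<forall>s\<in>sg_carrier S. \<exists>w\<in>L. \<rho> w = s)"

definition automatic_structure ::
  "'a sgp \<Rightarrow> 'l set \<Rightarrow> ('l list \<Rightarrow> 'a) \<Rightarrow> 'l list set \<Rightarrow> bool" where
  "automatic_structure S A \<rho> L \<longleftrightarrow> rep_language S A \<rho> L \<and>
    (\<forall>x\<in>letters_eps A. regular_lang (deltaR ` rel_right \<rho> L x))"

definition async_automatic_structure ::
  "'a sgp \<Rightarrow> 'l set \<Rightarrow> ('l list \<Rightarrow> 'a) \<Rightarrow> 'l list set \<Rightarrow> bool" where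
  "async_automatic_structure S A \<rho> L \<longleftrightarrow> rep_language S A \<rho> L \<and>
    (\<forall>x\<in>letters_eps A. rational_rel (rel_right \<rho> L x))"

definition biautomatic_structure ::
  "'a sgp \<Rightarrow> 'l set \<Rightarrow> ('l list \<Rightarrow> 'a) \<Rightarrow> 'l list set \<Rightarrow> bool" where
  "biautomatic_structure S A \<rho> L \<longleftrightarrow> rep_language S A \<rho> L \<and>
    (\<forall>x\<in>letters_eps A.
      regular_lang (deltaR ` rel_right \<rho> L x) \<and> regular_lang (deltaR ` rel_left \<rho> L x) \<and>
      regular_lang (deltaL ` rel_right \<rho> L x) \<and> regular_lang (deltaL ` rel_left \<rho> L x))"

definition async_biautomatic_structure ::
  "'a sgp \<Rightarrow> 'l set \<Rightarrow> ('l list \<Rightarrow> 'a) \<Rightarrow> 'l list set \<Rightarrow> bool" where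
  "async_biautomatic_structure S A \<rho> L \<longleftrightarrow> rep_language S A \<rho> L \<and>
    (\<forall>x\<in>letters_eps A. rational_rel (rel_right \<rho> L x) \<and> rational_rel (rel_left \<rho> L x))"

text \<open>Every finite alphabet can be taken to consist of natural numbers.\<close>

definition automatic :: "'a sgp \<Rightarrow> bool" where
  "automatic S \<longleftrightarrow> (\<exists>(A :: nat set) \<rho> L. automatic_structure S A \<rho> L)"

definition async_automatic :: "'a sgp \<Rightarrow> bool" where
  "async_automatic S \<longleftrightarrow> (\<exists>(A :: nat set) \<rho> L. async_automatic_structure S A \<rho> L)"

definition biautomatic :: "'a sgp \<Rightarrow> bool" where
  "biautomatic S \<longleftrightarrow> (\<exists>(A :: nat set) \<rho> L. biautomatic_structure S A \<rho> L)"

definition async_biautomatic :: "'a sgp \<Rightarrow> bool" where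
  "async_biautomatic S \<longleftrightarrow> (\<exists>(A :: nat set) \<rho> L. async_biautomatic_structure S A \<rho> L)"

section \<open>Goedel numbering of word-hyperbolic structures\<close>

definition code_nfa :: "nat nfa \<Rightarrow> nat" where
  "code_nfa M = prod_encode (list_encode (nfa_init M), prod_encode (list_encode (nfa_final M),
    list_encode (map (\<lambda>(p, a, q). prod_encode (p, prod_encode (a, q))) (nfa_trans M))))"

fun code_hsym :: "hsym \<Rightarrow> nat" where
  "code_hsym Hash1 = 0"
| "code_hsym Hash2 = 1"
| "code_hsym (Letter a) = a + 2"

definition code_cfg :: "hsym cfg \<Rightarrow> nat" where
  "code_cfg G = prod_encode (cfg_start G, list_encode (map (\<lambda>(N, r).
    prod_encode (N, list_encode (map (sum_encode \<circ> map_sum id code_hsym) r))) (cfg_prods G)))"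

definition code_wh :: "wh_struct \<Rightarrow> nat" where
  "code_wh \<Sigma> = prod_encode (list_encode (wh_alphabet \<Sigma>),
    prod_encode (code_nfa (wh_aut \<Sigma>), code_cfg (wh_gram \<Sigma>)))"

lemma inj_code_nfa: "inj code_nfa"
proof (rule injI)
  fix M N assume eq: "code_nfa M = code_nfa N"
  have inj: "inj (\<lambda>(p, a, q). prod_encode (p, prod_encode (a, q)))" by (auto simp: inj_def)
  show "M = N"
    using eq inj_mapI[OF inj] by (auto simp: code_nfa_def inj_eq list_encode_eq intro: nfa.equality)
qed

lemma inj_code_cfg: "inj code_cfg"
proof (rule injI)
  fix G H assume eq: "code_cfg G = code_cfg H"
  have "inj code_hsym"
  proof (rule injI)
    fix x y show "code_hsym x = code_hsym y \<Longrightarrow> x = y" by (cases x; cases y) auto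
  qed
  then have "inj (map_sum (id :: nat \<Rightarrow> nat) code_hsym)" by (simp add: sum.inj_map)
  then have "inj (sum_encode \<circ> map_sum id code_hsym)"
    by (rule inj_compose[OF inj_sum_encode])
  then have i: "inj (map (sum_encode \<circ> map_sum id code_hsym))" by (rule inj_mapI)
  have "inj (\<lambda>(N, r). prod_encode (N, list_encode (map (sum_encode \<circ> map_sum id code_hsym) r)))"
    using i by (auto simp: inj_eq list_encode_eq intro!: injI)
  from inj_mapI[OF this] eq show "G = H"
    by (auto simp: code_cfg_def inj_eq list_encode_eq intro: cfg.equality)
qed

lemma inj_code_wh: "inj code_wh"
  using inj_code_nfa inj_code_cfg
  by (auto intro!: injI wh_struct.equality simp: code_wh_def inj_eq list_encode_eq)

section \<open>Decidability of properties of word-hyperbolic semigroups\<close>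

text \<open>The algorithm receives (the code of) an interpreted word-hyperbolic structure for \<open>S\<close> and
  must halt with the correct answer; nothing is required of it on other inputs. A word-hyperbolic
  semigroup is the image of a language over a finite alphabet, hence countable, so up to
  isomorphism its carrier is a set of natural numbers.\<close>

definition wh_decidable :: "(nat sgp \<Rightarrow> bool) \<Rightarrow> bool" where
  "wh_decidable P \<longleftrightarrow> (\<exists>f. \<forall>\<Sigma> S. interpreted_wh_structure \<Sigma> S \<longrightarrow>
    rec_eval f [code_wh \<Sigma>] (if P S then 1 else 0))"

end

theory Submission
  imports Defs "HOL-Library.Sublist"
begin

text \<open>Let \<open>A\<close> be finite and \<open>I\<close> an ideal of \<open>A\<^sup>+\<close>. The Rees quotient \<open>A\<^sup>+ / I\<close>, with all of \<open>A\<^sup>+\<close> as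
  language of representatives, has the multiplication table of all \<open>u #\<^sub>1 v #\<^sub>2 w\<^bsup>rev\<^esup>\<close> with \<open>uv = w\<close>, or
  with \<open>uv\<close> and \<open>w\<close> in \<open>I\<close>; it is context-free if \<open>I\<close> is. If \<open>I\<close> is regular, the quotient is
  biautomatic. Conversely, if the quotient is asynchronously automatic and \<open>p\<close> is a letter, then
  \<open>{y. yp \<in> I}\<close> agrees outside \<open>I\<close> with a regular language.

  A partial recursive function \<open>g\<close> is compiled into a regular language \<open>W\<close> of counter operations, such
  that \<open>g(x)\<close> is defined iff some word of \<open>W\<close> passes all its zero tests when started on \<open>x\<close>. Append to
  these words an unused counter's increments, decrements and a zero test. Let \<open>I\<close> be generated by the
  delimited words that are not such a history with input \<open>x\<close> passing all tests; a failing zero test is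
  detected by comparing two letter counts, so \<open>I\<close> is context-free. If \<open>g(x)\<close> is undefined, every
  history is faulty and \<open>I\<close> is regular; otherwise \<open>{y. yp \<in> I}\<close> separates \<open>a\<^sup>n\<close> and \<open>b\<^sup>m\<close> with \<open>n \<noteq> m\<close>
  from \<open>a\<^sup>n b\<^sup>n\<close>, hence is not regular.

  Now suppose that \<open>f\<close> decides the property. The input \<open>x\<close> enters the grammar only through a chain of
  productions, so the code of the structure for \<open>x\<close> is computable from \<open>x\<close> and a template. Let \<open>g\<close> be
  defined at \<open>x\<close> iff \<open>f\<close> accepts the structure which results when the template with code \<open>x\<close> is filled
  with its own code \<open>x\<close>. For the code of the template belonging to \<open>g\<close> itself this is contradictory.\<close>

section \<open>Languages with finitely many left quotients\<close>

text \<open>Faults, and not correct histories, generate the ideal because legality is a conjunction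
  over all tests and several counters, in general not a context-free condition, whereas a fault is
  located at one test and concerns one counter. The ideal must moreover become fully regular when
  nothing halts. For this reason a wrong input is a fault by itself, before any closing delimiter:
  if no history with input \<open>x\<close> passes, every delimited body then lies in the ideal and
  no test has to be inspected any more. The extra counter serves the other case. A halting
  computation may have a single legal history, and its absence would leave the ideal regular; the
  counter multiplies it into an unbounded family, of which only the members with equal counts are
  legal.

  Regularity is treated as finiteness of the set of left quotients, which passes through transducers
  without a choice of states; automata appear where the definitions ask for them. All four
  properties lie between biautomatic and asynchronously automatic, so the two cases settle them
  together.\<close>

definition lquot :: "'a list set \<Rightarrow> 'a list \<Rightarrow> 'a list set" where
  "lquot X x = {z. x @ z \<in> X}"

text \<open>Regularity in Myhill-Nerode form. The alphabet may be infinite, so a bound on the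
  letters is added only when an automaton has to be produced, in
  \<open>fin_quot_regular\<close>.\<close>

definition fin_quot :: "'a list set \<Rightarrow> bool" where
  "fin_quot X \<longleftrightarrow> finite (range (lquot X))"

definition conc :: "'a list set \<Rightarrow> 'a list set \<Rightarrow> 'a list set" where
  "conc X Y = {x @ y | x y. x \<in> X \<and> y \<in> Y}"

inductive_set star :: "'a list set \<Rightarrow> 'a list set" for X where
  star_Nil: "[] \<in> star X"
| star_app: "x \<in> X \<Longrightarrow> y \<in> star X \<Longrightarrow> x @ y \<in> star X"

lemma lquot_iff [simp]: "z \<in> lquot X x \<longleftrightarrow> x @ z \<in> X"
  by (simp add: lquot_def)

lemma lquot_Nil [simp]: "lquot X [] = X"
  by (simp add: lquot_def)

lemma lquot_lquot [simp]: "lquot (lquot X x) y = lquot X (x @ y)"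
  by (auto simp: lquot_def)

lemma lquot_Cons: "lquot X (a # x) = lquot (lquot X [a]) x"
  by simp

lemma lquot_in_range:
  assumes "D \<in> range (lquot X)"
  shows "lquot D x \<in> range (lquot X)"
proof -
  from assms obtain y where "D = lquot X y" by (rule rangeE)
  then have "lquot D x = lquot X (y @ x)" by simp
  then show ?thesis by (rule range_eqI)
qed

text \<open>The transition-table form of the criterion, for constructions whose quotients are best
  described letter by letter; \<open>fin_quot_subset\<close> is for those with a closed
  formula.\<close>

lemma fin_quotI:
  assumes "finite F" "X \<in> F" "\<And>Y a. Y \<in> F \<Longrightarrow> lquot Y [a] \<in> F"
  shows "fin_quot X"
proof -
  have "Y \<in> F \<Longrightarrow> lquot Y x \<in> F" for x Y
  proof (induction x arbitrary: Y)
    case (Cons a x)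
    then show ?case using assms(3) by (subst lquot_Cons) blast
  qed simp
  then show ?thesis
    unfolding fin_quot_def using assms(1,2) by (auto intro: finite_subset)
qed

lemma fin_quot_subset: "finite F \<Longrightarrow> (\<And>x. lquot X x \<in> F) \<Longrightarrow> fin_quot X"
  unfolding fin_quot_def by (auto intro: finite_subset)

lemma fin_quot_lquot: "fin_quot X \<Longrightarrow> fin_quot (lquot X x)"
  unfolding fin_quot_def by (rule finite_subset[rotated]) auto

lemma fin_quot_Un: "fin_quot X \<Longrightarrow> fin_quot Y \<Longrightarrow> fin_quot (X \<union> Y)"
  by (rule fin_quot_subset[where F = "(\<lambda>(D, E). D \<union> E) ` (range (lquot X) \<times> range (lquot Y))"])
     (auto simp: fin_quot_def image_iff lquot_def)

lemma fin_quot_Compl: "fin_quot X \<Longrightarrow> fin_quot (- X)"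
  by (rule fin_quot_subset[where F = "uminus ` range (lquot X)"])
     (auto simp: fin_quot_def image_iff lquot_def)

lemma fin_quot_Int: "fin_quot X \<Longrightarrow> fin_quot Y \<Longrightarrow> fin_quot (X \<inter> Y)"
  using fin_quot_Compl[OF fin_quot_Un[OF fin_quot_Compl[of X] fin_quot_Compl[of Y]]] by simp

lemma fin_quot_Diff: "fin_quot X \<Longrightarrow> fin_quot Y \<Longrightarrow> fin_quot (X - Y)"
  by (simp add: Diff_eq fin_quot_Int fin_quot_Compl)

lemma fin_quot_UN: "finite J \<Longrightarrow> (\<And>j. j \<in> J \<Longrightarrow> fin_quot (X j)) \<Longrightarrow> fin_quot (\<Union>j\<in>J. X j)"
proof (induction J rule: finite_induct)
  case empty
  show ?case by (rule fin_quot_subset[of "{{}}"]) (auto simp: lquot_def)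
qed (auto intro: fin_quot_Un)

lemma fin_quot_UNIV: "fin_quot UNIV"
  by (rule fin_quot_subset[of "{UNIV}"]) (auto simp: lquot_def)

lemma fin_quot_lists: "fin_quot (lists B)"
  by (rule fin_quot_subset[of "{lists B, {}}"]) (auto simp: lquot_def)

lemma fin_quot_finite:
  assumes "finite X"
  shows "fin_quot X"
proof (rule fin_quot_subset)
  show "finite (Pow (\<Union>w\<in>X. (\<lambda>n. drop n w) ` {..length w}))"
    using assms by simp
  fix x
  have "\<exists>w\<in>X. z \<in> (\<lambda>n. drop n w) ` {..length w}" if "x @ z \<in> X" for z
    using that by (intro bexI[of _ "x @ z"] image_eqI[of _ _ "length x"]) auto
  then show "lquot X x \<in> Pow (\<Union>w\<in>X. (\<lambda>n. drop n w) ` {..length w})"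
    by (auto simp: lquot_def)
qed

text \<open>In a word \<open>x @ z\<close> of the product the cut falls either in \<open>z\<close>
  or in \<open>x\<close>. The quotient thus depends on one quotient of \<open>X\<close> and a set of
  quotients of \<open>Y\<close>, which bounds their number.\<close>

lemma lquot_conc:
  "lquot (conc X Y) x = conc (lquot X x) Y \<union> \<Union> {lquot Y v | u v. x = u @ v \<and> u \<in> X}"
proof -
  have "z \<in> lquot (conc X Y) x \<longleftrightarrow>
      z \<in> conc (lquot X x) Y \<or> (\<exists>u v. x = u @ v \<and> u \<in> X \<and> v @ z \<in> Y)" for z
    unfolding conc_def lquot_def append_eq_append_conv2 mem_Collect_eq by (metis append_Nil2)
  then show ?thesis by (auto simp del: lquot_iff) (auto simp: lquot_def)
qed

lemma fin_quot_conc: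
  assumes "fin_quot X" "fin_quot Y"
  shows "fin_quot (conc X Y)"
proof (rule fin_quot_subset)
  let ?F = "(\<lambda>(D, E). conc D Y \<union> \<Union> E) ` (range (lquot X) \<times> Pow (range (lquot Y)))"
  show "finite ?F" using assms by (simp add: fin_quot_def)
  show "lquot (conc X Y) x \<in> ?F" for x
    unfolding lquot_conc
    by (rule image_eqI[where x = "(lquot X x, {lquot Y v | u v. x = u @ v \<and> u \<in> X})"]) auto
qed

lemma star_mono_app: "x \<in> star X \<Longrightarrow> y \<in> star X \<Longrightarrow> x @ y \<in> star X"
  by (induction rule: star.induct) (auto intro: star_app)

text \<open>\<open>v\<close> is the part of the straddling factor that lies in \<open>x\<close>. The
  first alternative provides for a cut with no factor left behind it.\<close>

lemma star_split:
  "w \<in> star X \<Longrightarrow> w = x @ z \<Longrightarrow>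
    x \<in> star X \<and> z = [] \<or> (\<exists>u v. x = u @ v \<and> u \<in> star X \<and> z \<in> conc (lquot X v) (star X))"
proof (induction arbitrary: x rule: star.induct)
  case star_Nil
  then show ?case by (auto intro: star.intros)
next
  case (star_app a b)
  from star_app.prems consider x' where "x = a @ x'" "b = x' @ z"
    | a' where "a = x @ a'" "z = a' @ b"
    by (fastforce simp: append_eq_append_conv2)
  then show ?case
  proof cases
    case 1
    from star_app.IH[OF 1(2)] show ?thesis
    proof
      assume "x' \<in> star X \<and> z = []"
      then show ?thesis using 1 star_app.hyps by (auto intro: star.intros)
    next
      assume "\<exists>u v. x' = u @ v \<and> u \<in> star X \<and> z \<in> conc (lquot X v) (star X)"
      then obtain u v where "x' = u @ v" "u \<in> star X" "z \<in> conc (lquot X v) (star X)" by blast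
      with 1 star_app.hyps have "x = (a @ u) @ v" "a @ u \<in> star X" by (auto intro: star.intros)
      then show ?thesis using \<open>z \<in> _\<close> by blast
    qed
  next
    case 2
    then have "x = [] @ x" "[] \<in> star X" "z \<in> conc (lquot X x) (star X)"
      using star_app.hyps by (auto simp: conc_def intro: star.intros)
    then show ?thesis by blast
  qed
qed

lemma lquot_star:
  "lquot (star X) x = (if x \<in> star X then {[]} else {}) \<union>
    (\<Union>D\<in>{lquot X v | u v. x = u @ v \<and> u \<in> star X}. conc D (star X))" (is "?l = ?r")
proof
  show "?l \<subseteq> ?r"
  proof
    fix z assume "z \<in> ?l"
    then have "x @ z \<in> star X" by simp
    from star_split[OF this refl] show "z \<in> ?r" by auto
  qed
  show "?r \<subseteq> ?l"
    by (auto simp: conc_def star_mono_app split: if_splits) (metis append.assoc star_app star_mono_app)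
qed

lemma fin_quot_star:
  assumes "fin_quot X"
  shows "fin_quot (star X)"
proof (rule fin_quot_subset)
  let ?F = "(\<lambda>(B, E). B \<union> (\<Union>D\<in>E. conc D (star X))) ` ({{[]}, {}} \<times> Pow (range (lquot X)))"
  show "finite ?F" using assms by (simp add: fin_quot_def)
  show "lquot (star X) x \<in> ?F" for x
    unfolding lquot_star
    by (rule image_eqI[where x = "(if x \<in> star X then {[]} else {},
      {lquot X v | u v. x = u @ v \<and> u \<in> star X})"]) auto
qed

text \<open>Injectivity makes the quotient by a letter \<open>f b\<close> the image of the quotient
  by \<open>b\<close>; a letter outside the range of \<open>f\<close> leaves nothing.\<close>

lemma fin_quot_map:
  assumes "fin_quot X" "inj f"
  shows "fin_quot (map f ` X)"
proof (rule fin_quotI)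
  let ?F = "insert {} ((`) (map f) ` range (lquot X))"
  show "finite ?F" using assms by (simp add: fin_quot_def)
  show "map f ` X \<in> ?F" by (auto intro: image_eqI[of _ _ "[]"] simp: image_iff intro!: exI[of _ "[]"])
  fix Y a assume "Y \<in> ?F"
  then consider "Y = {}" | x where "Y = map f ` lquot X x" by auto
  then show "lquot Y [a] \<in> ?F"
  proof cases
    case 2
    show ?thesis
    proof (cases "a \<in> range f")
      case True
      then obtain b where "a = f b" by blast
      then have "lquot Y [a] = map f ` lquot X (x @ [b])"
        using \<open>inj f\<close> 2 by (force simp: lquot_def image_iff Cons_eq_map_conv inj_eq)
      then show ?thesis by blast
    next
      case False
      then have "lquot Y [a] = {}" using 2 by (auto simp: Cons_eq_map_conv)
      then show ?thesis by blast
    qed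
  qed (simp add: lquot_def)
qed

text \<open>With \<open>h = Hash1\<close> these are all ways of writing the words of
  \<open>X\<close> as a product of two factors, as the multiplication table does.\<close>

definition ins :: "'a \<Rightarrow> 'a list set \<Rightarrow> 'a list set" where
  "ins h X = {u @ h # v | u v. u @ v \<in> X}"

text \<open>Before \<open>h\<close> is read the quotient is again an insertion, afterwards it is a
  plain quotient. The phases are told apart because \<open>h\<close> does not occur in the words of
  \<open>X\<close>.\<close>

lemma fin_quot_ins:
  assumes "fin_quot X" "\<And>w. w \<in> X \<Longrightarrow> h \<notin> set w"
  shows "fin_quot (ins h X)"
proof (rule fin_quotI)
  let ?Q = "range (lquot X)"
  let ?F = "?Q \<union> ins h ` ?Q"
  show "finite ?F" using assms by (simp add: fin_quot_def)
  show "ins h X \<in> ?F" by (metis UnI2 imageI lquot_Nil rangeI)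
  fix Y a assume "Y \<in> ?F"
  then consider x where "Y = lquot X x" | x where "Y = ins h (lquot X x)" by auto
  then show "lquot Y [a] \<in> ?F"
  proof cases
    case 1
    then show ?thesis by auto
  next
    case 2
    show ?thesis
    proof (cases "a = h")
      case True
      then have "lquot Y [a] = lquot X x"
        using 2 assms(2) by (force simp: lquot_def ins_def Cons_eq_append_conv)
      then show ?thesis by blast
    next
      case False
      then have "lquot Y [a] = ins h (lquot X (x @ [a]))"
        using 2 by (force simp: lquot_def ins_def Cons_eq_append_conv)
      then show ?thesis by blast
    qed
  qed
qed

section \<open>Finite automata\<close>

lemma nfa_path_append:
  "nfa_path M p (u @ v) r \<longleftrightarrow> (\<exists>q. nfa_path M p u q \<and> nfa_path M q v r)"
proof (induction u arbitrary: p)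
  case Nil
  then show ?case by (auto elim: nfa_path.cases intro: nfa_path.intros)
next
  case (Cons a u)
  have *: "nfa_path M p (a # w) r \<longleftrightarrow> (\<exists>q. (p, a, q) \<in> set (nfa_trans M) \<and> nfa_path M q w r)" for w r
    by (auto elim: nfa_path.cases intro: nfa_path.intros)
  show ?case by (auto simp: * Cons.IH)
qed

lemma nfa_path_Nil [simp]: "nfa_path M p [] q \<longleftrightarrow> p = q"
  by (auto elim: nfa_path.cases intro: nfa_path.intros)

lemma nfa_path_Cons:
  "nfa_path M p (a # w) r \<longleftrightarrow> (\<exists>q. (p, a, q) \<in> set (nfa_trans M) \<and> nfa_path M q w r)"
  by (auto elim: nfa_path.cases intro: nfa_path.intros)

text \<open>The automaton whose states are the left quotients; \<open>e\<close> numbers them,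
  because states are natural numbers. Finiteness of \<open>B\<close> makes the list of transitions
  finite.\<close>

lemma fin_quot_regular:
  assumes "fin_quot X" "X \<subseteq> lists B" "finite B"
  shows "regular_lang X"
proof -
  define Q where "Q = range (lquot X)"
  have fin: "finite Q" using assms(1) by (simp add: fin_quot_def Q_def)
  have closed: "D \<in> Q \<Longrightarrow> lquot D [a] \<in> Q" for D a
    unfolding Q_def by (rule lquot_in_range)
  from finite_imp_inj_to_nat_seg[OF fin] obtain e :: "'a list set \<Rightarrow> nat"
    where e: "inj_on e Q" by auto
  let ?T = "(\<lambda>(D, a). (e D, a, e (lquot D [a]))) ` (Q \<times> B)"
  have "finite ?T" by (intro finite_imageI finite_cartesian_product fin assms(3))
  from finite_list[OF this] obtain tr where tr: "set tr = ?T" ..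
  have "finite (e ` {D \<in> Q. [] \<in> D})" using fin by simp
  from finite_list[OF this] obtain fs where fs: "set fs = e ` {D \<in> Q. [] \<in> D}" ..
  define M where "M = \<lparr>nfa_init = [e X], nfa_final = fs, nfa_trans = tr\<rparr>"
  have trE: "(i, a, j) \<in> set tr \<longleftrightarrow> (\<exists>D\<in>Q. a \<in> B \<and> i = e D \<and> j = e (lquot D [a]))" for i a j
    unfolding tr by (auto simp: image_iff)
  have path: "nfa_path M (e D) w r \<longleftrightarrow> w \<in> lists B \<and> r = e (lquot D w)" if "D \<in> Q" for D w r
    using that
  proof (induction w arbitrary: D)
    case (Cons a w)
    have "lquot D [a] \<in> Q" using Cons.prems by (rule closed)
    moreover have "(e D, a, q) \<in> set tr \<longleftrightarrow> a \<in> B \<and> q = e (lquot D [a])" for q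
      unfolding trE using Cons.prems inj_on_eq_iff[OF e] by metis
    ultimately show ?case
      using Cons.IH[of "lquot D [a]"] by (auto simp: nfa_path_Cons M_def)
  qed (auto simp: M_def)
  have X: "X \<in> Q" unfolding Q_def by (metis lquot_Nil rangeI)
  have "w \<in> nfa_lang M \<longleftrightarrow> w \<in> X" for w
  proof -
    have "w \<in> nfa_lang M \<longleftrightarrow> w \<in> lists B \<and> e (lquot X w) \<in> set fs"
      using path[OF X, of w] by (auto simp: nfa_lang_def M_def)
    also have "\<dots> \<longleftrightarrow> w \<in> lists B \<and> [] \<in> lquot X w"
      unfolding fs using inj_on_image_mem_iff[OF e, of "lquot X w" "{D \<in> Q. [] \<in> D}"]
      by (auto simp: Q_def)
    finally show ?thesis using assms(2) by auto
  qed
  then show ?thesis unfolding regular_lang_def by blast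
qed

lemma regular_rev:
  assumes "regular_lang X"
  shows "regular_lang (rev ` X)"
proof -
  from assms obtain M where X: "X = nfa_lang M" by (auto simp: regular_lang_def)
  define N where "N = \<lparr>nfa_init = nfa_final M, nfa_final = nfa_init M,
    nfa_trans = map (\<lambda>(p, a, q). (q, a, p)) (nfa_trans M)\<rparr>"
  have path: "nfa_path N q (rev w) p \<longleftrightarrow> nfa_path M p w q" for p q w
  proof (induction w arbitrary: p)
    case (Cons a w)
    have "(q, a, p) \<in> set (nfa_trans N) \<longleftrightarrow> (p, a, q) \<in> set (nfa_trans M)" for p q
      by (force simp: N_def)
    then show ?case by (auto simp: nfa_path_append nfa_path_Cons Cons.IH)
  qed auto
  have "rev ` X = nfa_lang N"
  proof (intro equalityI subsetI)
    fix w assume "w \<in> nfa_lang N"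
    then obtain p q where "p \<in> set (nfa_init M)" "q \<in> set (nfa_final M)" "nfa_path N q w p"
      by (auto simp: nfa_lang_def N_def)
    then have "rev w \<in> X" using path[of q "rev w" p] by (auto simp: X nfa_lang_def)
    then show "w \<in> rev ` X" by (metis imageI rev_rev_ident)
  qed (auto simp: X nfa_lang_def path, auto simp: N_def)
  then show ?thesis by (auto simp: regular_lang_def)
qed

lemma nfa_path_map:
  assumes "nfa_trans N = map (\<lambda>(p, a, q). (p, f a, q)) (nfa_trans M)"
  shows "nfa_path N p v q \<longleftrightarrow> (\<exists>w. v = map f w \<and> nfa_path M p w q)"
proof (induction v arbitrary: p)
  case (Cons b v)
  have "(p, b, q) \<in> set (nfa_trans N) \<longleftrightarrow> (\<exists>a. b = f a \<and> (p, a, q) \<in> set (nfa_trans M))" for q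
    by (force simp: assms)
  then show ?case by (auto simp: nfa_path_Cons Cons.IH Cons_eq_map_conv) (metis list.simps(9) nfa_path_Cons)+
qed auto

lemma nfa_lang_map:
  "nfa_lang \<lparr>nfa_init = nfa_init M, nfa_final = nfa_final M,
    nfa_trans = map (\<lambda>(p, a, q). (p, f a, q)) (nfa_trans M)\<rparr> = map f ` nfa_lang M"
  by (auto simp: nfa_lang_def nfa_path_map[where f = f and M = M] image_iff)

lemma rational_rel_converse:
  assumes "rational_rel R"
  shows "rational_rel (R\<inverse>)"
proof -
  from assms obtain T where
    R: "R = {(concat (map fst w), concat (map snd w)) | w. w \<in> nfa_lang T}"
    by (auto simp: rational_rel_def)
  show ?thesis
    unfolding rational_rel_def
    by (rule exI[of _ "\<lparr>nfa_init = nfa_init T, nfa_final = nfa_final T,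
      nfa_trans = map (\<lambda>(p, a, q). (p, prod.swap a, q)) (nfa_trans T)\<rparr>"])
       (unfold nfa_lang_map, force simp: R comp_def)
qed

lemma deltaR_decode:
  "concat (map (case_option [] (\<lambda>a. [a]) \<circ> fst) (deltaR (u, v))) = u \<and>
   concat (map (case_option [] (\<lambda>a. [a]) \<circ> snd) (deltaR (u, v))) = v"
proof -
  have 1: "concat (map (case_option [] (\<lambda>a. [a]) \<circ> fst) (zip xs ys)) =
      concat (map (case_option [] (\<lambda>a. [a])) xs)"
    "concat (map (case_option [] (\<lambda>a. [a]) \<circ> snd) (zip xs ys)) =
      concat (map (case_option [] (\<lambda>a. [a])) ys)"
    if "length xs = length ys" for xs ys :: "'a option list"
    using that by (induction rule: list_induct2) auto
  have 2: "concat (map (case_option [] (\<lambda>a. [a])) (map Some xs @ replicate n None)) = xs"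
    for xs :: "'a list" and n
  proof (induction xs)
    case Nil show ?case by (induction n) auto
  qed auto
  show ?thesis by (simp add: deltaR_def 1 2 del: map_append)
qed

text \<open>A synchronous automaton becomes a transducer by reading the padding symbol as the empty
  word on each track.\<close>

lemma regular_imp_rational:
  assumes "regular_lang (deltaR ` R)"
  shows "rational_rel R"
proof -
  from assms obtain M where M: "deltaR ` R = nfa_lang M" by (auto simp: regular_lang_def)
  let ?o = "case_option [] (\<lambda>a. [a])"
  let ?f = "\<lambda>(a, b). (?o a, ?o b)"
  have "{(concat (map fst w), concat (map snd w)) | w. w \<in> map ?f ` nfa_lang M} = R"
  proof -
    have *: "(concat (map fst (map ?f (deltaR r))), concat (map snd (map ?f (deltaR r)))) = r" for r
      using deltaR_decode[of "fst r" "snd r"] by (simp add: comp_def case_prod_beta)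
    have "{(concat (map fst w), concat (map snd w)) | w. w \<in> map ?f ` nfa_lang M} =
      (\<lambda>r. (concat (map fst (map ?f (deltaR r))), concat (map snd (map ?f (deltaR r))))) ` R"
      unfolding M[symmetric] by blast
    also have "\<dots> = R" unfolding * by simp
    finally show ?thesis .
  qed
  then show ?thesis
    unfolding rational_rel_def
    by (intro exI[of _ "\<lparr>nfa_init = nfa_init M, nfa_final = nfa_final M,
      nfa_trans = map (\<lambda>(p, a, q). (p, ?f a, q)) (nfa_trans M)\<rparr>"]) (simp only: nfa_lang_map)
qed

text \<open>\<open>us\<close> are the factors consumed once \<open>x\<close> is covered, and
  \<open>s\<close> is the overhang of the last of them. For \<open>x = []\<close> nothing is
  consumed and there is no overhang.\<close>

lemma concat_split:
  "x @ z = concat ws \<Longrightarrow> \<exists>us s vs. ws = us @ vs \<and> concat us = x @ s \<and> z = s @ concat vs \<and>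
    (s = [] \<or> (\<exists>w\<in>set ws. suffix s w))"
proof (induction ws arbitrary: x)
  case Nil
  then show ?case by auto
next
  case (Cons w ws)
  show ?case
  proof (cases "x = []")
    case True
    then show ?thesis using Cons.prems
      by (intro exI[of _ "[]"] exI[of _ "w # ws"]) auto
  next
    case False
    from Cons.prems consider s where "w = x @ s" "z = s @ concat ws"
      | x' where "x = w @ x'" "x' @ z = concat ws"
      by (fastforce simp: append_eq_append_conv2)
    then show ?thesis
    proof cases
      case 1
      then show ?thesis
        by (intro exI[of _ "[w]"] exI[of _ s] exI[of _ ws]) (auto simp: suffix_def)
    next
      case 2
      from Cons.IH[OF 2(2)] obtain us s vs where "ws = us @ vs" "concat us = x' @ s"
        "z = s @ concat vs" "s = [] \<or> (\<exists>w\<in>set ws. suffix s w)" by blast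
      then show ?thesis using 2
        by (intro exI[of _ "w # us"] exI[of _ s] exI[of _ vs]) auto
    qed
  qed
qed

text \<open>After a prefix \<open>x\<close> of the image word has been produced, a run of the transducer is
  described by the overhang \<open>s\<close> of the current label beyond \<open>x\<close>, the state, and the left quotient
  of \<open>R\<close> by the output; the overhangs are suffixes of images of labels, hence finite in number.\<close>

lemma fin_quot_rational_preimage:
  fixes T :: "('a list \<times> 'c list) set" and h :: "'a \<Rightarrow> 'b list"
  assumes "rational_rel T" "fin_quot R"
  shows "fin_quot {concat (map h u) | u. \<exists>v\<in>R. (u, v) \<in> T}" (is "fin_quot ?X")
proof -
  from assms(1) obtain N where
    T: "T = {(concat (map fst w), concat (map snd w)) | w. w \<in> nfa_lang N}"
    by (auto simp: rational_rel_def)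
  let ?H = "\<lambda>u. concat (map h u)"
  let ?S = "insert [] (\<Union>(p, a, q)\<in>set (nfa_trans N). {s. suffix s (?H (fst a))})"
  let ?P = "insert undefined (set (nfa_init N) \<union> snd ` snd ` set (nfa_trans N))"
  let ?hc = "\<lambda>w. concat (map (?H \<circ> fst) w)" and ?vc = "\<lambda>w. concat (map snd w)"
  define C where "C x = {(s, q, D). s \<in> ?S \<and> (\<exists>p\<in>set (nfa_init N). \<exists>w. nfa_path N p w q \<and>
      ?hc w = x @ s \<and> D = lquot R (?vc w))}" for x
  \<comment> \<open>\<open>A\<close> reads the remaining output off a set of configurations, so the
    quotient depends on \<open>x\<close> only through \<open>C x\<close>.\<close>
  define A where "A K = {z. \<exists>(s, q, D)\<in>K. \<exists>z' w. z = s @ z' \<and> (\<exists>r\<in>set (nfa_final N).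
      nfa_path N q w r) \<and> ?hc w = z' \<and> ?vc w \<in> D}" for K
  have Hc: "?H (concat (map fst w)) = ?hc w" for w :: "('a list \<times> 'c list) list"
    by (induction w) auto
  have labels: "nfa_path N p w q \<Longrightarrow> a \<in> set w \<Longrightarrow> \<exists>p' q'. (p', a, q') \<in> set (nfa_trans N)" for p w q a
    by (induction rule: nfa_path.induct) auto
  have target: "nfa_path N p w q \<Longrightarrow> p \<in> ?P \<Longrightarrow> q \<in> ?P" for p w q
  proof (induction rule: nfa_path.induct)
    case (2 p a q w r)
    have "q \<in> snd ` snd ` set (nfa_trans N)"
      by (rule image_eqI[OF _ image_eqI[OF _ 2(1)]]) simp_all
    then have "q \<in> ?P" by simp
    then show ?case by (rule 2(3))
  qed
  have X: "?X = {?hc w | w. w \<in> nfa_lang N \<and> ?vc w \<in> R}"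
    unfolding T Hc[symmetric] by blast
  have quot: "lquot ?X x = A (C x)" for x
  proof (intro equalityI subsetI)
    fix z assume "z \<in> lquot ?X x"
    then have "x @ z \<in> {?hc w | w. w \<in> nfa_lang N \<and> ?vc w \<in> R}"
      unfolding X lquot_def by blast
    then obtain w where "x @ z = ?hc w" "w \<in> nfa_lang N" "?vc w \<in> R" by blast
    then obtain p r where w: "x @ z = ?hc w" "p \<in> set (nfa_init N)" "r \<in> set (nfa_final N)"
      "nfa_path N p w r" "?vc w \<in> R"
      unfolding nfa_lang_def by blast
    from concat_split[OF w(1)] obtain us s vs where s: "map (?H \<circ> fst) w = us @ vs" "concat us = x @ s"
      "z = s @ concat vs" "s = [] \<or> (\<exists>w'\<in>set (map (?H \<circ> fst) w). suffix s w')" by blast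
    from s(1) obtain w1 w2 where w12: "w = w1 @ w2" "us = map (?H \<circ> fst) w1" "vs = map (?H \<circ> fst) w2"
      by (auto simp: map_eq_append_conv)
    from w(4) obtain q where q: "nfa_path N p w1 q" "nfa_path N q w2 r"
      by (auto simp: w12 nfa_path_append)
    have "s \<in> ?S"
    proof (cases "s = []")
      case False
      with s(4) obtain a where "a \<in> set w" "suffix s (?H (fst a))" by auto
      with labels[OF w(4)] show ?thesis by fastforce
    qed simp
    then have "(s, q, lquot R (?vc w1)) \<in> C x"
      unfolding C_def using w(2) q(1) s(2) w12(2) by auto
    moreover have "?vc w2 \<in> lquot R (?vc w1)" using w(5) w12 by simp
    ultimately show "z \<in> A (C x)"
      unfolding A_def using q(2) w(3) s(3) w12(3)
      by (intro CollectI bexI[of _ "(s, q, lquot R (?vc w1))"]) auto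
  next
    fix z assume "z \<in> A (C x)"
    then obtain s q D w2 r where A: "(s, q, D) \<in> C x" "z = s @ ?hc w2"
      "r \<in> set (nfa_final N)" "nfa_path N q w2 r" "?vc w2 \<in> D"
      unfolding A_def by blast
    then obtain p w1 where B: "p \<in> set (nfa_init N)" "nfa_path N p w1 q"
      "?hc w1 = x @ s" "D = lquot R (?vc w1)"
      unfolding C_def by blast
    have "nfa_path N p (w1 @ w2) r"
      unfolding nfa_path_append using A(4) B(2) by blast
    then have "w1 @ w2 \<in> nfa_lang N"
      unfolding nfa_lang_def using A(3) B(1) by blast
    moreover have "?vc (w1 @ w2) \<in> R" "x @ z = ?hc (w1 @ w2)" using A B by simp_all
    ultimately show "z \<in> lquot ?X x"
      unfolding X lquot_def by (intro CollectI exI[of _ "w1 @ w2"] conjI)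
  qed
  have C: "C x \<in> Pow (?S \<times> ?P \<times> range (lquot R))" for x
  proof (intro PowI subsetI)
    fix k assume "k \<in> C x"
    then obtain s q D p w where k: "k = (s, q, D)" "s \<in> ?S" "p \<in> set (nfa_init N)"
      "nfa_path N p w q" "D = lquot R (?vc w)" unfolding C_def by blast
    then have "q \<in> ?P" by (intro target[of p w q]) auto
    with k show "k \<in> ?S \<times> ?P \<times> range (lquot R)" by blast
  qed
  have fin: "finite (Pow (?S \<times> ?P \<times> range (lquot R)))"
  proof -
    have "finite {s. suffix s y}" for y :: "'b list"
      unfolding set_suffixes_eq[symmetric] by simp
    then have "finite ?S" by (simp add: case_prod_beta)
    then show ?thesis using assms(2) by (simp add: fin_quot_def)
  qed
  show ?thesis
  proof (rule fin_quot_subset)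
    show "finite (A ` Pow (?S \<times> ?P \<times> range (lquot R)))"
      using fin by (rule finite_imageI)
    show "lquot ?X x \<in> A ` Pow (?S \<times> ?P \<times> range (lquot R))" for x
      unfolding quot using C by (rule imageI)
  qed
qed

section \<open>Context-free languages\<close>

text \<open>Big-step derivations with one rule per leading symbol, over an arbitrary type of
  nonterminals. Grammars can thus be built on structured nonterminals such as pairs of left
  quotients; \<open>cfl_nt\<close> renumbers them.\<close>

inductive yields :: "('n \<times> ('n + 't) list) set \<Rightarrow> ('n + 't) list \<Rightarrow> 't list \<Rightarrow> bool" for P where
  yields_Nil: "yields P [] []"
| yields_T: "yields P \<alpha> w \<Longrightarrow> yields P (Inr a # \<alpha>) (a # w)"
| yields_N: "(N, r) \<in> P \<Longrightarrow> yields P r u \<Longrightarrow> yields P \<alpha> v \<Longrightarrow> yields P (Inl N # \<alpha>) (u @ v)"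

text \<open>The language of a right-hand side when each nonterminal \<open>N\<close> stands for
  \<open>L N\<close>. A grammar is thereby read as a system of inclusions
  \<open>sat L r \<subseteq> L N\<close>.\<close>

fun sat :: "('n \<Rightarrow> 't list set) \<Rightarrow> ('n + 't) list \<Rightarrow> 't list set" where
  "sat L [] = {[]}"
| "sat L (Inl N # \<alpha>) = conc (L N) (sat L \<alpha>)"
| "sat L (Inr a # \<alpha>) = (#) a ` sat L \<alpha>"

definition nt :: "('n \<times> ('n + 't) list) set \<Rightarrow> 'n \<Rightarrow> 't list set" where
  "nt P N = {w. yields P [Inl N] w}"

lemma concI: "x \<in> X \<Longrightarrow> y \<in> Y \<Longrightarrow> x @ y \<in> conc X Y"
  by (auto simp: conc_def)

lemma concE:
  assumes "w \<in> conc X Y" obtains x y where "w = x @ y" "x \<in> X" "y \<in> Y"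
  using assms by (auto simp: conc_def)

lemma yields_Nil_iff [simp]: "yields P [] w \<longleftrightarrow> w = []"
  by (auto elim: yields.cases intro: yields.intros)

lemma yields_T_iff [simp]: "yields P (Inr a # \<alpha>) w \<longleftrightarrow> (\<exists>w'. w = a # w' \<and> yields P \<alpha> w')"
  by (auto elim: yields.cases intro: yields.intros)

lemma yields_N_iff:
  "yields P (Inl N # \<alpha>) w \<longleftrightarrow> (\<exists>r u v. (N, r) \<in> P \<and> yields P r u \<and> yields P \<alpha> v \<and> w = u @ v)"
proof
  show "yields P (Inl N # \<alpha>) w \<Longrightarrow> \<exists>r u v. (N, r) \<in> P \<and> yields P r u \<and> yields P \<alpha> v \<and> w = u @ v"
    by (erule yields.cases) auto
qed (auto intro: yields_N)

lemma nt_iff: "w \<in> nt P N \<longleftrightarrow> (\<exists>r. (N, r) \<in> P \<and> yields P r w)"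
  by (auto simp: nt_def yields_N_iff)

lemma yields_iff_sat: "yields P \<alpha> w \<longleftrightarrow> w \<in> sat (nt P) \<alpha>"
proof (induction \<alpha> arbitrary: w)
  case (Cons x \<alpha>)
  show ?case
  proof (cases x)
    case (Inl N)
    then show ?thesis
      by (auto simp: Cons.IH yields_N_iff[of P N \<alpha>] nt_iff conc_def)
  qed (auto simp: Cons.IH)
qed simp

lemma sat_mono: "(\<And>N. K N \<subseteq> L N) \<Longrightarrow> sat K \<alpha> \<subseteq> sat L \<alpha>"
proof (induction \<alpha>)
  case (Cons x \<alpha>)
  then show ?case by (cases x) (auto simp: conc_def, blast+)
qed simp

lemma yields_sound:
  assumes "\<And>N r. (N, r) \<in> P \<Longrightarrow> sat L r \<subseteq> L N" "yields P \<alpha> w"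
  shows "w \<in> sat L \<alpha>"
  using assms(2)
proof (induction rule: yields.induct)
  case (yields_N N r u \<alpha> v)
  then show ?case using assms(1)[OF yields_N(1)] by (auto intro: concI)
qed auto

text \<open>\<open>nt P\<close> is the least solution of the inclusions of the grammar. Upper bounds
  on generated languages are therefore proved by guessing \<open>L\<close> and checking each
  production.\<close>

lemma nt_sound:
  assumes "\<And>N r. (N, r) \<in> P \<Longrightarrow> sat L r \<subseteq> L N"
  shows "nt P N \<subseteq> L N"
proof
  fix w assume "w \<in> nt P N"
  then have "w \<in> sat L [Inl N]" by (intro yields_sound[OF assms]) (auto simp: nt_def)
  then show "w \<in> L N" by (auto simp: conc_def)
qed

lemma sat_append: "sat L (\<alpha> @ \<beta>) = conc (sat L \<alpha>) (sat L \<beta>)"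
proof (induction \<alpha>)
  case (Cons x \<alpha>)
  then show ?case
    by (cases x) (auto simp: conc_def image_iff, (metis append.assoc append_Cons)+)
qed (simp add: conc_def)

lemma yields_append:
  "yields P (\<alpha> @ \<beta>) w \<longleftrightarrow> (\<exists>u v. w = u @ v \<and> yields P \<alpha> u \<and> yields P \<beta> v)"
  unfolding yields_iff_sat sat_append by (auto simp: conc_def)

lemma sat_map_Inr [simp]: "sat L (map Inr w) = {w}"
  by (induction w) auto

lemma yields_map_Inr [simp]: "yields P (map Inr w) v \<longleftrightarrow> v = w"
  by (simp add: yields_iff_sat)

lemma cfg_step_context: "cfg_step G x y \<Longrightarrow> cfg_step G (u @ x @ v) (u @ y @ v)"
  unfolding cfg_step_def by (metis append.assoc append_Cons)

lemma cfg_steps_context: "(cfg_step G)\<^sup>*\<^sup>* x y \<Longrightarrow> (cfg_step G)\<^sup>*\<^sup>* (u @ x @ v) (u @ y @ v)"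
  by (induction rule: rtranclp_induct)
     (auto intro: cfg_step_context rtranclp.rtrancl_into_rtrancl)

text \<open>Forwards, a big-step derivation is pulled back through one rewriting step by cutting the
  word around the rewritten nonterminal. Backwards, the leading nonterminal is rewritten first and
  the derivations of the two parts run in context.\<close>

lemma cfg_steps_iff_yields:
  "(cfg_step G)\<^sup>*\<^sup>* \<alpha> (map Inr w) \<longleftrightarrow> yields (set (cfg_prods G)) \<alpha> w"
proof
  assume "(cfg_step G)\<^sup>*\<^sup>* \<alpha> (map Inr w)"
  then show "yields (set (cfg_prods G)) \<alpha> w"
  proof (induction rule: converse_rtranclp_induct)
    case (step x y)
    then obtain u v N r where r: "(N, r) \<in> set (cfg_prods G)" "x = u @ [Inl N] @ v" "y = u @ r @ v"
      by (auto simp: cfg_step_def)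
    with step.IH obtain a b c where w: "w = a @ b @ c"
      "yields (set (cfg_prods G)) u a" "yields (set (cfg_prods G)) r b" "yields (set (cfg_prods G)) v c"
      by (auto simp: yields_append)
    then have "yields (set (cfg_prods G)) [Inl N] b"
      unfolding yields_N_iff using r(1) by auto
    with w show ?case unfolding r(2) yields_append by blast
  qed simp
next
  assume "yields (set (cfg_prods G)) \<alpha> w"
  then show "(cfg_step G)\<^sup>*\<^sup>* \<alpha> (map Inr w)"
  proof (induction rule: yields.induct)
    case (yields_T \<alpha> w a)
    then show ?case using cfg_steps_context[of G \<alpha> "map Inr w" "[Inr a]" "[]"] by simp
  next
    case (yields_N N r u \<alpha> v)
    have "cfg_step G (Inl N # \<alpha>) (r @ \<alpha>)"
      unfolding cfg_step_def by (rule exI[of _ "[]"]) (use yields_N(1) in auto)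
    also have "(cfg_step G)\<^sup>*\<^sup>* (r @ \<alpha>) (map Inr u @ \<alpha>)"
      using cfg_steps_context[OF yields_N(4), of "[]" \<alpha>] by simp
    also have "(cfg_step G)\<^sup>*\<^sup>* (map Inr u @ \<alpha>) (map Inr u @ map Inr v)"
      using cfg_steps_context[OF yields_N(5), of "map Inr u" "[]"] by simp
    finally show ?case by simp
  qed simp
qed

lemma cfg_lang_eq_nt: "cfg_lang G = nt (set (cfg_prods G)) (cfg_start G)"
  unfolding cfg_lang_def nt_def cfg_steps_iff_yields ..

section \<open>Closure properties of context-free languages\<close>

definition cfl :: "'t list set \<Rightarrow> bool" where
  "cfl L \<longleftrightarrow> (\<exists>G. L = cfg_lang G)"

lemma cflE:
  assumes "cfl L"
  obtains P :: "(nat \<times> (nat + 't) list) set" and N where "finite P" "L = nt P N"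
  using assms unfolding cfl_def cfg_lang_eq_nt by (metis List.finite_set)

abbreviation rename :: "('n \<Rightarrow> 'm) \<Rightarrow> ('n + 't) list \<Rightarrow> ('m + 't) list" where
  "rename f \<equiv> map (map_sum f id)"

lemma yields_rename:
  assumes "\<And>N r. (N, r) \<in> P \<Longrightarrow> (f N, rename f r) \<in> P'" "yields P \<alpha> w"
  shows "yields P' (rename f \<alpha>) w"
  using assms(2)
proof (induction rule: yields.induct)
  case (yields_N N r u \<alpha> v)
  from yields.yields_N[OF assms(1)[OF yields_N(1)] yields_N(4,5)] show ?case by simp
qed auto

lemma nt_rename:
  assumes "\<And>N r. (N, r) \<in> P \<Longrightarrow> (f N, rename f r) \<in> P'"
  shows "nt P N \<subseteq> nt P' (f N)"
  unfolding nt_def using yields_rename[of P f P', OF assms, of "[Inl N]"] by auto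

lemma sat_rename [simp]: "sat L (rename f \<alpha>) = sat (L \<circ> f) \<alpha>"
proof (induction \<alpha>)
  case (Cons x \<alpha>)
  then show ?case by (cases x) auto
qed simp

lemma sat_cong: "(\<And>N. Inl N \<in> set \<alpha> \<Longrightarrow> K N = L N) \<Longrightarrow> sat K \<alpha> = sat L \<alpha>"
proof (induction \<alpha>)
  case (Cons x \<alpha>)
  then show ?case by (cases x) auto
qed simp

text \<open>Only the finitely many nonterminals in \<open>NT\<close> matter, and \<open>f\<close>
  numbers these. The guessed solution \<open>L\<close> transports the generated languages along
  \<open>f\<close> and is empty at numbers not in use.\<close>

lemma cfl_nt:
  fixes P :: "('n \<times> ('n + 't) list) set"
  assumes "finite P"
  shows "cfl (nt P N)"
proof -
  define NT where "NT = insert N (fst ` P \<union> (\<Union>r\<in>snd ` P. {M. Inl M \<in> set r}))"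
  have "{M. Inl M \<in> set r} = projl ` (set r \<inter> range Inl)" for r :: "('n + 't) list"
    by force
  then have "finite NT" unfolding NT_def using assms by simp
  from finite_imp_inj_to_nat_seg[OF this] obtain f :: "'n \<Rightarrow> nat" where f: "inj_on f NT" by auto
  define P' where "P' = (\<lambda>(M, r). (f M, rename f r)) ` P"
  have "finite P'" unfolding P'_def using assms by simp
  from finite_list[OF this] obtain ps where ps: "set ps = P'" ..
  define L where "L k = (\<Union>M\<in>{M \<in> NT. f M = k}. nt P M)" for k
  have L: "L (f M) = nt P M" if "M \<in> NT" for M
  proof -
    have "{K \<in> NT. f K = f M} = {M}" using that inj_onD[OF f] by blast
    then show ?thesis by (simp add: L_def)
  qed
  have "nt P' (f N) \<subseteq> L (f N)"
  proof (rule nt_sound)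
    fix k s assume "(k, s) \<in> P'"
    then obtain M r where Mr: "(M, r) \<in> P" "k = f M" "s = rename f r" by (auto simp: P'_def)
    have M: "M \<in> NT" unfolding NT_def using Mr(1) by force
    have "Inl M' \<in> set r \<Longrightarrow> M' \<in> NT" for M' unfolding NT_def using Mr(1) by force
    then have "sat L s = sat (nt P) r" using L unfolding Mr sat_rename by (intro sat_cong) auto
    also have "\<dots> \<subseteq> nt P M" using Mr(1) by (auto simp: nt_iff yields_iff_sat)
    finally show "sat L s \<subseteq> L k" using M by (simp add: Mr L)
  qed
  moreover have "nt P N \<subseteq> nt P' (f N)"
    by (rule nt_rename) (force simp: P'_def)
  moreover have "N \<in> NT" by (simp add: NT_def)
  ultimately have "nt P N = cfg_lang \<lparr>cfg_start = f N, cfg_prods = ps\<rparr>"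
    using L by (simp add: cfg_lang_eq_nt ps)
  then show ?thesis unfolding cfl_def by blast
qed

text \<open>Union and concatenation in one construction: the nonterminals of the \<open>i\<close>-th
  grammar are tagged with \<open>i\<close>, and a new start symbol \<open>None\<close> receives the
  right-hand sides in \<open>R\<close>.\<close>

lemma cfl_sat:
  fixes L :: "'i :: finite \<Rightarrow> 't list set"
  assumes "\<And>i. cfl (L i)" "finite R"
  shows "cfl (\<Union>r\<in>R. sat L r)"
proof -
  have "\<exists>P :: (nat \<times> (nat + 't) list) set. \<exists>N. finite P \<and> L i = nt P N" for i
    using cflE[OF assms(1)] by metis
  then obtain P :: "'i \<Rightarrow> (nat \<times> (nat + 't) list) set" and S where
    P: "\<And>i. finite (P i)" "\<And>i. L i = nt (P i) (S i)" by metis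
  define Q where "Q = (\<lambda>r. (None, rename (\<lambda>i. Some (i, S i)) r)) ` R \<union>
    (\<Union>i. (\<lambda>(N, r). (Some (i, N), rename (\<lambda>N. Some (i, N)) r)) ` P i)"
  define K where "K = case_option (\<Union>r\<in>R. sat L r) (\<lambda>(i, N). nt (P i) N)"
  have "finite Q" unfolding Q_def using assms(2) P(1) by simp
  moreover have "nt Q None \<subseteq> K None"
  proof (rule nt_sound)
    fix M s assume "(M, s) \<in> Q"
    then consider r where "r \<in> R" "M = None" "s = rename (\<lambda>i. Some (i, S i)) r"
      | i N r where "(N, r) \<in> P i" "M = Some (i, N)" "s = rename (\<lambda>N. Some (i, N)) r"
      by (auto simp: Q_def)
    then show "sat K s \<subseteq> K M"
    proof cases
      case 1
      have "K \<circ> (\<lambda>i. Some (i, S i)) = L" by (auto simp: K_def P)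
      then show ?thesis using 1 by (auto simp: K_def)
    next
      case 2
      have "K \<circ> (\<lambda>N. Some (i, N)) = nt (P i)" by (auto simp: K_def)
      then show ?thesis using 2 by (auto simp: K_def nt_iff yields_iff_sat)
    qed
  qed
  moreover have "K None \<subseteq> nt Q None"
  proof
    fix w assume "w \<in> K None"
    then obtain r where r: "r \<in> R" "w \<in> sat L r" by (auto simp: K_def)
    have "L i \<subseteq> nt Q (Some (i, S i))" for i
      unfolding P(2) by (rule nt_rename[where f = "\<lambda>N. Some (i, N)"]) (force simp: Q_def)
    then have "w \<in> sat (nt Q \<circ> (\<lambda>i. Some (i, S i))) r"
      using r(2) sat_mono[of L "nt Q \<circ> (\<lambda>i. Some (i, S i))" r] by auto
    then have "yields Q (rename (\<lambda>i. Some (i, S i)) r) w" by (simp add: yields_iff_sat)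
    moreover have "(None, rename (\<lambda>i. Some (i, S i)) r) \<in> Q" unfolding Q_def using r(1) by blast
    ultimately show "w \<in> nt Q None" unfolding nt_iff by blast
  qed
  ultimately have "cfl (K None)" using cfl_nt[of Q None] by (metis subset_antisym)
  then show ?thesis by (simp add: K_def)
qed

lemma cfl_Un:
  assumes "cfl X" "cfl Y"
  shows "cfl (X \<union> Y)"
  using cfl_sat[of "\<lambda>b. if b then X else Y" "{[Inl True], [Inl False]}"] assms
  by (simp add: conc_def)

lemma cfl_conc:
  assumes "cfl X" "cfl Y"
  shows "cfl (conc X Y)"
  using cfl_sat[of "\<lambda>b. if b then X else Y" "{[Inl True, Inl False]}"] assms
  by (simp add: conc_def)

lemma cfl_empty: "cfl {}"
proof -
  have "nt ({} :: (nat \<times> (nat + 'a) list) set) 0 = {}" by (auto simp: nt_iff)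
  then show ?thesis using cfl_nt[of "{} :: (nat \<times> (nat + 'a) list) set" 0] by simp
qed

definition hom :: "('a \<Rightarrow> 'b list) \<Rightarrow> 'a list \<Rightarrow> 'b list" where
  "hom h w = concat (map h w)"

lemma hom_simps [simp]:
  "hom h [] = []" "hom h (a # w) = h a @ hom h w" "hom h (u @ v) = hom h u @ hom h v"
  by (simp_all add: hom_def)

text \<open>An operation on words that can be carried out on right-hand sides, by \<open>T\<close>,
  preserves context-freeness. Homomorphic image and reversal are the instances.\<close>

lemma cfl_transfer:
  assumes "cfl L"
    and T: "\<And>K :: nat \<Rightarrow> 't list set. \<And>r. sat (\<lambda>N. g ` K N) (T r) = g ` sat K r"
  shows "cfl (g ` L :: 's list set)"
proof -
  from cflE[OF assms(1)] obtain P :: "(nat \<times> (nat + 't) list) set" and N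
    where P: "finite P" "L = nt P N" by metis
  define Q where "Q = (\<lambda>(N, r). (N, T r)) ` P"
  have 1: "nt Q N \<subseteq> g ` nt P N" for N
  proof (rule nt_sound)
    fix M s assume "(M, s) \<in> Q"
    then obtain r where "(M, r) \<in> P" "s = T r" by (auto simp: Q_def)
    moreover from this have "sat (nt P) r \<subseteq> nt P M" by (auto simp: nt_iff yields_iff_sat)
    ultimately show "sat (\<lambda>N. g ` nt P N) s \<subseteq> g ` nt P M" using T[of "nt P" r] by auto
  qed
  have 2: "nt P M \<subseteq> {w. g w \<in> nt Q M}" for M
  proof (rule nt_sound)
    fix M r assume Mr: "(M, r) \<in> P"
    show "sat (\<lambda>M. {w. g w \<in> nt Q M}) r \<subseteq> {w. g w \<in> nt Q M}"
    proof
      fix w assume "w \<in> sat (\<lambda>M. {w. g w \<in> nt Q M}) r"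
      then have "g w \<in> sat (\<lambda>N. g ` {w. g w \<in> nt Q N}) (T r)" unfolding T by blast
      also have "\<dots> \<subseteq> sat (nt Q) (T r)" by (rule sat_mono) blast
      finally have "yields Q (T r) (g w)" by (simp add: yields_iff_sat)
      moreover have "(M, T r) \<in> Q" using Mr unfolding Q_def by force
      ultimately show "w \<in> {w. g w \<in> nt Q M}" by (auto simp: nt_iff)
    qed
  qed
  have "g ` L = nt Q N" using 1[of N] 2[of N] P(2) by blast
  moreover have "finite Q" using P(1) by (simp add: Q_def)
  ultimately show ?thesis by (simp add: cfl_nt)
qed

lemma hom_conc: "hom h ` conc X Y = conc (hom h ` X) (hom h ` Y)"
proof (intro equalityI subsetI)
  fix w assume "w \<in> hom h ` conc X Y"
  then obtain x y where "x \<in> X" "y \<in> Y" "w = hom h x @ hom h y" by (auto simp: conc_def)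
  then show "w \<in> conc (hom h ` X) (hom h ` Y)" by (auto intro!: concI)
next
  fix w assume "w \<in> conc (hom h ` X) (hom h ` Y)"
  then obtain x y where "x \<in> X" "y \<in> Y" "w = hom h (x @ y)" by (auto simp: conc_def)
  then show "w \<in> hom h ` conc X Y" by (auto intro!: imageI concI simp del: hom_simps)
qed

lemma cfl_hom:
  assumes "cfl L"
  shows "cfl (hom h ` L)"
proof (rule cfl_transfer[OF assms,
    where T = "\<lambda>r. concat (map (case_sum (\<lambda>N. [Inl N]) (\<lambda>a. map Inr (h a))) r)"])
  fix K :: "nat \<Rightarrow> 'a list set" and r
  show "sat (\<lambda>N. hom h ` K N) (concat (map (case_sum (\<lambda>N. [Inl N]) (\<lambda>a. map Inr (h a))) r)) =
    hom h ` sat K r"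
  proof (induction r)
    case (Cons x r)
    then show ?case
    proof (cases x)
      case (Inl N)
      with Cons show ?thesis by (simp add: hom_conc)
    next
      case (Inr a)
      have "hom h ` (#) a ` X = conc {h a} (hom h ` X)" for X
        by (auto simp: conc_def image_iff)
      with Inr Cons show ?thesis by (simp add: sat_append)
    qed
  qed simp
qed

lemma conc_lists: "X \<subseteq> lists B \<Longrightarrow> Y \<subseteq> lists B \<Longrightarrow> conc X Y \<subseteq> lists B"
proof
  fix w assume "X \<subseteq> lists B" "Y \<subseteq> lists B" "w \<in> conc X Y"
  moreover from this obtain x y where "w = x @ y" "x \<in> X" "y \<in> Y" by (auto elim: concE)
  ultimately have "x \<in> lists B" "y \<in> lists B" by blast+
  then show "w \<in> lists B" by (simp add: \<open>w = x @ y\<close>)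
qed

lemma conc_assoc: "conc (conc X Y) Z = conc X (conc Y Z)"
  unfolding conc_def by (auto; metis append.assoc)

lemma conc_Nil [simp]: "conc X {[]} = X" "conc {[]} X = X"
  by (auto simp: conc_def)

lemma rev_conc: "rev ` conc X Y = conc (rev ` Y) (rev ` X)"
proof (intro equalityI subsetI)
  fix w assume "w \<in> rev ` conc X Y"
  then show "w \<in> conc (rev ` Y) (rev ` X)" by (auto simp: rev_append intro!: concI elim!: concE)
next
  fix w assume "w \<in> conc (rev ` Y) (rev ` X)"
  then obtain x y where "x \<in> X" "y \<in> Y" "w = rev (x @ y)" by (auto elim!: concE)
  then show "w \<in> rev ` conc X Y" by (auto intro!: imageI concI simp del: rev_append)
qed

lemma cfl_rev:
  assumes "cfl L"
  shows "cfl (rev ` L)"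
proof (rule cfl_transfer[OF assms, where T = rev])
  fix K :: "nat \<Rightarrow> 'a list set" and r
  show "sat (\<lambda>N. rev ` K N) (rev r) = rev ` sat K r"
  proof (induction r)
    case (Cons x r)
    have 1: "(#) a ` X = conc {[a]} X" for a :: 'a and X by (auto simp: conc_def)
    show ?case using Cons by (cases x) (auto simp: sat_append 1 rev_conc)
  qed simp
qed

text \<open>A terminal in a sentential form survives into the derived word, so productions with
  terminals outside \<open>B\<close> take no part in deriving words over \<open>B\<close> and can be
  deleted. A word-hyperbolic structure restricts the terminals of the grammar itself and not only
  those of its language.\<close>

lemma cfl_terminals:
  assumes "cfl L" "L \<subseteq> lists B"
  obtains G where "L = cfg_lang G"
    "\<forall>(N, r) \<in> set (cfg_prods G). \<forall>t. Inr t \<in> set r \<longrightarrow> t \<in> B"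
proof -
  from assms(1) obtain H where "L = cfg_lang H" by (auto simp: cfl_def)
  then have H: "L = nt (set (cfg_prods H)) (cfg_start H)" by (simp add: cfg_lang_eq_nt)
  let ?ok = "\<lambda>(N, r). \<forall>t. Inr t \<in> set r \<longrightarrow> t \<in> B"
  define G where "G = \<lparr>cfg_start = cfg_start H, cfg_prods = filter ?ok (cfg_prods H)\<rparr>"
  have sub: "yields P \<alpha> w \<Longrightarrow> Inr t \<in> set \<alpha> \<Longrightarrow> t \<in> set w" for P :: "(nat \<times> (nat + 'a) list) set" and \<alpha> w t
    by (induction rule: yields.induct) auto
  have trim: "yields (set (cfg_prods H)) \<alpha> w \<Longrightarrow> set w \<subseteq> B \<Longrightarrow> yields (set (cfg_prods G)) \<alpha> w" for \<alpha> w
  proof (induction rule: yields.induct)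
    case (yields_N N r u \<alpha> v)
    have "(N, r) \<in> set (cfg_prods G)"
      using yields_N sub[OF yields_N(2)] by (auto simp: G_def)
    then show ?case using yields_N by (auto intro: yields.intros)
  qed (auto intro: yields.intros)
  have "nt (set (cfg_prods G)) (cfg_start H) \<subseteq> nt (set (cfg_prods H)) (cfg_start H)"
  proof (rule nt_sound)
    fix N r assume "(N, r) \<in> set (cfg_prods G)"
    then have "(N, r) \<in> set (cfg_prods H)" by (simp add: G_def)
    then show "sat (nt (set (cfg_prods H))) r \<subseteq> nt (set (cfg_prods H)) N"
      by (auto simp: nt_iff yields_iff_sat)
  qed
  moreover have "L \<subseteq> nt (set (cfg_prods G)) (cfg_start H)"
    using trim[of "[Inl (cfg_start H)]"] assms(2) unfolding H nt_def lists_eq_set by blast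
  ultimately have "L = cfg_lang G" by (simp add: H cfg_lang_eq_nt G_def)
  moreover have "\<forall>(N, r) \<in> set (cfg_prods G). \<forall>t. Inr t \<in> set r \<longrightarrow> t \<in> B"
    by (auto simp: G_def)
  ultimately show ?thesis by (rule that)
qed

section \<open>Counting letters\<close>

definition weight :: "('a \<Rightarrow> int) \<Rightarrow> 'a list \<Rightarrow> int" where
  "weight f w = sum_list (map f w)"

lemma weight_simps [simp]:
  "weight f [] = 0" "weight f (a # w) = f a + weight f w" "weight f (u @ v) = weight f u + weight f v"
  by (simp_all add: weight_def)

text \<open>A discrete intermediate value theorem: the weight changes by at most one per letter and
  must step from \<open>0\<close> to \<open>s\<close> somewhere.\<close>

lemma weight_crossing:
  assumes f: "\<And>a. \<bar>f a\<bar> \<le> 1" and s: "s = 1 \<or> s = - 1" and w: "s * weight f w \<ge> 1"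
  obtains u a v where "w = u @ a # v" "weight f u = 0" "f a = s"
proof -
  have "\<exists>u a v. w = u @ a # v \<and> weight f u = 0 \<and> f a = s"
    using w
  proof (induction w rule: rev_induct)
    case (snoc b w)
    show ?case
    proof (cases "s * weight f w \<ge> 1")
      case True
      from snoc.IH[OF this] show ?thesis by (metis append.assoc append_Cons)
    next
      case False
      then have "weight f w = 0 \<and> f b = s"
        using snoc.prems s f[of b] by auto
      then show ?thesis by (intro exI[of _ w] exI[of _ b] exI[of _ "[]"]) simp
    qed
  qed simp
  then show ?thesis using that by blast
qed

text \<open>A nonterminal is a pair of left quotients \<open>(D, D')\<close>; it generates the words of weight zero
  that lead from \<open>D\<close> to \<open>D'\<close>. A word of weight zero that starts with a letter of non-zero weight
  is split at the letter where the weight first returns to zero.\<close>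

lemma cfl_weight_zero:
  fixes R :: "'t list set"
  assumes "fin_quot R" "R \<subseteq> lists T" "finite T" and f: "\<And>a. \<bar>f a\<bar> \<le> 1"
  shows "cfl {w \<in> R. weight f w = 0}"
proof -
  define Q where "Q = range (lquot R)"
  have Q: "finite Q" "R \<in> Q" using assms(1) unfolding Q_def fin_quot_def by (auto intro: range_eqI[of _ _ "[]"])
  have closed: "D \<in> Q \<Longrightarrow> lquot D w \<in> Q" for D w unfolding Q_def by (rule lquot_in_range)
  define P1 :: "(('t list set \<times> 't list set) option \<times> (('t list set \<times> 't list set) option + 't) list) set"
    where "P1 = (\<lambda>D. (None, [Inl (Some (R, D))])) ` {D \<in> Q. [] \<in> D}"
  define P2 :: "(('t list set \<times> 't list set) option \<times> (('t list set \<times> 't list set) option + 't) list) set"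
    where "P2 = (\<lambda>D. (Some (D, D), [])) ` Q"
  define P3 :: "(('t list set \<times> 't list set) option \<times> (('t list set \<times> 't list set) option + 't) list) set"
    where "P3 = (\<lambda>(D, D', a). (Some (D, D'), [Inr a, Inl (Some (lquot D [a], D'))])) `
    {k \<in> Q \<times> Q \<times> T. f (snd (snd k)) = 0}"
  \<comment> \<open>\<open>E\<close> is the guessed left quotient just before \<open>b\<close>, the
    letter that cancels \<open>a\<close>.\<close>
  define P4 :: "(('t list set \<times> 't list set) option \<times> (('t list set \<times> 't list set) option + 't) list) set"
    where "P4 = (\<lambda>(D, E, D', a, b). (Some (D, D'), [Inr a, Inl (Some (lquot D [a], E)),
      Inr b, Inl (Some (lquot E [b], D'))])) ` {k \<in> Q \<times> Q \<times> Q \<times> T \<times> T. case k of (D, E, D', a, b) \<Rightarrow> f a = - f b}"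
  define P where "P = P1 \<union> P2 \<union> P3 \<union> P4"
  define L where "L = case_option {w \<in> R. weight f w = 0} (\<lambda>(D, D'). {w. lquot D w = D' \<and> weight f w = 0})"
  have "finite P" unfolding P_def P1_def P2_def P3_def P4_def using Q(1) assms(3) by simp
  moreover have "nt P None \<subseteq> L None"
  proof (rule nt_sound)
    fix N r assume "(N, r) \<in> P"
    then consider "(N, r) \<in> P1" | "(N, r) \<in> P2" | "(N, r) \<in> P3" | "(N, r) \<in> P4" by (auto simp: P_def)
    then show "sat L r \<subseteq> L N"
    proof cases
      case 1
      then show ?thesis by (auto simp: P1_def L_def)
    next
      case 2
      then show ?thesis by (auto simp: P2_def L_def)
    next
      case 3
      then show ?thesis by (auto simp: P3_def L_def)
    next
      case 4
      then show ?thesis by (auto simp: P4_def L_def conc_def)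
    qed
  qed
  moreover have "L None \<subseteq> nt P None"
  proof
    fix w assume "w \<in> L None"
    then have w: "w \<in> R" "weight f w = 0" by (auto simp: L_def)
    have "D \<in> Q \<Longrightarrow> w \<in> lists T \<Longrightarrow> weight f w = 0 \<Longrightarrow> w \<in> nt P (Some (D, lquot D w))" for D w
    proof (induction w arbitrary: D rule: length_induct)
      case (1 w)
      show ?case
      proof (cases w)
        case Nil
        have "(Some (D, D), []) \<in> P" unfolding P_def P2_def using 1(2) by blast
        then show ?thesis using Nil by (auto simp: nt_iff)
      next
        case (Cons a w')
        show ?thesis
        proof (cases "f a = 0")
          case True
          have "(Some (D, lquot D w), [Inr a, Inl (Some (lquot D [a], lquot D w))]) \<in> P"
            unfolding P_def P3_def
            by (intro UnI1[OF UnI2] image_eqI[of _ _ "(D, lquot D w, a)"])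
               (use True 1 Cons closed in auto)
          moreover have "w' \<in> nt P (Some (lquot D [a], lquot (lquot D [a]) w'))"
            by (rule 1(1)[rule_format]) (use 1 Cons True closed in auto)
          ultimately have "yields P [Inr a, Inl (Some (lquot D [a], lquot D w))] (a # w')"
            using Cons by (simp add: nt_def)
          with \<open>_ \<in> P\<close> show ?thesis unfolding nt_iff using Cons by blast
        next
          case False
          then have "f a = 1 \<or> f a = - 1" using f[of a] by arith
          moreover have "weight f w' = - f a" using 1(4) Cons by simp
          ultimately have "- f a = 1 \<or> - f a = - 1" "- f a * weight f w' \<ge> 1" by auto
          from weight_crossing[OF f this] obtain u b v where
            w': "w' = u @ b # v" "weight f u = 0" "f b = - f a" by blast
          let ?E = "lquot (lquot D [a]) u"
          have prod: "(Some (D, lquot D w), [Inr a, Inl (Some (lquot D [a], ?E)),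
              Inr b, Inl (Some (lquot ?E [b], lquot D w))]) \<in> P"
            unfolding P_def P4_def
            by (intro UnI2 image_eqI[of _ _ "(D, ?E, lquot D w, a, b)"])
               (use 1 Cons w' closed in \<open>auto simp del: lquot_lquot\<close>)
          have "u \<in> nt P (Some (lquot D [a], ?E))"
            by (rule 1(1)[rule_format]) (use 1 Cons w' closed in auto)
          moreover have "v \<in> nt P (Some (lquot ?E [b], lquot (lquot ?E [b]) v))"
            by (rule 1(1)[rule_format]) (use 1 Cons w' closed in \<open>auto simp del: lquot_lquot\<close>)
          moreover have "lquot (lquot ?E [b]) v = lquot D w" using Cons w' by simp
          ultimately have "yields P [Inr a, Inl (Some (lquot D [a], ?E)),
              Inr b, Inl (Some (lquot ?E [b], lquot D w))] (a # u @ b # v)"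
            by (auto simp: yields_iff_sat simp del: lquot_lquot intro!: imageI concI)
          with prod show ?thesis unfolding nt_iff using Cons w' by blast
        qed
      qed
    qed
    then have "w \<in> nt P (Some (R, lquot R w))" using Q(2) w assms(2) by blast
    then have "yields P [Inl (Some (R, lquot R w))] w" by (simp add: nt_def)
    moreover have "(None, [Inl (Some (R, lquot R w))]) \<in> P"
      unfolding P_def P1_def using closed[OF Q(2), of w] w(1) by simp
    ultimately show "w \<in> nt P None" using nt_iff[of w P None] by blast
  qed
  ultimately have "cfl (L None)" using cfl_nt[of P None] by (metis subset_antisym)
  then show ?thesis by (simp add: L_def)
qed

text \<open>Regular languages are the case of constant weight zero.\<close>

lemma cfl_fin_quot: "fin_quot R \<Longrightarrow> R \<subseteq> lists T \<Longrightarrow> finite T \<Longrightarrow> cfl R"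
  using cfl_weight_zero[of R T "\<lambda>_. 0"] by (simp add: weight_def)

lemma fin_quot_star_single: "fin_quot (star {[a]})"
  by (intro fin_quot_star fin_quot_finite) simp

lemma star_single: "star {[a]} = range (\<lambda>n. replicate n a)"
proof (intro equalityI subsetI)
  fix x assume "x \<in> star {[a]}"
  then show "x \<in> range (\<lambda>n. replicate n a)"
  proof induction
    case star_Nil
    then show ?case by (intro range_eqI[of _ _ 0]) simp
  next
    case (star_app x y)
    then obtain n where "y = replicate n a" by blast
    with star_app show ?case by (intro range_eqI[of _ _ "Suc n"]) simp
  qed
next
  have "replicate n a \<in> star {[a]}" for n
    by (induction n) (use star_app[of "[a]" "{[a]}"] in \<open>auto intro: star_Nil\<close>)
  then show "x \<in> star {[a]}" if "x \<in> range (\<lambda>n. replicate n a)" for x using that by blast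
qed

text \<open>Positive weight is reduced to weight zero by appending erasable letters of weight \<open>-1\<close>.\<close>

lemma cfl_weight_pos:
  fixes R :: "'t list set"
  assumes "fin_quot R" "R \<subseteq> lists T" "finite T" and f: "\<And>a. \<bar>f a\<bar> \<le> 1"
  shows "cfl {w \<in> R. weight f w > 0}"
proof -
  \<comment> \<open>At least one \<open>None\<close> is appended, because the weight is to be
    strictly positive.\<close>
  let ?R = "conc (map Some ` R) (conc {[None]} (star {[None :: 't option]}))"
  let ?f = "case_option (- 1) f"
  let ?h = "case_option [] (\<lambda>a. [a])"
  have wS: "weight ?f (map Some w) = weight f w" for w by (induction w) auto
  have wN: "weight ?f (replicate n None) = - int n" for n by (induction n) auto
  have hS: "hom ?h (map Some w) = w" for w :: "'t list" by (induction w) auto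
  have hN: "hom ?h (replicate n None) = []" for n by (induction n) auto
  have mem: "x \<in> ?R \<longleftrightarrow> (\<exists>w n. w \<in> R \<and> x = map Some w @ replicate (Suc n) None)" for x
    by (fastforce simp: conc_def star_single)
  have "?R \<subseteq> lists (insert None (Some ` T))"
    using assms(2) by (auto simp: mem in_lists_conv_set subset_eq)
  moreover have "fin_quot ?R"
    by (intro fin_quot_conc fin_quot_map fin_quot_star_single)
       (use assms in \<open>auto intro: fin_quot_finite\<close>)
  ultimately have "cfl {x \<in> ?R. weight ?f x = 0}"
    using assms(3) f by (intro cfl_weight_zero[of ?R "insert None (Some ` T)"]) (auto split: option.split)
  then have cfl: "cfl (hom ?h ` {x \<in> ?R. weight ?f x = 0})" by (rule cfl_hom)
  have eq: "hom ?h ` {x \<in> ?R. weight ?f x = 0} = {w \<in> R. weight f w > 0}"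
  proof (intro equalityI subsetI)
    fix w assume "w \<in> hom ?h ` {x \<in> ?R. weight ?f x = 0}"
    then obtain v n where "v \<in> R" "weight ?f (map Some v @ replicate (Suc n) None) = 0"
      "w = hom ?h (map Some v @ replicate (Suc n) None)"
      unfolding mem by blast
    then show "w \<in> {w \<in> R. weight f w > 0}"
      unfolding hom_simps weight_simps wS wN hS hN by simp
  next
    fix w assume w: "w \<in> {w \<in> R. weight f w > 0}"
    let ?x = "map Some w @ replicate (Suc (nat (weight f w - 1))) None"
    have "weight ?f ?x = 0" unfolding weight_simps wS wN using w by simp
    moreover have "?x \<in> ?R" unfolding mem using w by blast
    moreover have "w = hom ?h ?x" unfolding hom_simps hS hN by simp
    ultimately have "?x \<in> {x \<in> ?R. weight ?f x = 0}" "w = hom ?h ?x" by blast+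
    then show "w \<in> hom ?h ` {x \<in> ?R. weight ?f x = 0}" by (rule rev_image_eqI)
  qed
  show ?thesis using cfl unfolding eq .
qed

lemma cfl_weight_nonzero:
  assumes "fin_quot R" "R \<subseteq> lists T" "finite T" and f: "\<And>a. \<bar>f a\<bar> \<le> 1"
  shows "cfl {w \<in> R. weight f w \<noteq> 0}"
proof -
  have neg: "weight (\<lambda>a. - f a) w = - weight f w" for w by (induction w) auto
  have "cfl ({w \<in> R. weight f w > 0} \<union> {w \<in> R. weight (\<lambda>a. - f a) w > 0})"
    using assms by (intro cfl_Un cfl_weight_pos[where T = T]) auto
  also have "\<dots> = {w \<in> R. weight f w \<noteq> 0}" by (auto simp: neg)
  finally show ?thesis .
qed

section \<open>Computable functions\<close>

text \<open>Total functions on tuples of a fixed length. They are written as HOL functions, and the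
  \<open>recf\<close> terms that compute them stay anonymous.\<close>

definition computable :: "nat \<Rightarrow> (nat list \<Rightarrow> nat) \<Rightarrow> bool" where
  "computable k F \<longleftrightarrow> (\<exists>f. \<forall>xs. length xs = k \<longrightarrow> rec_eval f xs (F xs))"

lemma computable_comp:
  assumes "computable (length Gs) F" "\<And>G. G \<in> set Gs \<Longrightarrow> computable k G"
  shows "computable k (\<lambda>xs. F (map (\<lambda>G. G xs) Gs))"
proof -
  from assms(1) obtain f where f: "\<And>xs. length xs = length Gs \<Longrightarrow> rec_eval f xs (F xs)"
    by (auto simp: computable_def)
  from assms(2) have "\<forall>G\<in>set Gs. \<exists>g. \<forall>xs. length xs = k \<longrightarrow> rec_eval g xs (G xs)"
    by (auto simp: computable_def)
  then obtain c where c: "\<And>G xs. G \<in> set Gs \<Longrightarrow> length xs = k \<Longrightarrow> rec_eval (c G) xs (G xs)"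
    by metis
  have "rec_eval (Comp f (map c Gs)) xs (F (map (\<lambda>G. G xs) Gs))" if "length xs = k" for xs
  proof (rule rec_eval.comp)
    show "list_all2 (\<lambda>g y. rec_eval g xs y) (map c Gs) (map (\<lambda>G. G xs) Gs)"
      using that by (auto simp: list_all2_conv_all_nth intro: c)
    show "rec_eval f (map (\<lambda>G. G xs) Gs) (F (map (\<lambda>G. G xs) Gs))" by (rule f) simp
  qed
  then show ?thesis unfolding computable_def by blast
qed

lemma computable_cong:
  "computable k F \<Longrightarrow> (\<And>xs. length xs = k \<Longrightarrow> F xs = G xs) \<Longrightarrow> computable k G"
  unfolding computable_def by fastforce

lemma computable_1:
  assumes "computable 1 F" "computable k G"
  shows "computable k (\<lambda>xs. F [G xs])"
  using computable_comp[of "[G]" F k] assms by simp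

lemma computable_zero: "computable k (\<lambda>_. 0)"
  unfolding computable_def by (auto intro: rec_eval.zero)

lemma computable_nth: "i < k \<Longrightarrow> computable k (\<lambda>xs. xs ! i)"
  unfolding computable_def by (auto intro: rec_eval.proj)

lemma computable_Suc:
  assumes "computable k F"
  shows "computable k (\<lambda>xs. Suc (F xs))"
proof -
  have "rec_eval Succ xs (Suc (hd xs))" if "length xs = 1" for xs
    using that rec_eval.succ by (cases xs) auto
  then have "computable 1 (\<lambda>xs. Suc (hd xs))" unfolding computable_def by blast
  from computable_1[OF this assms] show ?thesis by simp
qed

lemma computable_const: "computable k (\<lambda>_. c)"
  by (induction c) (auto intro: computable_zero computable_Suc)

lemma computable_rec:
  assumes "computable k G" "computable (Suc (Suc k)) H" "computable k N"
  shows "computable k (\<lambda>xs. rec_nat (G xs) (\<lambda>n r. H (n # r # xs)) (N xs))"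
proof -
  from assms(1) obtain g where g: "\<And>xs. length xs = k \<Longrightarrow> rec_eval g xs (G xs)"
    by (auto simp: computable_def)
  from assms(2) obtain h where h: "\<And>xs. length xs = Suc (Suc k) \<Longrightarrow> rec_eval h xs (H xs)"
    by (auto simp: computable_def)
  have rec: "rec_eval (PrimRec g h) (n # xs) (rec_nat (G xs) (\<lambda>n r. H (n # r # xs)) n)"
    if "length xs = k" for n xs
  proof (induction n)
    case 0
    show ?case using rec_eval.primrec_0[OF g[OF that]] by simp
  next
    case (Suc n)
    show ?case using rec_eval.primrec_Suc[OF Suc h] that by simp
  qed
  let ?R = "\<lambda>ys. rec_nat (G (tl ys)) (\<lambda>n r. H (n # r # tl ys)) (hd ys)"
  have "rec_eval (PrimRec g h) ys (?R ys)" if "length ys = Suc k" for ys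
    using rec[of "tl ys" "hd ys"] that by (cases ys) auto
  then have R: "computable (Suc k) ?R" unfolding computable_def by blast
  let ?Gs = "N # map (\<lambda>i xs. xs ! i) [0..<k]"
  have "computable k (\<lambda>xs. ?R (map (\<lambda>G. G xs) ?Gs))"
    by (rule computable_comp) (use R assms(3) in \<open>auto intro: computable_nth\<close>)
  moreover have "map (\<lambda>G. G xs) (map (\<lambda>i xs. xs ! i) [0..<k]) = xs" if "length xs = k" for xs :: "nat list"
    using that by (auto intro: nth_equalityI)
  ultimately show ?thesis by (elim computable_cong) simp
qed

lemma computable_Least:
  assumes "computable (Suc k) F" "\<And>xs. length xs = k \<Longrightarrow> \<exists>n. F (n # xs) = 0"
  shows "computable k (\<lambda>xs. LEAST n. F (n # xs) = 0)"
proof -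
  from assms(1) obtain f where f: "\<And>xs. length xs = Suc k \<Longrightarrow> rec_eval f xs (F xs)"
    by (auto simp: computable_def)
  have "rec_eval (Mu f) xs (LEAST n. F (n # xs) = 0)" if xs: "length xs = k" for xs
  proof (rule rec_eval.mu)
    let ?n = "LEAST n. F (n # xs) = 0"
    have "F (?n # xs) = 0" using assms(2)[OF xs] by (rule LeastI_ex)
    then show "rec_eval f (?n # xs) 0" using f[of "?n # xs"] xs by simp
    show "\<forall>m<?n. \<exists>y. rec_eval f (m # xs) (Suc y)"
    proof (intro allI impI)
      fix m assume "m < ?n"
      then have "F (m # xs) \<noteq> 0" by (rule not_less_Least)
      then obtain y where "F (m # xs) = Suc y" by (cases "F (m # xs)") auto
      then show "\<exists>y. rec_eval f (m # xs) (Suc y)" using f[of "m # xs"] xs by auto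
    qed
  qed
  then show ?thesis unfolding computable_def by blast
qed

lemma computable_add:
  assumes "computable k F" "computable k G"
  shows "computable k (\<lambda>xs. F xs + G xs)"
proof -
  have "computable k (\<lambda>xs. rec_nat (G xs) (\<lambda>n r. (\<lambda>ys. Suc (ys ! 1)) (n # r # xs)) (F xs))"
    by (intro computable_rec computable_Suc computable_nth assms) simp
  moreover have "rec_nat b (\<lambda>n r. Suc r) a = a + b" for a b :: nat by (induction a) auto
  ultimately show ?thesis by (elim computable_cong) simp
qed

lemma computable_pred:
  assumes "computable k F"
  shows "computable k (\<lambda>xs. F xs - 1)"
proof -
  have "computable k (\<lambda>xs. rec_nat ((\<lambda>_. 0) xs) (\<lambda>n r. (\<lambda>ys. ys ! 0) (n # r # xs)) (F xs))"
    by (intro computable_rec computable_zero computable_nth assms) simp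
  moreover have "rec_nat 0 (\<lambda>n r. n) a = a - 1" for a :: nat by (cases a) auto
  ultimately show ?thesis by (elim computable_cong) simp
qed

lemma computable_diff:
  assumes "computable k F" "computable k G"
  shows "computable k (\<lambda>xs. F xs - G xs)"
proof -
  have "computable k (\<lambda>xs. rec_nat (F xs) (\<lambda>n r. (\<lambda>ys. ys ! 1 - 1) (n # r # xs)) (G xs))"
    by (intro computable_rec computable_pred computable_nth assms) simp
  moreover have "rec_nat a (\<lambda>n r. r - 1) b = a - b" for a b :: nat by (induction b) auto
  ultimately show ?thesis by (elim computable_cong) simp
qed

lemma computable_triangle:
  assumes "computable k F"
  shows "computable k (\<lambda>xs. triangle (F xs))"
proof -
  have "computable k (\<lambda>xs. rec_nat ((\<lambda>_. 0) xs) (\<lambda>n r. (\<lambda>ys. ys ! 1 + Suc (ys ! 0)) (n # r # xs)) (F xs))"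
    by (intro computable_rec computable_zero computable_add computable_Suc computable_nth assms) simp_all
  moreover have "rec_nat 0 (\<lambda>n r. r + Suc n) a = triangle a" for a :: nat by (induction a) auto
  ultimately show ?thesis by (elim computable_cong) simp
qed

lemma computable_pair:
  assumes "computable k F" "computable k G"
  shows "computable k (\<lambda>xs. prod_encode (F xs, G xs))"
  unfolding prod_encode_def prod.case
  by (intro computable_add computable_triangle assms)

lemma triangle_mono: "m \<le> n \<Longrightarrow> triangle m \<le> triangle n"
  by (induction n) (auto simp: le_Suc_eq)

lemma computable_fst_snd:
  assumes "computable k F"
  shows "computable k (\<lambda>xs. fst (prod_decode (F xs)))" "computable k (\<lambda>xs. snd (prod_decode (F xs)))"
proof -
  \<comment> \<open>With truncated subtraction the condition says
    \<open>n < triangle (Suc k)\<close>. As \<open>prod_encode (a, b)\<close> is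
    \<open>triangle (a + b) + a\<close>, the least such \<open>k\<close> is the antidiagonal
    \<open>a + b\<close>, from which both components follow.\<close>
  define K where "K n = (LEAST k. Suc n - triangle (Suc k) = 0)" for n
  have "computable 1 (\<lambda>xs. LEAST n. (\<lambda>ys. Suc (ys ! 1) - triangle (Suc (ys ! 0))) (n # xs) = 0)"
  proof (rule computable_Least)
    show "computable (Suc 1) (\<lambda>ys. Suc (ys ! 1) - triangle (Suc (ys ! 0)))"
      by (intro computable_diff computable_triangle computable_Suc computable_nth) simp_all
    have "n \<le> triangle n" for n by (induction n) auto
    then show "\<exists>n. Suc ((n # xs) ! 1) - triangle (Suc ((n # xs) ! 0)) = 0" for xs
      by (metis diff_is_0_eq nth_Cons_0 nth_Cons_Suc One_nat_def)
  qed
  then have "computable 1 (\<lambda>xs. K (xs ! 0))" unfolding K_def by simp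
  from computable_1[OF this assms] have K: "computable k (\<lambda>xs. K (F xs))" by simp
  have K_sum: "K n = a + b \<and> n = triangle (a + b) + a" if "prod_decode n = (a, b)" for n a b
  proof -
    have n: "n = triangle (a + b) + a"
      using prod_decode_inverse[of n] that by (simp add: prod_encode_def)
    have "K n = a + b" unfolding K_def
    proof (rule Least_equality)
      show "Suc n - triangle (Suc (a + b)) = 0" by (simp add: n)
      fix y assume y: "Suc n - triangle (Suc y) = 0"
      show "a + b \<le> y"
      proof (rule ccontr)
        assume "\<not> a + b \<le> y"
        then have "triangle (Suc y) \<le> triangle (a + b)" by (intro triangle_mono) simp
        with y n show False by simp
      qed
    qed
    with n show ?thesis by simp
  qed
  have fs: "fst (prod_decode n) = n - triangle (K n)" "snd (prod_decode n) = K n - (n - triangle (K n))" for n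
    using K_sum[of n "fst (prod_decode n)" "snd (prod_decode n)"] by auto
  show "computable k (\<lambda>xs. fst (prod_decode (F xs)))" "computable k (\<lambda>xs. snd (prod_decode (F xs)))"
    unfolding fs by (intro computable_diff computable_triangle K assms)+
qed

lemma computable_mult_const:
  assumes "computable k F"
  shows "computable k (\<lambda>xs. c * F xs)"
proof (induction c)
  case (Suc c)
  from computable_add[OF assms this] show ?case by simp
qed (simp add: computable_zero)

lemmas computable_intros = computable_const computable_nth computable_Suc computable_add
  computable_mult_const computable_pair computable_fst_snd

section \<open>Extending a grammar by its own code\<close>

text \<open>The holes \<open>1\<close> and \<open>3\<close> of a template grammar are filled with nonterminals generating the
  words \<open>c\<^sup>j\<close> with \<open>j \<noteq> x\<close>, respectively the words \<open>c\<^sup>a #\<^sub>1 c\<^sup>b\<close> with \<open>a + b \<noteq> x\<close>, where \<open>c\<close> is the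
  letter \<open>3\<close>. The productions for \<open>x = 0\<close>, nonterminals \<open>5\<close> and \<open>7\<close>, belong to the template.\<close>

primrec hole_chain :: "nat \<Rightarrow> (nat \<times> (nat + hsym) list) list" where
  "hole_chain 0 = []"
| "hole_chain (Suc i) =
    (4 * i + 9, [Inr (Letter 3), Inl (4 * i + 5)]) # (4 * i + 9, []) #
    (4 * i + 11, [Inr (Letter 3), Inl (4 * i + 7)]) # (4 * i + 11, [Inr Hash1, Inl (4 * i + 9)]) #
    hole_chain i"

text \<open>Nonterminal \<open>4 * i + 5\<close> generates the runs of length other than
  \<open>i\<close>, and \<open>4 * i + 7\<close> the split ones. All even numbers are left to the
  template.\<close>

definition hole_prods :: "nat \<Rightarrow> (nat \<times> (nat + hsym) list) list" where
  "hole_prods x = (1, [Inl (4 * x + 5)]) # (3, [Inl (4 * x + 7)]) # hole_chain x"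

text \<open>The productions are put in front because a list code grows at its head: primitive
  recursion can prepend them to the code of the template's productions without decoding it.\<close>

definition fill_holes :: "nat \<Rightarrow> wh_struct \<Rightarrow> wh_struct" where
  "fill_holes x \<Sigma> = \<Sigma>\<lparr>wh_gram := \<lparr>cfg_start = cfg_start (wh_gram \<Sigma>),
    cfg_prods = hole_prods x @ cfg_prods (wh_gram \<Sigma>)\<rparr>\<rparr>"

lemma computable_fill_holes:
  "\<exists>F. computable 1 F \<and> (\<forall>\<Sigma>. F [code_wh \<Sigma>] = code_wh (fill_holes (code_wh \<Sigma>) \<Sigma>))"
proof -
  let ?cp = "\<lambda>(N, r). prod_encode (N, list_encode (map (sum_encode \<circ> map_sum id code_hsym) r))"
  let ?cons = "\<lambda>a r. Suc (prod_encode (a, r))"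
  let ?prod = "\<lambda>N r. prod_encode (N, r)"
  \<comment> \<open>\<open>11\<close> and \<open>1\<close> encode the terminals \<open>Letter 3\<close> and \<open>Hash1\<close>, and \<open>2 * N\<close> the nonterminal \<open>N\<close>.\<close>
  let ?step = "\<lambda>i r.
    ?cons (?prod (4 * i + 9) (?cons 11 (?cons (2 * (4 * i + 5)) 0)))
    (?cons (?prod (4 * i + 9) 0)
    (?cons (?prod (4 * i + 11) (?cons 11 (?cons (2 * (4 * i + 7)) 0)))
    (?cons (?prod (4 * i + 11) (?cons 1 (?cons (2 * (4 * i + 9)) 0))) r)))"
  define C where "C b x = rec_nat b ?step x" for b x
  have C: "C (list_encode (map ?cp ps)) x = list_encode (map ?cp (hole_chain x @ ps))" for x ps
    by (induction x) (simp_all add: C_def sum_encode_def algebra_simps)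
  \<comment> \<open>The code of the production list sits behind those of the alphabet, the automaton
    and the start symbol, hence three second components.\<close>
  define P where "P n = snd (prod_decode (snd (prod_decode (snd (prod_decode n)))))" for n
  define F where "F xs = (let n = xs ! 0 in
    prod_encode (fst (prod_decode n), prod_encode (fst (prod_decode (snd (prod_decode n))),
      prod_encode (fst (prod_decode (snd (prod_decode (snd (prod_decode n))))),
        ?cons (?prod 1 (?cons (2 * (4 * n + 5)) 0))
        (?cons (?prod 3 (?cons (2 * (4 * n + 7)) 0)) (C (P n) n))))))" for xs
  have "computable 1 (\<lambda>xs. rec_nat (P (xs ! 0)) (\<lambda>n r. (\<lambda>ys. ?step (ys ! 0) (ys ! 1)) (n # r # xs)) (xs ! 0))"
    unfolding P_def by (intro computable_rec computable_intros) simp_all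
  then have "computable 1 (\<lambda>xs. C (P (xs ! 0)) (xs ! 0))" by (simp add: C_def)
  then have "computable 1 F"
    unfolding F_def Let_def by (intro computable_intros) simp_all
  moreover have "F [code_wh \<Sigma>] = code_wh (fill_holes (code_wh \<Sigma>) \<Sigma>)" for \<Sigma>
  proof -
    let ?n = "code_wh \<Sigma>"
    have n: "?n = prod_encode (list_encode (wh_alphabet \<Sigma>),
        prod_encode (code_nfa (wh_aut \<Sigma>), prod_encode (cfg_start (wh_gram \<Sigma>),
          list_encode (map ?cp (cfg_prods (wh_gram \<Sigma>))))))"
      by (simp add: code_wh_def code_cfg_def)
    have "P ?n = list_encode (map ?cp (cfg_prods (wh_gram \<Sigma>)))"
      unfolding P_def n by simp
    then have "C (P ?n) ?n = list_encode (map ?cp (hole_chain ?n @ cfg_prods (wh_gram \<Sigma>)))"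
      by (simp only: C)
    moreover have "fst (prod_decode ?n) = list_encode (wh_alphabet \<Sigma>)"
      "fst (prod_decode (snd (prod_decode ?n))) = code_nfa (wh_aut \<Sigma>)"
      "fst (prod_decode (snd (prod_decode (snd (prod_decode ?n))))) = cfg_start (wh_gram \<Sigma>)"
      unfolding n by simp_all
    ultimately show ?thesis
      by (simp add: F_def Let_def fill_holes_def hole_prods_def code_wh_def[of "\<Sigma>\<lparr>wh_gram := _\<rparr>"]
        code_cfg_def sum_encode_def)
  qed
  ultimately show ?thesis by blast
qed

lemma rec_eval_Comp1_iff:
  "rec_eval (Comp f [g]) xs z \<longleftrightarrow> (\<exists>v. rec_eval g xs v \<and> rec_eval f [v] z)"
proof
  show "\<exists>v. rec_eval g xs v \<and> rec_eval f [v] z \<Longrightarrow> rec_eval (Comp f [g]) xs z"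
    by (auto intro: rec_eval.comp)
qed (auto elim!: rec_eval_CompE simp: list_all2_Cons1)

text \<open>Search for a zero of \<open>1 - f (F x)\<close>, an expression without the search
  variable: the search stops at once if \<open>f\<close> returns a positive value and never stops
  otherwise, whether \<open>f\<close> returns \<open>0\<close> or diverges.\<close>

lemma semidecides:
  assumes "computable 1 F"
  shows "\<exists>g. \<forall>x. (\<exists>y. rec_eval g [x] y) \<longleftrightarrow> (\<exists>v. rec_eval f [F [x]] (Suc v))"
proof -
  from assms obtain T where "\<forall>xs. length xs = 1 \<longrightarrow> rec_eval T xs (F xs)"
    by (auto simp: computable_def)
  then have T: "rec_eval T [x] (F [x])" for x by simp
  have "computable 1 (\<lambda>xs. 1 - xs ! 0)" by (intro computable_diff computable_intros) simp
  then obtain M where "\<forall>xs. length xs = 1 \<longrightarrow> rec_eval M xs (1 - xs ! 0)"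
    by (auto simp: computable_def)
  then have M: "rec_eval M [v] (1 - v)" for v by (metis length_Cons list.size(3) nth_Cons_0 One_nat_def)
  \<comment> \<open>\<open>Mu\<close> puts the search variable in front, so \<open>Proj 1\<close>
    selects \<open>x\<close>.\<close>
  define g where "g = Mu (Comp M [Comp f [Comp T [Proj 1]]])"
  have eval: "rec_eval (Comp M [Comp f [Comp T [Proj 1]]]) [m, x] z \<longleftrightarrow>
      (\<exists>v. rec_eval f [F [x]] v \<and> z = 1 - v)" for m x z
  proof
    assume "rec_eval (Comp M [Comp f [Comp T [Proj 1]]]) [m, x] z"
    then obtain p t v where p: "rec_eval (Proj 1) [m, x] p" "rec_eval T [p] t"
      and t: "rec_eval f [t] v" and v: "rec_eval M [v] z"
      unfolding rec_eval_Comp1_iff by blast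
    from p have "rec_eval T [x] t" by (auto elim: rec_eval_ProjE)
    then have "t = F [x]" using T rec_eval_deterministic by blast
    moreover have "z = 1 - v" using v M rec_eval_deterministic by blast
    ultimately show "\<exists>v. rec_eval f [F [x]] v \<and> z = 1 - v" using t by blast
  next
    assume "\<exists>v. rec_eval f [F [x]] v \<and> z = 1 - v"
    then obtain v where v: "rec_eval f [F [x]] v" "z = 1 - v" by blast
    have "rec_eval (Proj 1) [m, x] x" using rec_eval.proj[of 1 "[m, x]"] by simp
    then show "rec_eval (Comp M [Comp f [Comp T [Proj 1]]]) [m, x] z"
      unfolding rec_eval_Comp1_iff v(2) using T v(1) M by blast
  qed
  have "(\<exists>y. rec_eval g [x] y) \<longleftrightarrow> (\<exists>v. rec_eval f [F [x]] (Suc v))" for x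
  proof
    assume "\<exists>y. rec_eval g [x] y"
    then obtain y where "rec_eval (Comp M [Comp f [Comp T [Proj 1]]]) [y, x] 0"
      unfolding g_def by (auto elim: rec_eval_MuE)
    then obtain v where "rec_eval f [F [x]] v" "0 = 1 - v" unfolding eval by blast
    then show "\<exists>v. rec_eval f [F [x]] (Suc v)" by (cases v) auto
  next
    assume "\<exists>v. rec_eval f [F [x]] (Suc v)"
    then have "rec_eval (Comp M [Comp f [Comp T [Proj 1]]]) [0, x] 0"
      unfolding eval by force
    then have "rec_eval g [x] 0" unfolding g_def by (intro rec_eval.mu) auto
    then show "\<exists>y. rec_eval g [x] y" by blast
  qed
  then show ?thesis by blast
qed

section \<open>Regular languages of counter operations\<close>

text \<open>Letters \<open>0\<close>, \<open>1\<close> and \<open>2\<close> stay free for the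
  delimiter, the zero and the separator. In particular \<open>inc 0\<close> is \<open>3\<close>, the
  letter of the hole productions.\<close>

definition inc :: "nat \<Rightarrow> nat" where "inc i = 3 * i + 3"
definition dec :: "nat \<Rightarrow> nat" where "dec i = 3 * i + 4"
definition tst :: "nat \<Rightarrow> nat" where "tst i = 3 * i + 5"

lemma letter_eq [simp]:
  "inc i = inc j \<longleftrightarrow> i = j" "dec i = dec j \<longleftrightarrow> i = j" "tst i = tst j \<longleftrightarrow> i = j"
  "inc i \<noteq> dec j" "dec j \<noteq> inc i" "inc i \<noteq> tst j" "tst j \<noteq> inc i" "dec i \<noteq> tst j" "tst j \<noteq> dec i"
  unfolding inc_def dec_def tst_def by presburger+

lemma letter_small [simp]:
  "inc i \<noteq> 0" "dec i \<noteq> 0" "tst i \<noteq> 0" "inc i \<noteq> Suc 0" "dec i \<noteq> Suc 0" "tst i \<noteq> Suc 0"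
  "inc i \<noteq> 2" "dec i \<noteq> 2" "tst i \<noteq> 2"
  "0 \<noteq> inc i" "0 \<noteq> dec i" "0 \<noteq> tst i" "Suc 0 \<noteq> inc i" "Suc 0 \<noteq> dec i" "Suc 0 \<noteq> tst i"
  "2 \<noteq> inc i" "2 \<noteq> dec i" "2 \<noteq> tst i"
  unfolding inc_def dec_def tst_def by simp_all

definition ops :: "nat \<Rightarrow> nat set" where
  "ops k = inc ` {..<k} \<union> dec ` {..<k} \<union> tst ` {..<k}"

definition step_wt :: "nat \<Rightarrow> nat \<Rightarrow> int" where
  "step_wt i a = (if a = inc i then 1 else if a = dec i then - 1 else 0)"

abbreviation cnt :: "nat \<Rightarrow> nat list \<Rightarrow> int" where
  "cnt i \<equiv> weight (step_wt i)"

text \<open>Counters are integers and only a zero test can fail. A decrement below zero need not be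
  excluded: every loop below counts down to a zero test, which such a run never passes.\<close>

definition legal :: "(nat \<Rightarrow> int) \<Rightarrow> nat list \<Rightarrow> bool" where
  "legal \<sigma> w \<longleftrightarrow> (\<forall>u v i. w = u @ tst i # v \<longrightarrow> \<sigma> i + cnt i u = 0)"

definition after :: "(nat \<Rightarrow> int) \<Rightarrow> nat list \<Rightarrow> nat \<Rightarrow> int" where
  "after \<sigma> w = (\<lambda>i. \<sigma> i + cnt i w)"

text \<open>A language read as a nondeterministic program: each word is a possible run, and runs
  that fail a test are discarded. Concatenation becomes composition and star becomes
  iteration.\<close>

definition sem :: "nat list set \<Rightarrow> (nat \<Rightarrow> int) \<Rightarrow> (nat \<Rightarrow> int) set" where
  "sem X \<sigma> = {after \<sigma> w | w. w \<in> X \<and> legal \<sigma> w}"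

lemma legal_Nil [simp]: "legal \<sigma> []"
  by (simp add: legal_def)

lemma after_Nil [simp]: "after \<sigma> [] = \<sigma>"
  by (simp add: after_def)

lemma after_append [simp]: "after \<sigma> (u @ v) = after (after \<sigma> u) v"
  by (simp add: after_def add.assoc)

lemma legal_append: "legal \<sigma> (u @ v) \<longleftrightarrow> legal \<sigma> u \<and> legal (after \<sigma> u) v"
proof (intro iffI conjI)
  assume *: "legal \<sigma> (u @ v)"
  show "legal \<sigma> u"
    unfolding legal_def
  proof (intro allI impI)
    fix a b i assume "u = a @ tst i # b"
    then have "u @ v = a @ tst i # (b @ v)" by simp
    with * show "\<sigma> i + cnt i a = 0" unfolding legal_def by blast
  qed
  show "legal (after \<sigma> u) v"
    unfolding legal_def
  proof (intro allI impI)
    fix a b i assume "v = a @ tst i # b"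
    then have "u @ v = (u @ a) @ tst i # b" by simp
    with * have "\<sigma> i + cnt i (u @ a) = 0" unfolding legal_def by blast
    then show "after \<sigma> u i + cnt i a = 0" by (simp add: after_def)
  qed
next
  assume *: "legal \<sigma> u \<and> legal (after \<sigma> u) v"
  show "legal \<sigma> (u @ v)"
    unfolding legal_def
  proof (intro allI impI)
    fix a b i assume eq: "u @ v = a @ tst i # b"
    then obtain us where "u = a @ us \<and> us @ v = tst i # b \<or> u @ us = a \<and> v = us @ tst i # b"
      unfolding append_eq_append_conv2 by blast
    then have "(\<exists>c. u = a @ tst i # c) \<or> (\<exists>c. a = u @ c \<and> v = c @ tst i # b)"
      by (cases us) auto
    then consider c where "u = a @ tst i # c" | c where "a = u @ c" "v = c @ tst i # b" by blast
    then show "\<sigma> i + cnt i a = 0"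
    proof cases
      case 1
      with * show ?thesis unfolding legal_def by blast
    next
      case 2
      with * have "after \<sigma> u i + cnt i c = 0" unfolding legal_def by blast
      with 2 show ?thesis by (simp add: after_def)
    qed
  qed
qed

lemma semI: "w \<in> X \<Longrightarrow> legal \<sigma> w \<Longrightarrow> after \<sigma> w \<in> sem X \<sigma>"
  unfolding sem_def by blast

lemma semE:
  assumes "\<tau> \<in> sem X \<sigma>" obtains w where "w \<in> X" "legal \<sigma> w" "\<tau> = after \<sigma> w"
  using assms unfolding sem_def by blast

lemma sem_empty [simp]: "sem {} \<sigma> = {}"
  by (simp add: sem_def)

lemma sem_Nil [simp]: "sem {[]} \<sigma> = {\<sigma>}"
  by (simp add: sem_def)

lemma sem_conc: "sem (conc X Y) \<sigma> = (\<Union>\<tau>\<in>sem X \<sigma>. sem Y \<tau>)"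
proof (intro equalityI subsetI)
  fix \<rho> assume "\<rho> \<in> sem (conc X Y) \<sigma>"
  then obtain u v where uv: "u \<in> X" "v \<in> Y" "legal \<sigma> (u @ v)" "\<rho> = after \<sigma> (u @ v)"
    by (auto elim!: semE concE)
  then have "after \<sigma> u \<in> sem X \<sigma>" "\<rho> \<in> sem Y (after \<sigma> u)"
    by (auto simp: legal_append intro: semI)
  then show "\<rho> \<in> (\<Union>\<tau>\<in>sem X \<sigma>. sem Y \<tau>)" by blast
next
  fix \<rho> assume "\<rho> \<in> (\<Union>\<tau>\<in>sem X \<sigma>. sem Y \<tau>)"
  then obtain u v where "u \<in> X" "legal \<sigma> u" "v \<in> Y" "legal (after \<sigma> u) v" "\<rho> = after (after \<sigma> u) v"
    by (auto elim!: semE)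
  then show "\<rho> \<in> sem (conc X Y) \<sigma>"
    using semI[of "u @ v" "conc X Y" \<sigma>] by (auto simp: legal_append intro: concI)
qed

lemma sem_star: "sem (star X) \<sigma> = {\<tau>. (\<lambda>s t. t \<in> sem X s)\<^sup>*\<^sup>* \<sigma> \<tau>}"
proof (intro equalityI subsetI)
  fix \<tau> assume "\<tau> \<in> sem (star X) \<sigma>"
  then obtain w where "w \<in> star X" "legal \<sigma> w" "\<tau> = after \<sigma> w" by (rule semE)
  then have "(\<lambda>s t. t \<in> sem X s)\<^sup>*\<^sup>* \<sigma> \<tau>"
  proof (induction arbitrary: \<sigma> rule: star.induct)
    case (star_app x y)
    then have "after \<sigma> x \<in> sem X \<sigma>" "(\<lambda>s t. t \<in> sem X s)\<^sup>*\<^sup>* (after \<sigma> x) \<tau>"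
      by (auto simp: legal_append intro: semI)
    then show ?case by (rule converse_rtranclp_into_rtranclp)
  qed simp
  then show "\<tau> \<in> {\<tau>. (\<lambda>s t. t \<in> sem X s)\<^sup>*\<^sup>* \<sigma> \<tau>}" by simp
next
  fix \<tau> assume "\<tau> \<in> {\<tau>. (\<lambda>s t. t \<in> sem X s)\<^sup>*\<^sup>* \<sigma> \<tau>}"
  then have "(\<lambda>s t. t \<in> sem X s)\<^sup>*\<^sup>* \<sigma> \<tau>" by simp
  then show "\<tau> \<in> sem (star X) \<sigma>"
  proof (induction rule: converse_rtranclp_induct)
    case base
    show ?case using semI[OF star_Nil, of \<tau>] by simp
  next
    case (step s t)
    then have "\<tau> \<in> sem (conc X (star X)) s" unfolding sem_conc by blast
    moreover have "conc X (star X) \<subseteq> star X" by (auto elim!: concE intro: star_app)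
    ultimately show ?case unfolding sem_def by blast
  qed
qed

lemma legal_single: "legal \<sigma> [a] \<longleftrightarrow> (\<forall>i. a = tst i \<longrightarrow> \<sigma> i = 0)"
  by (auto simp: legal_def Cons_eq_append_conv)

lemma sem_inc [simp]: "sem {[inc r]} \<sigma> = {\<sigma>(r := \<sigma> r + 1)}"
  by (auto simp: sem_def legal_single after_def step_wt_def fun_eq_iff)

lemma sem_dec [simp]: "sem {[dec r]} \<sigma> = {\<sigma>(r := \<sigma> r - 1)}"
  by (auto simp: sem_def legal_single after_def step_wt_def fun_eq_iff)

lemma sem_tst [simp]: "sem {[tst r]} \<sigma> = (if \<sigma> r = 0 then {\<sigma>} else {})"
  by (auto simp: sem_def legal_single after_def step_wt_def fun_eq_iff)

definition prog :: "nat list set \<Rightarrow> bool" where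
  "prog X \<longleftrightarrow> fin_quot X \<and> (\<exists>k. X \<subseteq> lists (ops k))"

lemma ops_mono: "k \<le> l \<Longrightarrow> ops k \<subseteq> ops l"
  unfolding ops_def by fastforce

lemma prog_conc:
  assumes "prog X" "prog Y"
  shows "prog (conc X Y)"
proof -
  from assms obtain k l where "X \<subseteq> lists (ops k)" "Y \<subseteq> lists (ops l)" by (auto simp: prog_def)
  then have "X \<subseteq> lists (ops (max k l))" "Y \<subseteq> lists (ops (max k l))"
    using ops_mono[of k "max k l"] ops_mono[of l "max k l"] lists_mono by (meson max.cobounded1 max.cobounded2 order_trans)+
  then have "conc X Y \<subseteq> lists (ops (max k l))" by (rule conc_lists)
  with assms show ?thesis unfolding prog_def by (blast intro: fin_quot_conc)
qed

lemma prog_star: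
  assumes "prog X"
  shows "prog (star X)"
proof -
  from assms obtain k where k: "X \<subseteq> lists (ops k)" by (auto simp: prog_def)
  have "w \<in> star X \<Longrightarrow> w \<in> lists (ops k)" for w
    by (induction rule: star.induct) (use k in auto)
  with assms show ?thesis unfolding prog_def by (blast intro: fin_quot_star)
qed

lemma prog_basic [simp]: "prog {}" "prog {[]}" "prog {[inc r]}" "prog {[dec r]}" "prog {[tst r]}"
  unfolding prog_def by (auto intro!: fin_quot_finite exI[of _ "Suc r"] simp: ops_def)

section \<open>Counting loops and register macros\<close>

lemma rtranclp_funpow: "(\<lambda>s t. t = f s)\<^sup>*\<^sup>* \<sigma> \<tau> \<longleftrightarrow> (\<exists>n. \<tau> = (f ^^ n) \<sigma>)"
proof
  assume "(\<lambda>s t. t = f s)\<^sup>*\<^sup>* \<sigma> \<tau>"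
  then show "\<exists>n. \<tau> = (f ^^ n) \<sigma>"
  proof (induction rule: rtranclp_induct)
    case base
    show ?case by (rule exI[of _ 0]) simp
  next
    case (step s t)
    then obtain n where "s = (f ^^ n) \<sigma>" by blast
    with step show ?case by (intro exI[of _ "Suc n"]) simp
  qed
next
  have "(\<lambda>s t. t = f s)\<^sup>*\<^sup>* \<sigma> ((f ^^ n) \<sigma>)" for n
    by (induction n) (auto intro: rtranclp.rtrancl_into_rtrancl)
  then show "\<exists>n. \<tau> = (f ^^ n) \<sigma> \<Longrightarrow> (\<lambda>s t. t = f s)\<^sup>*\<^sup>* \<sigma> \<tau>" by blast
qed

text \<open>The star leaves the number of rounds open, but only the run with exactly
  \<open>\<sigma> r\<close> rounds passes the closing test, and none does if
  \<open>\<sigma> r\<close> is negative. So the nondeterministic loop has at most one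
  result.\<close>

lemma sem_countdown:
  assumes "\<And>s. sem X s = {f s}" "\<And>s. f s r = s r - 1"
  shows "sem (conc (star X) {[tst r]}) \<sigma> = (if \<sigma> r \<ge> 0 then {(f ^^ nat (\<sigma> r)) \<sigma>} else {})"
proof -
  have dec: "(f ^^ n) \<sigma> r = \<sigma> r - int n" for n by (induction n) (auto simp: assms(2))
  have "sem (conc (star X) {[tst r]}) \<sigma> = {(f ^^ n) \<sigma> | n. (f ^^ n) \<sigma> r = 0}"
    by (auto simp: sem_conc sem_star assms(1) rtranclp_funpow split: if_splits)
  also have "\<dots> = {(f ^^ n) \<sigma> | n. \<sigma> r = int n}" by (simp add: dec)
  also have "\<dots> = (if \<sigma> r \<ge> 0 then {(f ^^ nat (\<sigma> r)) \<sigma>} else {})" by (auto intro: exI[of _ "nat (\<sigma> r)"])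
  finally show ?thesis .
qed

definition clear :: "nat \<Rightarrow> nat list set" where
  "clear r = conc (star {[dec r]}) {[tst r]}"

definition move :: "nat \<Rightarrow> nat \<Rightarrow> nat list set" where
  "move r q = conc (star (conc {[dec r]} {[inc q]})) {[tst r]}"

text \<open>Counting \<open>r\<close> down destroys it, so its value is also collected in the
  scratch register \<open>t\<close> and moved back.\<close>

definition copy :: "nat \<Rightarrow> nat \<Rightarrow> nat \<Rightarrow> nat list set" where
  "copy r q t = conc (conc (star (conc {[dec r]} (conc {[inc q]} {[inc t]}))) {[tst r]}) (move t r)"

lemma prog_macros [simp]: "prog (clear r)" "prog (move r q)" "prog (copy r q t)"
  unfolding clear_def move_def copy_def by (intro prog_conc prog_star prog_basic)+

lemma sem_clear [simp]: "sem (clear r) \<sigma> = (if \<sigma> r \<ge> 0 then {\<sigma>(r := 0)} else {})"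
proof -
  have "((\<lambda>s. s(r := s r - 1)) ^^ n) \<sigma> = \<sigma>(r := \<sigma> r - int n)" for n
    by (induction n) auto
  moreover have "sem (clear r) \<sigma> = (if \<sigma> r \<ge> 0 then {((\<lambda>s. s(r := s r - 1)) ^^ nat (\<sigma> r)) \<sigma>} else {})"
    unfolding clear_def by (rule sem_countdown) simp_all
  ultimately show ?thesis by simp
qed

lemma sem_move [simp]:
  assumes "q \<noteq> r"
  shows "sem (move r q) \<sigma> = (if \<sigma> r \<ge> 0 then {\<sigma>(r := 0, q := \<sigma> q + \<sigma> r)} else {})"
proof -
  let ?f = "\<lambda>s. s(r := s r - 1, q := s q + (1 :: int))"
  have "(?f ^^ n) \<sigma> = \<sigma>(r := \<sigma> r - int n, q := \<sigma> q + int n)" for n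
    by (induction n) (use assms in \<open>auto simp: fun_eq_iff\<close>)
  moreover have "sem (move r q) \<sigma> = (if \<sigma> r \<ge> 0 then {(?f ^^ nat (\<sigma> r)) \<sigma>} else {})"
    unfolding move_def by (rule sem_countdown) (use assms in \<open>simp_all add: sem_conc\<close>)
  ultimately show ?thesis by simp
qed

lemma sem_copy:
  assumes "q \<noteq> r" "t \<noteq> r" "t \<noteq> q" "\<sigma> t = 0" "\<sigma> r \<ge> 0"
  shows "sem (copy r q t) \<sigma> = {\<sigma>(q := \<sigma> q + \<sigma> r)}"
proof -
  let ?f = "\<lambda>s. s(r := s r - 1, q := s q + (1 :: int), t := s t + 1)"
  have f: "(?f ^^ n) \<sigma> = \<sigma>(r := \<sigma> r - int n, q := \<sigma> q + int n, t := \<sigma> t + int n)" for n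
    by (induction n) (use assms in \<open>auto simp: fun_eq_iff\<close>)
  have "sem (conc (star (conc {[dec r]} (conc {[inc q]} {[inc t]}))) {[tst r]}) \<sigma> =
      (if \<sigma> r \<ge> 0 then {(?f ^^ nat (\<sigma> r)) \<sigma>} else {})"
    by (rule sem_countdown) (use assms in \<open>simp_all add: sem_conc\<close>)
  also have "\<dots> = {\<sigma>(r := 0, q := \<sigma> q + \<sigma> r, t := \<sigma> r)}"
    unfolding f using assms by simp
  finally show ?thesis
    unfolding copy_def sem_conc using assms by (auto simp: fun_eq_iff)
qed

section \<open>Compiling partial recursive functions\<close>

text \<open>Registers from \<open>m\<close> on are scratch space, zero at entry and, because the
  result differs from \<open>\<sigma>\<close> only at \<open>out\<close>, zero again at exit.
  Equality of the two sets makes divergence the same as having no passing run.\<close>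

definition implements :: "recf \<Rightarrow> nat list \<Rightarrow> nat \<Rightarrow> nat \<Rightarrow> nat list set \<Rightarrow> bool" where
  "implements g args out m X \<longleftrightarrow> prog X \<and>
    (\<forall>\<sigma>. (\<forall>i\<ge>m. \<sigma> i = 0) \<longrightarrow> \<sigma> out = 0 \<longrightarrow> (\<forall>i\<in>set args. \<sigma> i \<ge> 0) \<longrightarrow>
      sem X \<sigma> = {\<sigma>(out := int y) | y. rec_eval g (map (nat \<circ> \<sigma>) args) y})"

lemma implementsD:
  "implements g args out m X \<Longrightarrow> (\<And>i. i \<ge> m \<Longrightarrow> \<sigma> i = 0) \<Longrightarrow> \<sigma> out = 0 \<Longrightarrow> (\<And>i. i \<in> set args \<Longrightarrow> \<sigma> i \<ge> 0) \<Longrightarrow>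
    map (nat \<circ> \<sigma>) args = xs \<Longrightarrow> sem X \<sigma> = {\<sigma>(out := int y) | y. rec_eval g xs y}"
  unfolding implements_def by blast

text \<open>Quantified over all register layouts, so that the parts of a compound function can be
  placed where the compound needs them.\<close>

definition compiles :: "recf \<Rightarrow> bool" where
  "compiles g \<longleftrightarrow> (\<forall>args out m. set args \<subseteq> {..<m} \<longrightarrow> out < m \<longrightarrow> out \<notin> set args \<longrightarrow>
    (\<exists>X. implements g args out m X))"

lemma compilesD:
  assumes "compiles g" "set args \<subseteq> {..<m}" "out < m" "out \<notin> set args"
  obtains X where "implements g args out m X"
  using assms unfolding compiles_def by blast

lemma implementsI:
  assumes "prog X" "\<And>\<sigma>. (\<And>i. i \<ge> m \<Longrightarrow> \<sigma> i = 0) \<Longrightarrow> \<sigma> out = 0 \<Longrightarrow> (\<And>i. i \<in> set args \<Longrightarrow> \<sigma> i \<ge> 0) \<Longrightarrow>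
    sem X \<sigma> = {\<sigma>(out := int y) | y. rec_eval g (map (nat \<circ> \<sigma>) args) y}"
  shows "implements g args out m X"
  using assms unfolding implements_def by blast

lemma rec_eval_Succ_iff: "rec_eval Succ xs y \<longleftrightarrow> (\<exists>x. xs = [x] \<and> y = Suc x)"
  by (auto elim: rec_eval_SuccE intro: rec_eval.succ)

lemma rec_eval_Proj_iff: "rec_eval (Proj i) xs y \<longleftrightarrow> i < length xs \<and> y = xs ! i"
  by (auto elim: rec_eval_ProjE intro: rec_eval.proj)

lemma rec_eval_Zero_iff: "rec_eval Zero xs y \<longleftrightarrow> y = 0"
  by (auto elim: rec_eval_ZeroE intro: rec_eval.zero)

lemma compiles_Zero: "compiles Zero"
  unfolding compiles_def
proof (intro allI impI exI)
  fix args :: "nat list" and out m :: nat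
  show "implements Zero args out m {[]}"
    by (rule implementsI) (auto simp: rec_eval_Zero_iff fun_upd_idem)
qed

lemma compiles_Succ: "compiles Succ"
  unfolding compiles_def
proof (intro allI impI)
  fix args :: "nat list" and out m :: nat
  assume *: "set args \<subseteq> {..<m}" "out < m" "out \<notin> set args"
  show "\<exists>X. implements Succ args out m X"
  proof (cases "\<exists>a. args = [a]")
    case True
    then obtain a where a: "args = [a]" by blast
    have "implements Succ args out m (conc (copy a out m) {[inc out]})"
    proof (rule implementsI)
      fix \<sigma> :: "nat \<Rightarrow> int"
      assume "\<And>i. i \<ge> m \<Longrightarrow> \<sigma> i = 0" "\<sigma> out = 0" "\<And>i. i \<in> set args \<Longrightarrow> \<sigma> i \<ge> 0"
      then show "sem (conc (copy a out m) {[inc out]}) \<sigma> =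
          {\<sigma>(out := int y) | y. rec_eval Succ (map (nat \<circ> \<sigma>) args) y}"
        using * a by (auto simp: sem_conc sem_copy rec_eval_Succ_iff)
    qed (intro prog_conc prog_basic prog_macros)
    then show ?thesis by blast
  next
    case False
    have "implements Succ args out m {}"
      by (rule implementsI) (use False in \<open>auto simp: rec_eval_Succ_iff map_eq_Cons_conv\<close>)
    then show ?thesis by blast
  qed
qed

lemma compiles_Proj: "compiles (Proj n)"
  unfolding compiles_def
proof (intro allI impI)
  fix args :: "nat list" and out m :: nat
  assume *: "set args \<subseteq> {..<m}" "out < m" "out \<notin> set args"
  show "\<exists>X. implements (Proj n) args out m X"
  proof (cases "n < length args")
    case True
    then have n: "args ! n \<in> set args" by simp
    have "implements (Proj n) args out m (copy (args ! n) out m)"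
    proof (rule implementsI)
      fix \<sigma> :: "nat \<Rightarrow> int"
      assume \<sigma>: "\<And>i. i \<ge> m \<Longrightarrow> \<sigma> i = 0" "\<sigma> out = 0" "\<And>i. i \<in> set args \<Longrightarrow> \<sigma> i \<ge> 0"
      have "sem (copy (args ! n) out m) \<sigma> = {\<sigma>(out := \<sigma> out + \<sigma> (args ! n))}"
        by (rule sem_copy) (use * n \<sigma> in auto)
      then show "sem (copy (args ! n) out m) \<sigma> =
          {\<sigma>(out := int y) | y. rec_eval (Proj n) (map (nat \<circ> \<sigma>) args) y}"
        using True \<sigma>(2) \<sigma>(3)[OF n] by (auto simp: rec_eval_Proj_iff)
    qed simp
    then show ?thesis by blast
  next
    case False
    have "implements (Proj n) args out m {}"
      by (rule implementsI) (use False in \<open>auto simp: rec_eval_Proj_iff\<close>)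
    then show ?thesis by blast
  qed
qed

definition load :: "(nat \<Rightarrow> int) \<Rightarrow> nat \<Rightarrow> nat list \<Rightarrow> nat \<Rightarrow> int" where
  "load \<sigma> m ys i = (if m \<le> i \<and> i < m + length ys then int (ys ! (i - m)) else \<sigma> i)"

lemma load_snoc: "load \<sigma> m (ys @ [y]) = (load \<sigma> m ys)(m + length ys := int y)"
  by (auto simp: load_def fun_eq_iff nth_append)

lemma implements_prog: "implements g args out m X \<Longrightarrow> prog X"
  by (simp add: implements_def)

text \<open>The results are stacked in registers \<open>m\<close>, \<open>m + 1\<close> and so on.
  Induction from the right lets each further function write just above the earlier results, with its
  scratch space above that.\<close>

lemma compile_arguments:
  assumes "\<And>g. g \<in> set gs \<Longrightarrow> compiles g" "set args \<subseteq> {..<m}"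
  shows "\<exists>X. prog X \<and> (\<forall>\<sigma>. (\<forall>i\<ge>m. \<sigma> i = 0) \<longrightarrow> (\<forall>i\<in>set args. \<sigma> i \<ge> 0) \<longrightarrow>
    sem X \<sigma> = {load \<sigma> m ys | ys. list_all2 (\<lambda>g y. rec_eval g (map (nat \<circ> \<sigma>) args) y) gs ys})"
  using assms(1)
proof (induction gs rule: rev_induct)
  case Nil
  show ?case
    by (rule exI[of _ "{[]}"]) (auto simp: load_def fun_eq_iff)
next
  case (snoc g gs)
  have "\<exists>X. prog X \<and> (\<forall>\<sigma>. (\<forall>i\<ge>m. \<sigma> i = 0) \<longrightarrow> (\<forall>i\<in>set args. \<sigma> i \<ge> 0) \<longrightarrow>
    sem X \<sigma> = {load \<sigma> m ys | ys. list_all2 (\<lambda>g y. rec_eval g (map (nat \<circ> \<sigma>) args) y) gs ys})"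
    by (rule snoc.IH) (use snoc.prems in auto)
  then obtain X where X: "prog X" "\<And>\<sigma>. (\<forall>i\<ge>m. \<sigma> i = 0) \<Longrightarrow> (\<forall>i\<in>set args. \<sigma> i \<ge> 0) \<Longrightarrow>
    sem X \<sigma> = {load \<sigma> m ys | ys. list_all2 (\<lambda>g y. rec_eval g (map (nat \<circ> \<sigma>) args) y) gs ys}"
    by blast
  let ?r = "m + length gs"
  have "compiles g" using snoc.prems by simp
  then obtain Y where Y: "implements g args ?r (Suc ?r) Y"
    by (rule compilesD[of g args "Suc ?r" ?r]) (use assms(2) in auto)
  have sem: "sem (conc X Y) \<sigma> =
      {load \<sigma> m ys | ys. list_all2 (\<lambda>g y. rec_eval g (map (nat \<circ> \<sigma>) args) y) (gs @ [g]) ys}"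
    if \<sigma>: "\<forall>i\<ge>m. \<sigma> i = 0" "\<forall>i\<in>set args. \<sigma> i \<ge> 0" for \<sigma>
  proof -
    let ?R = "\<lambda>g y. rec_eval g (map (nat \<circ> \<sigma>) args) y"
    have "sem Y (load \<sigma> m ys) = {(load \<sigma> m ys)(?r := int y) | y. ?R g y}"
      if "length ys = length gs" for ys
    proof (rule implementsD[OF Y])
      show "map (nat \<circ> load \<sigma> m ys) args = map (nat \<circ> \<sigma>) args"
        using assms(2) by (auto simp: load_def)
    qed (use \<sigma> assms(2) that in \<open>auto simp: load_def\<close>)
    then have 1: "sem Y (load \<sigma> m ys) = {load \<sigma> m (ys @ [y]) | y. ?R g y}" if "list_all2 ?R gs ys" for ys
      using list_all2_lengthD[OF that] by (simp add: load_snoc)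
    have "sem (conc X Y) \<sigma> = (\<Union>\<tau>\<in>{load \<sigma> m ys | ys. list_all2 ?R gs ys}. sem Y \<tau>)"
      unfolding sem_conc X(2)[OF \<sigma>] ..
    also have "\<dots> = {load \<sigma> m (ys @ [y]) | ys y. list_all2 ?R gs ys \<and> ?R g y}"
      using 1 by (auto; blast)
    also have "\<dots> = {load \<sigma> m zs | zs. list_all2 ?R (gs @ [g]) zs}"
    proof -
      have "list_all2 ?R (gs @ [g]) zs \<longleftrightarrow> (\<exists>ys y. zs = ys @ [y] \<and> list_all2 ?R gs ys \<and> ?R g y)" for zs
      proof (cases zs rule: rev_cases)
        case (snoc ys y)
        show ?thesis
        proof (cases "length ys = length gs")
          case True
          then show ?thesis by (simp add: snoc list_all2_append)
        next
          case False
          then show ?thesis by (auto simp: snoc dest!: list_all2_lengthD)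
        qed
      qed simp
      then show ?thesis by (intro Collect_cong) auto
    qed
    finally show ?thesis .
  qed
  have "prog (conc X Y)" by (rule prog_conc[OF X(1) implements_prog[OF Y]])
  with sem show ?case by (intro exI[of _ "conc X Y"] conjI allI impI)
qed

lemma clear_registers:
  "\<exists>X. prog X \<and> (\<forall>\<sigma>. (\<forall>i. m \<le> i \<and> i < m + n \<longrightarrow> \<sigma> i \<ge> 0) \<longrightarrow>
    sem X \<sigma> = {\<lambda>i. if m \<le> i \<and> i < m + n then 0 else \<sigma> i})"
proof (induction n)
  case 0
  show ?case by (rule exI[of _ "{[]}"]) (auto simp: fun_eq_iff)
next
  case (Suc n)
  then obtain X where X: "prog X" "\<And>\<sigma>. (\<forall>i. m \<le> i \<and> i < m + n \<longrightarrow> \<sigma> i \<ge> 0) \<Longrightarrow>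
    sem X \<sigma> = {\<lambda>i. if m \<le> i \<and> i < m + n then 0 else \<sigma> i}" by blast
  show ?case
  proof (intro exI[of _ "conc X (clear (m + n))"] conjI allI impI)
    show "prog (conc X (clear (m + n)))" using X(1) by (intro prog_conc) simp_all
    fix \<sigma> :: "nat \<Rightarrow> int" assume \<sigma>: "\<forall>i. m \<le> i \<and> i < m + Suc n \<longrightarrow> \<sigma> i \<ge> 0"
    then have "sem X \<sigma> = {\<lambda>i. if m \<le> i \<and> i < m + n then 0 else \<sigma> i}" by (intro X(2)) auto
    then show "sem (conc X (clear (m + n))) \<sigma> = {\<lambda>i. if m \<le> i \<and> i < m + Suc n then 0 else \<sigma> i}"
      using \<sigma> by (auto simp: sem_conc fun_eq_iff)
  qed
qed

lemma rec_eval_Comp_iff: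
  "rec_eval (Comp f gs) xs z \<longleftrightarrow> (\<exists>ys. list_all2 (\<lambda>g y. rec_eval g xs y) gs ys \<and> rec_eval f ys z)"
  by (auto elim: rec_eval_CompE intro: rec_eval.comp)

text \<open>The arguments are evaluated into fresh registers, \<open>f\<close> is applied to these,
  and they are wiped, which restores the zeros from \<open>m\<close> on that
  \<open>implements\<close> demands at exit.\<close>

lemma compiles_Comp:
  assumes "compiles f" "\<And>g. g \<in> set gs \<Longrightarrow> compiles g"
  shows "compiles (Comp f gs)"
  unfolding compiles_def
proof (intro allI impI)
  fix args :: "nat list" and out m :: nat
  assume *: "set args \<subseteq> {..<m}" "out < m" "out \<notin> set args"
  let ?l = "length gs" and ?R = "\<lambda>\<sigma> g y. rec_eval g (map (nat \<circ> \<sigma>) args) y"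
  from compile_arguments[OF assms(2) *(1), of gs] obtain X where
    X: "prog X" "\<And>\<sigma>. (\<forall>i\<ge>m. \<sigma> i = 0) \<Longrightarrow> (\<forall>i\<in>set args. \<sigma> i \<ge> 0) \<Longrightarrow>
      sem X \<sigma> = {load \<sigma> m ys | ys. list_all2 (?R \<sigma>) gs ys}" by auto
  obtain Y where Y: "implements f [m..<m + ?l] out (m + ?l) Y"
    by (rule compilesD[OF assms(1), of "[m..<m + ?l]" "m + ?l" out]) (use * in auto)
  from clear_registers[of m ?l] obtain Z where
    Z: "prog Z" "\<And>\<sigma>. (\<forall>i. m \<le> i \<and> i < m + ?l \<longrightarrow> \<sigma> i \<ge> 0) \<Longrightarrow>
      sem Z \<sigma> = {\<lambda>i. if m \<le> i \<and> i < m + ?l then 0 else \<sigma> i}" by blast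
  have "implements (Comp f gs) args out m (conc X (conc Y Z))"
  proof (rule implementsI)
    show "prog (conc X (conc Y Z))" by (intro prog_conc X(1) implements_prog[OF Y] Z(1))
    fix \<sigma> :: "nat \<Rightarrow> int"
    assume \<sigma>: "\<And>i. i \<ge> m \<Longrightarrow> \<sigma> i = 0" "\<sigma> out = 0" "\<And>i. i \<in> set args \<Longrightarrow> \<sigma> i \<ge> 0"
    have 1: "sem (conc Y Z) (load \<sigma> m ys) = {\<sigma>(out := int z) | z. rec_eval f ys z}"
      if ys: "list_all2 (?R \<sigma>) gs ys" for ys
    proof -
      have len: "length ys = ?l" using list_all2_lengthD[OF ys] by simp
      have "sem Y (load \<sigma> m ys) = {(load \<sigma> m ys)(out := int z) | z. rec_eval f ys z}"
      proof (rule implementsD[OF Y])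
        show "map (nat \<circ> load \<sigma> m ys) [m..<m + ?l] = ys"
          using len by (auto intro!: nth_equalityI simp: load_def)
      qed (use \<sigma> * len in \<open>auto simp: load_def\<close>)
      moreover have "sem Z ((load \<sigma> m ys)(out := int z)) = {\<sigma>(out := int z)}" for z
        by (subst Z(2)) (use \<sigma> * len in \<open>auto simp: load_def fun_eq_iff\<close>)
      ultimately show ?thesis by (auto simp: sem_conc)
    qed
    have "sem (conc X (conc Y Z)) \<sigma> = (\<Union>\<tau>\<in>{load \<sigma> m ys | ys. list_all2 (?R \<sigma>) gs ys}. sem (conc Y Z) \<tau>)"
      unfolding sem_conc[of X] using \<sigma> by (subst X(2)) auto
    also have "\<dots> = {\<sigma>(out := int z) | z. rec_eval (Comp f gs) (map (nat \<circ> \<sigma>) args) z}"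
      unfolding rec_eval_Comp_iff using 1 by (auto; blast)
    finally show "sem (conc X (conc Y Z)) \<sigma> =
      {\<sigma>(out := int z) | z. rec_eval (Comp f gs) (map (nat \<circ> \<sigma>) args) z}" .
  qed
  then show "\<exists>X. implements (Comp f gs) args out m X" by blast
qed

lemma rec_eval_PrimRec_iff:
  "rec_eval (PrimRec g h) (0 # xs) z \<longleftrightarrow> rec_eval g xs z"
  "rec_eval (PrimRec g h) (Suc n # xs) z \<longleftrightarrow>
    (\<exists>r. rec_eval (PrimRec g h) (n # xs) r \<and> rec_eval h (n # r # xs) z)"
  by (auto elim: rec_eval_PrimRec0E rec_eval_PrimRecSucE intro: rec_eval.primrec_0 rec_eval.primrec_Suc)

lemma rec_eval_Mu_iff:
  "rec_eval (Mu f) xs n \<longleftrightarrow> rec_eval f (n # xs) 0 \<and> (\<forall>m<n. \<exists>y. rec_eval f (m # xs) (Suc y))"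
  by (auto elim: rec_eval_MuE intro: rec_eval.mu)

lemma compiles_PrimRec:
  assumes "compiles g" "compiles h"
  shows "compiles (PrimRec g h)"
  unfolding compiles_def
proof (intro allI impI)
  fix args :: "nat list" and out m :: nat
  assume *: "set args \<subseteq> {..<m}" "out < m" "out \<notin> set args"
  show "\<exists>X. implements (PrimRec g h) args out m X"
  proof (cases args)
    case Nil
    \<comment> \<open>Primitive recursion is undefined on the empty tuple, and the empty language
      has no run.\<close>
    have "\<not> rec_eval (PrimRec g h) [] y" for y
      by (auto elim: rec_eval.cases)
    then have "implements (PrimRec g h) args out m {}"
      by (intro implementsI) (auto simp: Nil)
    then show ?thesis by blast
  next
    case (Cons a as)
    \<comment> \<open>Register \<open>m\<close> counts the remaining rounds, \<open>m + 1\<close>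
      the rounds done; \<open>m + 2\<close> holds the accumulated value and \<open>m + 3\<close> the
      result of one call of \<open>h\<close>.\<close>
    obtain G where G: "implements g as (m + 2) (m + 4) G"
      by (rule compilesD[OF assms(1), of as "m + 4" "m + 2"]) (use * Cons in auto)
    obtain H where H: "implements h ((m + 1) # (m + 2) # as) (m + 3) (m + 4) H"
      by (rule compilesD[OF assms(2), of "(m + 1) # (m + 2) # as" "m + 4" "m + 3"]) (use * Cons in auto)
    define B where "B = conc {[dec m]} (conc H (conc (clear (m + 2)) (conc (move (m + 3) (m + 2)) {[inc (m + 1)]})))"
    define E where "E = conc {[tst m]} (conc (move (m + 2) out) (clear (m + 1)))"
    define X where "X = conc (copy a m (m + 1)) (conc G (conc (star B) E))"
    have "implements (PrimRec g h) args out m X"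
    proof (rule implementsI)
      show "prog X"
        unfolding X_def B_def E_def
        by (intro prog_conc prog_star prog_basic prog_macros implements_prog[OF G] implements_prog[OF H])
      fix \<sigma> :: "nat \<Rightarrow> int"
      assume \<sigma>: "\<And>i. i \<ge> m \<Longrightarrow> \<sigma> i = 0" "\<sigma> out = 0" "\<And>i. i \<in> set args \<Longrightarrow> \<sigma> i \<ge> 0"
      define N where "N = nat (\<sigma> a)"
      have N: "\<sigma> a = int N" using \<sigma>(3)[of a] by (simp add: N_def Cons)
      let ?xs = "map (nat \<circ> \<sigma>) as"
      \<comment> \<open>The star may run past \<open>N\<close> rounds; register \<open>m\<close> is
        then negative and \<open>E\<close> has no passing run from there.\<close>
      define st where "st j r = \<sigma>(m := int N - int j, m + 1 := int j, m + 2 := int r)" for j r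
      have am: "a < m" "a \<noteq> out" using * Cons by auto
      have as: "i \<in> set as \<Longrightarrow> i < m \<and> i \<noteq> out" for i using * Cons by auto
      have 1: "sem (copy a m (m + 1)) \<sigma> = {\<sigma>(m := int N)}"
        using sem_copy[of m a "m + 1" \<sigma>] \<sigma> am by (simp add: N)
      have "sem G (\<sigma>(m := int N)) = {(\<sigma>(m := int N))(m + 2 := int r) | r. rec_eval g ?xs r}"
        by (rule implementsD[OF G]) (use \<sigma> as Cons in \<open>auto dest: as\<close>)
      also have "\<dots> = {st 0 r | r. rec_eval g ?xs r}"
      proof -
        have "(\<sigma>(m := int N))(m + 2 := int r) = st 0 r" for r
          using \<sigma>(1)[of "m + 1"] by (auto simp: st_def fun_eq_iff)
        then show ?thesis by simp
      qed
      finally have 2: "sem G (\<sigma>(m := int N)) = {st 0 r | r. rec_eval g ?xs r}" .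
      have body: "sem B (st j r) = {st (Suc j) s | s. rec_eval h (j # r # ?xs) s}" for j r
      proof -
        let ?\<tau> = "(st j r)(m := int N - int j - 1)"
        have "sem H ?\<tau> = {?\<tau>(m + 3 := int s) | s. rec_eval h (j # r # ?xs) s}"
          by (rule implementsD[OF H]) (use \<sigma> as Cons in \<open>auto simp: st_def dest: as\<close>)
        moreover have "sem (conc (clear (m + 2)) (conc (move (m + 3) (m + 2)) {[inc (m + 1)]}))
            (?\<tau>(m + 3 := int s)) = {st (Suc j) s}" for s
          using \<sigma>(1)[of "m + 3"] by (auto simp: sem_conc st_def fun_eq_iff)
        moreover have "sem B (st j r) = (\<Union>\<tau>\<in>sem H ?\<tau>.
            sem (conc (clear (m + 2)) (conc (move (m + 3) (m + 2)) {[inc (m + 1)]})) \<tau>)"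
          unfolding B_def sem_conc[of "{[dec m]}"] sem_conc[of H] by (simp add: st_def)
        ultimately show ?thesis by (auto; blast)
      qed
      have loop: "(\<Union>\<tau>\<in>{st 0 r | r. rec_eval g ?xs r}. sem (star B) \<tau>) =
          {st j r | j r. rec_eval (PrimRec g h) (j # ?xs) r}"
      proof (intro equalityI subsetI)
        fix \<tau> assume "\<tau> \<in> (\<Union>\<tau>\<in>{st 0 r | r. rec_eval g ?xs r}. sem (star B) \<tau>)"
        then obtain r where r: "rec_eval g ?xs r" "(\<lambda>s t. t \<in> sem B s)\<^sup>*\<^sup>* (st 0 r) \<tau>"
          by (auto simp: sem_star)
        from r(2) show "\<tau> \<in> {st j r | j r. rec_eval (PrimRec g h) (j # ?xs) r}"
        proof (induction rule: rtranclp_induct)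
          case base
          have "rec_eval (PrimRec g h) (0 # ?xs) r" using r(1) by (rule rec_eval.primrec_0)
          then show ?case by blast
        next
          case (step y z)
          from step.IH obtain j q where q: "y = st j q" "rec_eval (PrimRec g h) (j # ?xs) q" by blast
          with step.hyps(2) obtain s where s: "z = st (Suc j) s" "rec_eval h (j # q # ?xs) s"
            unfolding q(1) body by blast
          from q(2) s(2) have "rec_eval (PrimRec g h) (Suc j # ?xs) s" by (rule rec_eval.primrec_Suc)
          then show ?case using s(1) by blast
        qed
      next
        have "rec_eval (PrimRec g h) (j # ?xs) r \<Longrightarrow>
            \<exists>r0. rec_eval g ?xs r0 \<and> (\<lambda>s t. t \<in> sem B s)\<^sup>*\<^sup>* (st 0 r0) (st j r)" for j r
        proof (induction j arbitrary: r)
          case 0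
          then show ?case unfolding rec_eval_PrimRec_iff by blast
        next
          case (Suc j)
          then obtain q where q: "rec_eval (PrimRec g h) (j # ?xs) q" "rec_eval h (j # q # ?xs) r"
            unfolding rec_eval_PrimRec_iff by blast
          from Suc.IH[OF q(1)] obtain r0 where "rec_eval g ?xs r0"
            "(\<lambda>s t. t \<in> sem B s)\<^sup>*\<^sup>* (st 0 r0) (st j q)" by blast
          moreover have "st (Suc j) r \<in> sem B (st j q)" unfolding body using q(2) by blast
          ultimately show ?case by (meson rtranclp.rtrancl_into_rtrancl)
        qed
        then show "\<tau> \<in> (\<Union>\<tau>\<in>{st 0 r | r. rec_eval g ?xs r}. sem (star B) \<tau>)"
          if "\<tau> \<in> {st j r | j r. rec_eval (PrimRec g h) (j # ?xs) r}" for \<tau>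
          using that unfolding sem_star by blast
      qed
      have exit: "sem E (st j r) = (if j = N then {\<sigma>(out := int r)} else {})" for j r
      proof -
        have "sem E (st j r) = (if j = N then {(st j r)(m + 2 := 0, out := int r, m + 1 := 0)} else {})"
          unfolding E_def using *(2) \<sigma>(2) by (auto simp: sem_conc st_def)
        moreover have "(st N r)(m + 2 := 0, out := int r, m + 1 := 0) = \<sigma>(out := int r)"
          using *(2) \<sigma>(1) by (auto simp: st_def fun_eq_iff)
        ultimately show ?thesis by auto
      qed
      have "sem X \<sigma> = (\<Union>\<rho>\<in>(\<Union>\<tau>\<in>{st 0 r | r. rec_eval g ?xs r}. sem (star B) \<tau>). sem E \<rho>)"
        unfolding X_def sem_conc 1 by (simp add: 2)
      also have "\<dots> = {\<sigma>(out := int r) | r. rec_eval (PrimRec g h) (N # ?xs) r}"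
        unfolding loop
      proof (intro equalityI subsetI)
        fix \<tau> assume "\<tau> \<in> (\<Union>\<rho>\<in>{st j r | j r. rec_eval (PrimRec g h) (j # ?xs) r}. sem E \<rho>)"
        then obtain j r where "rec_eval (PrimRec g h) (j # ?xs) r" "\<tau> \<in> sem E (st j r)" by blast
        then show "\<tau> \<in> {\<sigma>(out := int r) | r. rec_eval (PrimRec g h) (N # ?xs) r}"
          unfolding exit by (auto split: if_splits)
      next
        fix \<tau> assume "\<tau> \<in> {\<sigma>(out := int r) | r. rec_eval (PrimRec g h) (N # ?xs) r}"
        then obtain r where "rec_eval (PrimRec g h) (N # ?xs) r" "\<tau> = \<sigma>(out := int r)" by blast
        moreover from this have "\<tau> \<in> sem E (st N r)" unfolding exit by simp
        ultimately show "\<tau> \<in> (\<Union>\<rho>\<in>{st j r | j r. rec_eval (PrimRec g h) (j # ?xs) r}. sem E \<rho>)" by blast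
      qed
      finally show "sem X \<sigma> = {\<sigma>(out := int y) | y. rec_eval (PrimRec g h) (map (nat \<circ> \<sigma>) args) y}"
        by (simp add: Cons N_def)
    qed
    then show ?thesis by blast
  qed
qed

lemma compiles_Mu:
  assumes "compiles f"
  shows "compiles (Mu f)"
  unfolding compiles_def
proof (intro allI impI)
  fix args :: "nat list" and out m :: nat
  assume *: "set args \<subseteq> {..<m}" "out < m" "out \<notin> set args"
  obtain F where F: "implements f (m # args) (m + 1) (m + 2) F"
    by (rule compilesD[OF assms(1), of "m # args" "m + 2" "m + 1"]) (use * in auto)
  \<comment> \<open>At value \<open>0\<close> the decrement leads to \<open>-1\<close>, from which
    \<open>clear\<close> never passes. Hence the body has a passing run only if the value of
    \<open>f\<close> is positive.\<close>
  define B where "B = conc F (conc {[dec (m + 1)]} (conc (clear (m + 1)) {[inc m]}))"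
  \<comment> \<open>The final call of \<open>f\<close> must return \<open>0\<close>; the candidate
    in register \<open>m\<close> is then the result.\<close>
  define E where "E = conc F (conc {[tst (m + 1)]} (move m out))"
  have "implements (Mu f) args out m (conc (star B) E)"
  proof (rule implementsI)
    show "prog (conc (star B) E)"
      unfolding B_def E_def
      by (intro prog_conc prog_star prog_basic prog_macros implements_prog[OF F])
    fix \<sigma> :: "nat \<Rightarrow> int"
    assume \<sigma>: "\<And>i. i \<ge> m \<Longrightarrow> \<sigma> i = 0" "\<sigma> out = 0" "\<And>i. i \<in> set args \<Longrightarrow> \<sigma> i \<ge> 0"
    let ?xs = "map (nat \<circ> \<sigma>) args"
    define st where "st j = \<sigma>(m := int j)" for j
    have args: "i \<in> set args \<Longrightarrow> i < m" for i using * by auto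
    have f: "sem F (st j) = {(st j)(m + 1 := int y) | y. rec_eval f (j # ?xs) y}" for j
      by (rule implementsD[OF F]) (use \<sigma> * in \<open>auto simp: st_def dest: args\<close>)
    have body: "sem B (st j) = {st (Suc j) | y. rec_eval f (j # ?xs) (Suc y)}" for j
    proof -
      have "sem (conc {[dec (m + 1)]} (conc (clear (m + 1)) {[inc m]})) ((st j)(m + 1 := int y)) =
          (if y = 0 then {} else {st (Suc j)})" for y
        using \<sigma>(1)[of "m + 1"] by (auto simp: sem_conc st_def fun_eq_iff)
      then have "sem B (st j) = (\<Union>y\<in>{y. rec_eval f (j # ?xs) y}. if y = 0 then {} else {st (Suc j)})"
        unfolding B_def sem_conc[of F] f by fastforce
      also have "\<dots> = {st (Suc j) | y. rec_eval f (j # ?xs) (Suc y)}"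
        by (auto split: if_splits simp: gr0_conv_Suc)
      finally show ?thesis .
    qed
    have exit: "sem E (st j) = {\<sigma>(out := int j) | y. rec_eval f (j # ?xs) 0 \<and> y = (0 :: nat)}" for j
    proof -
      have "sem (conc {[tst (m + 1)]} (move m out)) ((st j)(m + 1 := int y)) =
          (if y = 0 then {\<sigma>(out := int j)} else {})" for y
      proof -
        have "sem (conc {[tst (m + 1)]} (move m out)) ((st j)(m + 1 := int y)) =
            (if y = 0 then {(st j)(m + 1 := 0, m := 0, out := int j)} else {})"
          using *(2) \<sigma>(2) by (simp add: sem_conc st_def)
        moreover have "(st j)(m + 1 := 0, m := 0, out := int j) = \<sigma>(out := int j)"
          using *(2) \<sigma>(1)[of m] \<sigma>(1)[of "m + 1"] by (simp add: st_def fun_eq_iff)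
        ultimately show ?thesis by simp
      qed
      then have "sem E (st j) = (\<Union>y\<in>{y. rec_eval f (j # ?xs) y}. if y = 0 then {\<sigma>(out := int j)} else {})"
        unfolding E_def sem_conc[of F] f by fastforce
      also have "\<dots> = {\<sigma>(out := int j) | y. rec_eval f (j # ?xs) 0 \<and> y = (0 :: nat)}"
        by (auto split: if_splits)
      finally show ?thesis .
    qed
    have loop: "sem (star B) (st 0) = {st j | j. \<forall>i<j. \<exists>y. rec_eval f (i # ?xs) (Suc y)}"
    proof (intro equalityI subsetI)
      fix \<tau> assume "\<tau> \<in> sem (star B) (st 0)"
      then have "(\<lambda>s t. t \<in> sem B s)\<^sup>*\<^sup>* (st 0) \<tau>" by (simp add: sem_star)
      then show "\<tau> \<in> {st j | j. \<forall>i<j. \<exists>y. rec_eval f (i # ?xs) (Suc y)}"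
      proof (induction rule: rtranclp_induct)
        case base
        have "\<forall>i<0. \<exists>y. rec_eval f (i # ?xs) (Suc y)" by simp
        then show ?case by blast
      next
        case (step y z)
        from step.IH obtain j where j: "y = st j" "\<forall>i<j. \<exists>y. rec_eval f (i # ?xs) (Suc y)" by blast
        with step.hyps(2) have "z = st (Suc j)" "\<exists>y. rec_eval f (j # ?xs) (Suc y)"
          unfolding j(1) body by blast+
        moreover from this j(2) have "\<forall>i<Suc j. \<exists>y. rec_eval f (i # ?xs) (Suc y)"
          using less_Suc_eq by auto
        ultimately show ?case by blast
      qed
    next
      have "\<forall>i<j. \<exists>y. rec_eval f (i # ?xs) (Suc y) \<Longrightarrow> (\<lambda>s t. t \<in> sem B s)\<^sup>*\<^sup>* (st 0) (st j)" for j
      proof (induction j)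
        case (Suc j)
        then have "(\<lambda>s t. t \<in> sem B s)\<^sup>*\<^sup>* (st 0) (st j)" by simp
        moreover have "st (Suc j) \<in> sem B (st j)" unfolding body using Suc.prems by blast
        ultimately show ?case by (meson rtranclp.rtrancl_into_rtrancl)
      qed simp
      then show "\<tau> \<in> sem (star B) (st 0)"
        if "\<tau> \<in> {st j | j. \<forall>i<j. \<exists>y. rec_eval f (i # ?xs) (Suc y)}" for \<tau>
        using that unfolding sem_star by blast
    qed
    have "st 0 = \<sigma>" using \<sigma>(1)[of m] by (auto simp: st_def)
    then have "sem (conc (star B) E) \<sigma> = (\<Union>\<tau>\<in>sem (star B) (st 0). sem E \<tau>)" by (simp add: sem_conc)
    also have "\<dots> = {\<sigma>(out := int y) | y. rec_eval (Mu f) ?xs y}"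
    proof (intro equalityI subsetI)
      fix \<tau> assume "\<tau> \<in> (\<Union>\<tau>\<in>sem (star B) (st 0). sem E \<tau>)"
      then obtain j where "\<forall>i<j. \<exists>y. rec_eval f (i # ?xs) (Suc y)" "\<tau> \<in> sem E (st j)"
        unfolding loop by blast
      then show "\<tau> \<in> {\<sigma>(out := int y) | y. rec_eval (Mu f) ?xs y}"
        unfolding exit rec_eval_Mu_iff by blast
    next
      fix \<tau> assume "\<tau> \<in> {\<sigma>(out := int y) | y. rec_eval (Mu f) ?xs y}"
      then obtain j where j: "\<tau> = \<sigma>(out := int j)" "rec_eval f (j # ?xs) 0"
        "\<forall>i<j. \<exists>y. rec_eval f (i # ?xs) (Suc y)" unfolding rec_eval_Mu_iff by blast
      then have "\<tau> \<in> sem E (st j)" unfolding exit by blast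
      then show "\<tau> \<in> (\<Union>\<tau>\<in>sem (star B) (st 0). sem E \<tau>)" unfolding loop using j(3) by blast
    qed
    finally show "sem (conc (star B) E) \<sigma> = {\<sigma>(out := int y) | y. rec_eval (Mu f) ?xs y}" .
  qed
  then show "\<exists>X. implements (Mu f) args out m X" by blast
qed

lemma compiles: "compiles g"
proof (induction g)
  case (Comp f gs)
  then show ?case by (intro compiles_Comp) auto
qed (auto intro: compiles_Zero compiles_Succ compiles_Proj compiles_PrimRec compiles_Mu)

section \<open>Quotients of free semigroups by ideals\<close>

lemma plus_words_iff: "w \<in> plus_words A \<longleftrightarrow> w \<in> lists A \<and> w \<noteq> []"
  by (simp add: plus_words_def)

text \<open>Normal forms, coded as numbers because decidability is defined for semigroups of natural
  numbers. The zero is represented by the one-letter word \<open>[z]\<close>.\<close>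

definition elt :: "nat list set \<Rightarrow> nat \<Rightarrow> nat list \<Rightarrow> nat" where
  "elt I z w = list_encode (if w \<in> I then [z] else w)"

definition quot :: "nat set \<Rightarrow> nat list set \<Rightarrow> nat \<Rightarrow> nat sgp" where
  "quot A I z = \<lparr>sg_carrier = elt I z ` plus_words A,
    sg_mult = \<lambda>x y. elt I z (list_decode x @ list_decode y)\<rparr>"

locale word_ideal =
  fixes A :: "nat set" and I :: "nat list set" and z :: nat
  assumes finite_A: "finite A" and z_in_A: "z \<in> A" and I_words: "I \<subseteq> plus_words A"
    and z_in_I: "[z] \<in> I"
    and ideal: "w \<in> I \<Longrightarrow> u \<in> lists A \<Longrightarrow> v \<in> lists A \<Longrightarrow> u @ w @ v \<in> I"
begin

lemma I_lists: "w \<in> I \<Longrightarrow> w \<in> lists A" and Nil_not_in_I: "[] \<notin> I"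
  using I_words unfolding plus_words_def by blast+

lemma ideal_left: "w \<in> I \<Longrightarrow> u \<in> lists A \<Longrightarrow> u @ w \<in> I"
  using ideal[of w u "[]"] by simp

lemma ideal_right: "w \<in> I \<Longrightarrow> v \<in> lists A \<Longrightarrow> w @ v \<in> I"
  using ideal[of w "[]" v] by simp

lemma elt_eq_iff: "elt I z u = elt I z v \<longleftrightarrow> u = v \<or> u \<in> I \<and> v \<in> I"
  using z_in_I by (auto simp: elt_def list_encode_eq)

lemma mult_elt:
  assumes "u \<in> plus_words A" "v \<in> plus_words A"
  shows "sg_mult (quot A I z) (elt I z u) (elt I z v) = elt I z (u @ v)"
proof -
  have "elt I z ((if u \<in> I then [z] else u) @ (if v \<in> I then [z] else v)) = elt I z (u @ v)"
    using assms z_in_I z_in_A ideal_left[of v u] ideal_right[of u v]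
      ideal_left[of "[z]" u] ideal_right[of "[z]" v] ideal_right[of "[z]" "[z]"]
    by (auto simp: elt_eq_iff plus_words_iff)
  then show ?thesis by (simp add: quot_def elt_def[of I z u] elt_def[of I z v])
qed

lemma plus_words_append: "u \<in> plus_words A \<Longrightarrow> v \<in> plus_words A \<Longrightarrow> u @ v \<in> plus_words A"
  by (auto simp: plus_words_iff)

lemma carrier_quot: "sg_carrier (quot A I z) = elt I z ` plus_words A"
  by (simp add: quot_def)

lemma semigroup_quot: "is_semigroup (quot A I z)"
proof -
  have "[z] \<in> plus_words A" using z_in_A by (simp add: plus_words_iff)
  then show ?thesis
    unfolding is_semigroup_def carrier_quot
    by (auto simp: mult_elt plus_words_append)
qed

lemma free_hom_quot: "free_hom A (quot A I z) (elt I z)"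
  unfolding free_hom_def carrier_quot by (auto simp: mult_elt)

text \<open>Two letters in \<open>I\<close> would name the same element; allowing only
  \<open>z\<close> there keeps the interpretation injective on the alphabet. As every non-empty word
  is a representative, letters can be assigned to themselves.\<close>

lemma interpreted_quot:
  assumes "wh_A \<Sigma> = A" "wh_L \<Sigma> = plus_words A"
    and M: "wh_M \<Sigma> = {hword u v w | u v w. u \<in> plus_words A \<and> v \<in> plus_words A \<and> w \<in> plus_words A \<and>
      (u @ v = w \<or> u @ v \<in> I \<and> w \<in> I)}"
    and "\<forall>(p, a, q) \<in> set (nfa_trans (wh_aut \<Sigma>)). a \<in> A"
    and "\<forall>(N, r) \<in> set (cfg_prods (wh_gram \<Sigma>)). \<forall>t. Inr t \<in> set r \<longrightarrow> t \<in> Letter ` A \<union> {Hash1, Hash2}"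
    and letters: "\<And>a. [a] \<in> I \<Longrightarrow> a = z"
  shows "interpreted_wh_structure \<Sigma> (quot A I z)"
proof -
  have "pre_word_hyperbolic \<Sigma>"
    unfolding pre_word_hyperbolic_def assms(1,2)
  proof (intro conjI)
    show "wh_M \<Sigma> \<subseteq> {hword u v w | u v w. u \<in> plus_words A \<and> v \<in> plus_words A \<and> w \<in> plus_words A}"
      unfolding M by blast
  qed (use assms(4,5) in \<open>simp_all add: plus_words_iff\<close>)
  moreover have "wh_interpretation \<Sigma> (quot A I z) (elt I z)"
    unfolding wh_interpretation_def assms(1,2) carrier_quot
  proof (intro conjI free_hom_quot)
    show "inj_on (\<lambda>a. elt I z [a]) A"
      using letters by (auto simp: inj_on_def elt_eq_iff)
    have "sg_mult (quot A I z) (elt I z u) (elt I z v) = elt I z w \<longleftrightarrow> u @ v = w \<or> u @ v \<in> I \<and> w \<in> I"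
      if "u \<in> plus_words A" "v \<in> plus_words A" for u v w
      unfolding mult_elt[OF that] elt_eq_iff ..
    then show "wh_M \<Sigma> = {hword u v w | u v w. u \<in> plus_words A \<and> v \<in> plus_words A \<and> w \<in> plus_words A \<and>
        sg_mult (quot A I z) (elt I z u) (elt I z v) = elt I z w}"
      unfolding M by (intro Collect_cong ex_cong1) blast
  qed simp
  ultimately show ?thesis
    unfolding interpreted_wh_structure_def assignment_of_generators_def assms(1,2)
    using semigroup_quot by (auto simp: plus_words_iff)
qed

end

text \<open>Words outside the ideal are singleton classes. Hence an arbitrary finite generating set
  contains the letter \<open>p\<close>, and the substitution of words for generators recovers such a word from
  any of its representatives.\<close>

lemma (in word_ideal) async_automatic_fin_quot:
  assumes "async_automatic (quot A I z)" "p \<in> A" "[p] \<notin> I"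
  obtains X where "fin_quot X" "\<And>y. y \<in> plus_words A \<Longrightarrow> y \<notin> I \<Longrightarrow> y \<in> X \<longleftrightarrow> y @ [p] \<in> I"
proof -
  let ?S = "quot A I z"
  from assms(1) obtain B :: "nat set" and \<rho> L where S: "async_automatic_structure ?S B \<rho> L"
    unfolding async_automatic_def by blast
  then have "rep_language ?S B \<rho> L" by (simp add: async_automatic_structure_def)
  then have rep: "free_hom B ?S \<rho>" "\<rho> ` plus_words B = sg_carrier ?S" "L \<subseteq> plus_words B"
      "\<And>s. s \<in> sg_carrier ?S \<Longrightarrow> \<exists>w\<in>L. \<rho> w = s"
    by (simp_all add: rep_language_def)
  have rat: "rational_rel (rel_right \<rho> L x)" if "x \<in> letters_eps B" for x
    using S that by (simp add: async_automatic_structure_def)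
  have "\<exists>w. w \<in> plus_words A \<and> elt I z w = \<rho> [a]" if "a \<in> B" for a
  proof -
    have "\<rho> [a] \<in> \<rho> ` plus_words B" using that by (intro imageI) (simp add: plus_words_iff)
    then have "\<rho> [a] \<in> elt I z ` plus_words A" unfolding rep(2) carrier_quot .
    then show ?thesis by force
  qed
  \<comment> \<open>\<open>h\<close> chooses a word over \<open>A\<close> for each generator in
    \<open>B\<close>, so that \<open>hom h\<close> translates a word over \<open>B\<close> into one
    over \<open>A\<close> with the same value.\<close>
  then obtain h where h: "\<And>a. a \<in> B \<Longrightarrow> h a \<in> plus_words A" "\<And>a. a \<in> B \<Longrightarrow> elt I z (h a) = \<rho> [a]"
    by metis
  have mult: "\<rho> (u @ v) = sg_mult ?S (\<rho> u) (\<rho> v)" if "u \<in> plus_words B" "v \<in> plus_words B" for u v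
    using rep(1) that unfolding free_hom_def by blast
  have hom: "hom h u \<in> plus_words A \<and> elt I z (hom h u) = \<rho> u" if "u \<in> plus_words B" for u
  proof -
    from that have "u \<noteq> []" "u \<in> lists B" by (auto simp: plus_words_iff)
    then show ?thesis
    proof (induction u rule: list_nonempty_induct)
      case (single a)
      then show ?case using h by simp
    next
      case (cons a u)
      then have a: "a \<in> B" "u \<in> plus_words B" "hom h u \<in> plus_words A" "elt I z (hom h u) = \<rho> u"
        by (auto simp: plus_words_iff)
      then have "\<rho> (a # u) = sg_mult ?S (elt I z (h a)) (elt I z (hom h u))"
        using mult[of "[a]" u] h(2) by (simp add: plus_words_iff)
      also have "\<dots> = elt I z (h a @ hom h u)" using a h(1) by (intro mult_elt)
      finally show ?case using a h(1) by (simp add: plus_words_append)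
    qed
  qed
  have p: "[p] \<in> plus_words A" and z: "[z] \<in> plus_words A"
    using assms(2) z_in_A by (auto simp: plus_words_iff)
  have "elt I z [p] \<in> \<rho> ` plus_words B" unfolding rep(2) carrier_quot using p by (rule imageI)
  then obtain w where w: "w \<in> plus_words B" "elt I z (hom h w) = elt I z [p]" using hom by force
  then have "hom h w = [p]" using assms(3) by (simp add: elt_eq_iff)
  \<comment> \<open>\<open>hom h w\<close> has length one and every \<open>h b\<close> is non-empty,
    so \<open>w\<close> is a single generator. Multiplication by \<open>p\<close> is thus among the
    given rational relations.\<close>
  have "\<exists>b. w = [b] \<and> b \<in> B"
  proof (cases w)
    case (Cons b w')
    have "w' = []"
    proof (rule ccontr)
      assume "w' \<noteq> []"
      then have "hom h w' \<noteq> []" "h b \<noteq> []"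
        using hom[of w'] h(1)[of b] w(1) Cons by (auto simp: plus_words_iff)
      then show False using \<open>hom h w = [p]\<close> Cons by (auto simp: append_eq_Cons_conv)
    qed
    then show ?thesis using w(1) Cons by (simp add: plus_words_iff)
  qed (use w(1) in \<open>simp add: plus_words_iff\<close>)
  then obtain b where b: "b \<in> B" "h b = [p]" using \<open>hom h w = [p]\<close> by auto
  have "elt I z [z] \<in> sg_carrier ?S" unfolding carrier_quot using z by (rule imageI)
  from rep(4)[OF this] obtain u0 where u0: "u0 \<in> L" "\<rho> u0 = elt I z [z]" by blast
  \<comment> \<open>All words of \<open>L\<close> that represent the zero, as those equal in value
    to the fixed \<open>u0\<close>. The homomorphism is the identity here, and the converse puts
    \<open>u0\<close> on the second track.\<close>
  define R where "R = {concat (map (\<lambda>a. [a]) v) | v. \<exists>u\<in>{u0}. (v, u) \<in> (rel_right \<rho> L [])\<inverse>}"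
  have "rational_rel ((rel_right \<rho> L [])\<inverse>)"
    by (intro rational_rel_converse rat) (simp add: letters_eps_def)
  then have "fin_quot R" unfolding R_def by (rule fin_quot_rational_preimage) (simp add: fin_quot_finite)
  have R: "v \<in> R \<longleftrightarrow> v \<in> L \<and> \<rho> v = elt I z [z]" for v
    unfolding R_def using u0 by (auto simp: rel_right_def)
  \<comment> \<open>Translations of the words \<open>u\<close> for which \<open>u @ [b]\<close>
    represents the zero. A word \<open>y\<close> outside \<open>I\<close> is the translation of each
    of its representatives, so it does not matter which of them is used.\<close>
  define X where "X = {concat (map h u) | u. \<exists>v\<in>R. (u, v) \<in> rel_right \<rho> L [b]}"
  have "rational_rel (rel_right \<rho> L [b])" using b(1) by (intro rat) (simp add: letters_eps_def)
  then have "fin_quot X" unfolding X_def using \<open>fin_quot R\<close> by (rule fin_quot_rational_preimage)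
  moreover have "y \<in> X \<longleftrightarrow> y @ [p] \<in> I" if y: "y \<in> plus_words A" "y \<notin> I" for y
  proof -
    have step: "\<rho> (u @ [b]) = elt I z (hom h u @ [p])" if "u \<in> L" for u
    proof -
      have "u \<in> plus_words B" using that rep(3) by blast
      then have "u @ [b] \<in> plus_words B" using b(1) by (simp add: plus_words_iff)
      from hom[OF this] show ?thesis using b(2) by simp
    qed
    show ?thesis
    proof
      assume "y \<in> X"
      then obtain u v where "y = concat (map h u)" "v \<in> R" "(u, v) \<in> rel_right \<rho> L [b]"
        unfolding X_def by blast
      then have "y = hom h u" "u \<in> L" "\<rho> (u @ [b]) = \<rho> v" "v \<in> R"
        by (simp_all add: rel_right_def hom_def)
      then have "elt I z (y @ [p]) = elt I z [z]" using step R by simp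
      then show "y @ [p] \<in> I" using z_in_I by (auto simp: elt_eq_iff)
    next
      assume "y @ [p] \<in> I"
      have "elt I z y \<in> sg_carrier ?S" unfolding carrier_quot using y(1) by (rule imageI)
      from rep(4)[OF this] obtain u where u: "u \<in> L" "\<rho> u = elt I z y" by blast
      with hom[of u] rep(3) have "elt I z (hom h u) = elt I z y" by auto
      then have "y = hom h u" using y(2) by (auto simp: elt_eq_iff)
      then have "y = concat (map h u)" "\<rho> (u @ [b]) = \<rho> u0"
        using step[OF u(1)] u0(2) \<open>y @ [p] \<in> I\<close> z_in_I by (simp_all add: elt_eq_iff hom_def)
      moreover from this(2) have "(u, u0) \<in> rel_right \<rho> L [b]"
        using u(1) u0(1) by (simp add: rel_right_def)
      moreover have "u0 \<in> R" using u0 R by simp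
      ultimately show "y \<in> X" unfolding X_def by blast
    qed
  qed
  ultimately show ?thesis by (rule that)
qed

text \<open>An automaton is a transducer with empty output, so the statement on preimages under
  transducers applies.\<close>

lemma regular_fin_quot:
  assumes "regular_lang X"
  shows "fin_quot X"
proof -
  from assms obtain M where X: "X = nfa_lang M" by (auto simp: regular_lang_def)
  let ?f = "\<lambda>a. ([a], [] :: nat list)"
  let ?T = "{(concat (map fst w), concat (map snd w)) | w. w \<in> map ?f ` nfa_lang M}"
  have "rational_rel ?T"
    unfolding rational_rel_def
    by (intro exI[of _ "\<lparr>nfa_init = nfa_init M, nfa_final = nfa_final M,
      nfa_trans = map (\<lambda>(p, a, q). (p, ?f a, q)) (nfa_trans M)\<rparr>"]) (simp only: nfa_lang_map)
  then have "fin_quot {concat (map (\<lambda>a. [a]) u) | u. \<exists>v\<in>{[]}. (u, v) \<in> ?T}"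
    by (rule fin_quot_rational_preimage) (simp add: fin_quot_finite)
  also have "{concat (map (\<lambda>a. [a]) u) | u. \<exists>v\<in>{[]}. (u, v) \<in> ?T} = X"
  proof -
    have f: "concat (map fst (map ?f w)) = w" "concat (map snd (map ?f w)) = []" for w
      by (induction w) auto
    have "?T = (\<lambda>w. (concat (map fst (map ?f w)), concat (map snd (map ?f w)))) ` X"
      unfolding X by blast
    then have T: "?T = (\<lambda>w. (w, [])) ` X" unfolding f .
    show ?thesis unfolding T by auto
  qed
  finally show ?thesis .
qed

section \<open>Padded relations for regular ideals\<close>

lemma fin_quot_rev:
  assumes "fin_quot X" "X \<subseteq> lists B" "finite B"
  shows "fin_quot (rev ` X)"
  by (rule regular_fin_quot[OF regular_rev[OF fin_quot_regular[OF assms]]])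

lemma fin_quot_Collect_append:
  assumes "fin_quot X"
  shows "fin_quot {u. u @ w \<in> X}"
proof (rule fin_quot_subset)
  show "finite ((\<lambda>D. {u. u @ w \<in> D}) ` range (lquot X))" using assms by (simp add: fin_quot_def)
  have "lquot {u. u @ w \<in> X} x = {u. u @ w \<in> lquot X x}" for x by (auto simp: lquot_def)
  then show "lquot {u. u @ w \<in> X} x \<in> (\<lambda>D. {u. u @ w \<in> D}) ` range (lquot X)" for x by blast
qed

text \<open>The padded form of the pair \<open>(u, a # u)\<close>. Left multiplication moves the
  word by one place, and the first argument is the letter still to be matched.\<close>

fun shift :: "'a \<Rightarrow> 'a list \<Rightarrow> ('a option \<times> 'a option) list" where
  "shift a [] = [(None, Some a)]"
| "shift a (b # u) = (Some b, Some a) # shift b u"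

lemma fin_quot_shift:
  assumes "fin_quot X" "X \<subseteq> lists A" "finite A"
  shows "fin_quot (shift a ` X)"
proof (rule fin_quotI)
  define Q where "Q = range (lquot X)"
  \<comment> \<open>A state is the pending letter with a left quotient; \<open>{[]}\<close> is
    reached after the final pair, which carries the padding.\<close>
  define F where "F = {{}, {[]}} \<union> (\<lambda>(b, D). shift b ` D) ` (insert a A \<times> Q)"
  have closed: "D \<in> Q \<Longrightarrow> lquot D w \<in> Q" for D w unfolding Q_def by (rule lquot_in_range)
  have sub: "D \<in> Q \<Longrightarrow> c # w \<in> D \<Longrightarrow> c \<in> A" for D c w
    using assms(2) unfolding Q_def by (auto simp: lquot_def)
  show "finite F" unfolding F_def Q_def using assms by (simp add: fin_quot_def)
  have "X \<in> Q" unfolding Q_def by (metis lquot_Nil rangeI)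
  then show "shift a ` X \<in> F" unfolding F_def by (intro UnI2 image_eqI[of _ _ "(a, X)"]) auto
  fix Y t assume "Y \<in> F"
  then consider "Y = {}" | "Y = {[]}" | b D where "Y = shift b ` D" "b \<in> insert a A" "D \<in> Q"
    unfolding F_def by auto
  then show "lquot Y [t] \<in> F"
  proof cases
    case 1
    then have "lquot Y [t] = {}" by (auto simp: lquot_def)
    then show ?thesis by (simp add: F_def)
  next
    case 2
    then have "lquot Y [t] = {}" by (auto simp: lquot_def)
    then show ?thesis by (simp add: F_def)
  next
    case 3
    have cons: "t # w \<in> Y \<longleftrightarrow> t = (None, Some b) \<and> w = [] \<and> [] \<in> D \<or>
        (\<exists>c u. t = (Some c, Some b) \<and> c # u \<in> D \<and> w = shift c u)" for w
    proof
      assume "t # w \<in> Y"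
      then obtain u where "u \<in> D" "t # w = shift b u" unfolding 3(1) by blast
      then show "t = (None, Some b) \<and> w = [] \<and> [] \<in> D \<or>
          (\<exists>c u. t = (Some c, Some b) \<and> c # u \<in> D \<and> w = shift c u)" by (cases u) auto
    next
      assume "t = (None, Some b) \<and> w = [] \<and> [] \<in> D \<or>
          (\<exists>c u. t = (Some c, Some b) \<and> c # u \<in> D \<and> w = shift c u)"
      then show "t # w \<in> Y" unfolding 3(1)
        by (elim disjE exE conjE; intro image_eqI[of _ _ "[]"] image_eqI[of _ _ "_ # _"]) simp_all
    qed
    show ?thesis
    proof (cases "\<exists>c \<in> A. t = (Some c, Some b)")
      case True
      then obtain c where c: "c \<in> A" "t = (Some c, Some b)" by blast
      have "(Some c, Some b) # w \<in> Y \<longleftrightarrow> (\<exists>u. c # u \<in> D \<and> w = shift c u)" for w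
        using cons[of w] unfolding c(2) by simp
      then have "lquot Y [t] = shift c ` lquot D [c]"
        by (auto simp: lquot_def c(2))
      then show ?thesis unfolding F_def using c(1) closed[OF 3(3)]
        by (intro UnI2 image_eqI[of _ _ "(c, lquot D [c])"]) auto
    next
      case False
      then have "lquot Y [t] \<in> {{}, {[]}}"
        using sub[OF 3(3)] by (auto simp: cons lquot_def)
      then show ?thesis by (auto simp: F_def)
    qed
  qed
qed

lemma deltaR_append_letter:
  "deltaR (u, u) = map (\<lambda>b. (Some b, Some b)) u"
  "deltaR (u, u @ [a]) = map (\<lambda>b. (Some b, Some b)) u @ [(None, Some a)]"
  "deltaR (u, a # u) = shift a u"
  "deltaR (b # u, [z]) = (Some b, Some z) # map (\<lambda>b. (Some b, None)) u"
proof -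
  have z: "zip (map Some u) (map Some u) = map (\<lambda>b. (Some b, Some b)) u" for u :: "'a list"
    by (induction u) auto
  then show "deltaR (u, u) = map (\<lambda>b. (Some b, Some b)) u" by (simp add: deltaR_def)
  show "deltaR (u, u @ [a]) = map (\<lambda>b. (Some b, Some b)) u @ [(None, Some a)]"
    by (simp add: deltaR_def z)
  have "zip (map Some u @ [None]) (Some a # map Some u) = shift a u"
    by (induction u arbitrary: a) auto
  then show "deltaR (u, a # u) = shift a u" by (simp add: deltaR_def)
  have "zip (map Some u) (replicate (length u) (None :: 'a option)) = map (\<lambda>b. (Some b, None)) u"
    by (induction u) auto
  then show "deltaR (b # u, [z]) = (Some b, Some z) # map (\<lambda>b. (Some b, None)) u"
    by (simp add: deltaR_def)
qed

text \<open>Through this identity the left-padded relations of an ideal are obtained from the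
  right-padded relations of the reversed ideal.\<close>

lemma deltaL_rev: "deltaL (u, v) = rev (deltaR (rev u, rev v))"
  by (simp add: deltaL_def deltaR_def zip_rev[symmetric] rev_map)

text \<open>Exactly one representative per element. Multiplication by a letter then either extends a
  word by that letter or sends it to \<open>[z]\<close>, and the two pieces of each relation are
  handled separately.\<close>

definition normal_words :: "nat set \<Rightarrow> nat list set \<Rightarrow> nat \<Rightarrow> nat list set" where
  "normal_words A I z = insert [z] (plus_words A - I)"

context word_ideal
begin

abbreviation "NW \<equiv> normal_words A I z"

lemma NW_words: "NW \<subseteq> plus_words A"
  using z_in_A by (auto simp: normal_words_def plus_words_iff)

lemma NW_I: "v \<in> NW \<Longrightarrow> v \<in> I \<longleftrightarrow> v = [z]"
  using z_in_I by (auto simp: normal_words_def)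

lemma letters_eps_lists: "x \<in> letters_eps A \<Longrightarrow> x \<in> lists A"
  by (auto simp: letters_eps_def)

lemma rel_right_quot:
  assumes "x \<in> letters_eps A"
  shows "rel_right (elt I z) NW x =
    (\<lambda>u. (u, u @ x)) ` {u \<in> plus_words A. u @ x \<in> plus_words A - I} \<union>
    (\<lambda>u. (u, [z])) ` {u \<in> NW. u @ x \<in> I}" (is "_ = ?r")
proof (intro equalityI subsetI)
  fix k assume "k \<in> rel_right (elt I z) NW x"
  then obtain u v where k: "k = (u, v)" "u \<in> NW" "v \<in> NW" "u @ x = v \<or> u @ x \<in> I \<and> v \<in> I"
    by (auto simp: rel_right_def elt_eq_iff)
  show "k \<in> ?r"
  proof (cases "u @ x \<in> I")
    case True
    then have "v = [z]" using k NW_I by auto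
    with True k show ?thesis by auto
  next
    case False
    then have "u @ x = v" using k by auto
    with False k NW_words show ?thesis by auto
  qed
next
  fix k assume "k \<in> ?r"
  then consider u where "k = (u, u @ x)" "u \<in> plus_words A" "u @ x \<in> plus_words A" "u @ x \<notin> I"
    | u where "k = (u, [z])" "u \<in> NW" "u @ x \<in> I" by auto
  then show "k \<in> rel_right (elt I z) NW x"
  proof cases
    case 1
    then have "u \<notin> I" using ideal_right letters_eps_lists[OF assms] by blast
    with 1 show ?thesis by (auto simp: rel_right_def normal_words_def)
  next
    case 2
    then show ?thesis using z_in_I by (auto simp: rel_right_def normal_words_def elt_eq_iff)
  qed
qed

lemma rel_left_quot:
  assumes "x \<in> letters_eps A"
  shows "rel_left (elt I z) NW x =
    (\<lambda>u. (u, x @ u)) ` {u \<in> plus_words A. x @ u \<in> plus_words A - I} \<union>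
    (\<lambda>u. (u, [z])) ` {u \<in> NW. x @ u \<in> I}" (is "_ = ?r")
proof (intro equalityI subsetI)
  fix k assume "k \<in> rel_left (elt I z) NW x"
  then obtain u v where k: "k = (u, v)" "u \<in> NW" "v \<in> NW" "x @ u = v \<or> x @ u \<in> I \<and> v \<in> I"
    by (auto simp: rel_left_def elt_eq_iff)
  show "k \<in> ?r"
  proof (cases "x @ u \<in> I")
    case True
    then have "v = [z]" using k NW_I by auto
    with True k show ?thesis by auto
  next
    case False
    then have "x @ u = v" using k by auto
    with False k NW_words show ?thesis by auto
  qed
next
  fix k assume "k \<in> ?r"
  then consider u where "k = (u, x @ u)" "u \<in> plus_words A" "x @ u \<in> plus_words A" "x @ u \<notin> I"
    | u where "k = (u, [z])" "u \<in> NW" "x @ u \<in> I" by auto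
  then show "k \<in> rel_left (elt I z) NW x"
  proof cases
    case 1
    then have "u \<notin> I" using ideal_left letters_eps_lists[OF assms] by blast
    with 1 show ?thesis by (auto simp: rel_left_def normal_words_def)
  next
    case 2
    then show ?thesis using z_in_I by (auto simp: rel_left_def normal_words_def elt_eq_iff)
  qed
qed

lemma fin_quot_plus_words: "fin_quot (plus_words A)"
  unfolding plus_words_def by (intro fin_quot_Diff fin_quot_lists fin_quot_finite) simp

text \<open>Against \<open>[z]\<close> only the first letter of \<open>u\<close> meets a letter; all
  others meet padding.\<close>

lemma regular_deltaR_zero:
  assumes "fin_quot Z" "Z \<subseteq> plus_words A"
  shows "fin_quot (deltaR ` (\<lambda>u. (u, [z])) ` Z)"
proof -
  let ?e = "\<lambda>b. (Some b, None)"
  have "deltaR ` (\<lambda>u. (u, [z])) ` Z = (\<Union>b\<in>A. conc {[(Some b, Some z)]} (map ?e ` lquot Z [b]))" (is "?l = ?r")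
  proof (intro equalityI subsetI)
    fix k assume "k \<in> ?l"
    then obtain u where u: "u \<in> Z" "k = deltaR (u, [z])" by blast
    then obtain b v where "u = b # v" "b \<in> A" using assms(2) by (cases u) (auto simp: plus_words_iff)
    with u show "k \<in> ?r" by (auto simp: conc_def deltaR_append_letter)
  next
    fix k assume "k \<in> ?r"
    then obtain b v where "b # v \<in> Z" "k = deltaR (b # v, [z])"
      by (auto simp: conc_def deltaR_append_letter)
    then show "k \<in> ?l" by blast
  qed
  moreover have "fin_quot ?r"
    using finite_A assms(1)
    by (intro fin_quot_UN fin_quot_conc fin_quot_map fin_quot_lquot)
       (auto intro: fin_quot_finite injI)
  ultimately show ?thesis by simp
qed

abbreviation "pairs \<equiv> (insert None (Some ` A)) \<times> (insert None (Some ` A))"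

lemma deltaR_lists: "u \<in> lists A \<Longrightarrow> v \<in> lists A \<Longrightarrow> deltaR (u, v) \<in> lists pairs"
  unfolding in_lists_conv_set
proof (intro ballI)
  fix k assume uv: "\<forall>a\<in>set u. a \<in> A" "\<forall>a\<in>set v. a \<in> A" and "k \<in> set (deltaR (u, v))"
  then have "fst k \<in> set (map Some u @ replicate (length v - length u) None)"
    "snd k \<in> set (map Some v @ replicate (length u - length v) None)"
    unfolding deltaR_def prod.case by (metis prod.collapse set_zip_leftD, metis prod.collapse set_zip_rightD)
  then have "fst k \<in> insert None (Some ` A)" "snd k \<in> insert None (Some ` A)"
    using uv by (auto split: if_splits)
  then show "k \<in> pairs" by (simp only: mem_Times_iff simp_thms)
qed

lemma regular_deltaR:
  assumes "fin_quot (deltaR ` R)" "R \<subseteq> plus_words A \<times> plus_words A"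
  shows "regular_lang (deltaR ` R)"
proof (rule fin_quot_regular[OF assms(1)])
  show "deltaR ` R \<subseteq> lists pairs"
  proof
    fix k assume "k \<in> deltaR ` R"
    then obtain u v where "(u, v) \<in> R" "k = deltaR (u, v)" by auto
    moreover from this assms(2) have "u \<in> plus_words A" "v \<in> plus_words A" by blast+
    moreover from this have "u \<in> lists A" "v \<in> lists A" by (simp_all add: plus_words_iff)
    ultimately show "k \<in> lists pairs" using deltaR_lists by blast
  qed
  show "finite pairs" using finite_A by simp
qed

lemma rel_words: "rel_right (elt I z) NW x \<subseteq> plus_words A \<times> plus_words A"
  "rel_left (elt I z) NW x \<subseteq> plus_words A \<times> plus_words A"
  using NW_words by (auto simp: rel_right_def rel_left_def)

lemma fin_quot_NW: "fin_quot I \<Longrightarrow> fin_quot NW"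
  unfolding normal_words_def insert_is_Un[of _ "plus_words A - I"]
  by (rule fin_quot_Un[OF fin_quot_finite fin_quot_Diff[OF fin_quot_plus_words]]) simp_all

lemma regular_deltaR_right:
  assumes "fin_quot I" "x \<in> letters_eps A"
  shows "regular_lang (deltaR ` rel_right (elt I z) NW x)"
proof (rule regular_deltaR[OF _ rel_words(1)])
  let ?N = "{u \<in> plus_words A. u @ x \<in> plus_words A - I}"
  have eq: "{u \<in> NW. u @ x \<in> I} = NW \<inter> {u. u @ x \<in> I}" "?N = plus_words A \<inter> {u. u @ x \<in> plus_words A - I}"
    by auto
  have N: "fin_quot ?N" unfolding eq
    by (intro fin_quot_Int fin_quot_Collect_append fin_quot_Diff fin_quot_plus_words assms)
  have Z: "fin_quot {u \<in> NW. u @ x \<in> I}" unfolding eq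
    by (intro fin_quot_Int fin_quot_NW fin_quot_Collect_append assms)
  have diag: "fin_quot (map (\<lambda>b. (Some b, Some b)) ` ?N)"
    using N by (rule fin_quot_map) (auto intro: injI)
  have "fin_quot (deltaR ` (\<lambda>u. (u, u @ x)) ` ?N)"
  proof (cases x)
    case Nil
    then show ?thesis using diag by (simp add: image_image deltaR_append_letter)
  next
    case (Cons a y)
    with assms(2) have x: "x = [a]" by (auto simp: letters_eps_def)
    have "deltaR ` (\<lambda>u. (u, u @ x)) ` ?N = conc (map (\<lambda>b. (Some b, Some b)) ` ?N) {[(None, Some a)]}"
      unfolding x image_image deltaR_append_letter by (auto simp: conc_def)
    then show ?thesis using diag by (simp add: fin_quot_conc fin_quot_finite)
  qed
  then show "fin_quot (deltaR ` rel_right (elt I z) NW x)"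
    unfolding rel_right_quot[OF assms(2)] image_Un
    using NW_words by (intro fin_quot_Un regular_deltaR_zero Z) auto
qed

lemma regular_deltaR_left:
  assumes "fin_quot I" "x \<in> letters_eps A"
  shows "regular_lang (deltaR ` rel_left (elt I z) NW x)"
proof (rule regular_deltaR[OF _ rel_words(2)])
  let ?N = "{u \<in> plus_words A. x @ u \<in> plus_words A - I}"
  have eq: "{u \<in> NW. x @ u \<in> I} = NW \<inter> lquot I x" "?N = plus_words A \<inter> lquot (plus_words A - I) x"
    by auto
  have N: "fin_quot ?N" unfolding eq
    by (intro fin_quot_Int fin_quot_lquot fin_quot_Diff fin_quot_plus_words assms)
  have Z: "fin_quot {u \<in> NW. x @ u \<in> I}" unfolding eq
    by (intro fin_quot_Int fin_quot_NW fin_quot_lquot assms)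
  have "fin_quot (deltaR ` (\<lambda>u. (u, x @ u)) ` ?N)"
  proof (cases x)
    case Nil
    have "fin_quot (map (\<lambda>b. (Some b, Some b)) ` ?N)"
      using N by (rule fin_quot_map) (auto intro: injI)
    then show ?thesis using Nil by (simp add: image_image deltaR_append_letter)
  next
    case (Cons a y)
    with assms(2) have x: "x = [a]" by (auto simp: letters_eps_def)
    have "deltaR ` (\<lambda>u. (u, x @ u)) ` ?N = shift a ` ?N"
      unfolding x image_image by (simp add: deltaR_append_letter)
    then show ?thesis
      using fin_quot_shift[OF N _ finite_A, of a] by (simp add: plus_words_iff subset_iff)
  qed
  then show "fin_quot (deltaR ` rel_left (elt I z) NW x)"
    unfolding rel_left_quot[OF assms(2)] image_Un
    using NW_words by (intro fin_quot_Un regular_deltaR_zero Z) auto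
qed

lemma rev_word_ideal: "word_ideal A (rev ` I) z"
proof
  show "rev ` I \<subseteq> plus_words A"
  proof
    fix w assume "w \<in> rev ` I"
    then obtain v where "v \<in> I" "w = rev v" by blast
    then show "w \<in> plus_words A" using I_lists[of v] Nil_not_in_I by (auto simp: plus_words_iff)
  qed
  show "[z] \<in> rev ` I" using z_in_I by (intro image_eqI[of _ _ "[z]"]) simp
  fix w u v assume w: "w \<in> rev ` I" "u \<in> lists A" "v \<in> lists A"
  then have "rev v @ rev w @ rev u \<in> I" by (intro ideal) auto
  then show "u @ w @ v \<in> rev ` I" by (intro image_eqI[of _ _ "rev v @ rev w @ rev u"]) simp
qed (use finite_A z_in_A in simp_all)

lemma rev_mem_iff: "rev w \<in> rev ` X \<longleftrightarrow> w \<in> X"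
  by (auto simp: image_iff)

lemma normal_words_rev: "normal_words A (rev ` I) z = rev ` NW"
proof -
  have "w \<in> normal_words A (rev ` I) z \<longleftrightarrow> rev w \<in> NW" for w
    using rev_mem_iff[of "rev w" I] by (auto simp: normal_words_def plus_words_iff rev_singleton_conv)
  moreover have "w \<in> rev ` NW \<longleftrightarrow> rev w \<in> NW" for w using rev_mem_iff[of "rev w" NW] by simp
  ultimately show ?thesis by blast
qed

lemma elt_rev_eq_iff: "elt (rev ` I) z (rev u) = elt (rev ` I) z (rev v) \<longleftrightarrow> elt I z u = elt I z v"
  using word_ideal.elt_eq_iff[OF rev_word_ideal] by (simp add: elt_eq_iff rev_mem_iff)

lemma letters_eps_rev: "x \<in> letters_eps A \<Longrightarrow> rev x = x"
  by (auto simp: letters_eps_def)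

lemma deltaL_image:
  fixes R :: "('b list \<times> 'b list) set"
  shows "deltaL ` R = rev ` deltaR ` {(rev u, rev v) | u v. (u, v) \<in> R}"
proof -
  have "{(rev u, rev v) | u v. (u, v) \<in> R} = (\<lambda>k. (rev (fst k), rev (snd k))) ` R"
    by force
  then have "rev ` deltaR ` {(rev u, rev v) | u v. (u, v) \<in> R} =
      (\<lambda>k. rev (deltaR (rev (fst k), rev (snd k)))) ` R" by (simp only: image_image)
  also have "\<dots> = deltaL ` R"
  proof (rule image_cong[OF refl])
    show "rev (deltaR (rev (fst k), rev (snd k))) = deltaL k" for k :: "'b list \<times> 'b list"
      using deltaL_rev[of "fst k" "snd k"] by simp
  qed
  finally show ?thesis ..
qed

text \<open>Reversal exchanges left and right multiplication as well as the side of the padding. The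
  left-padded relations are therefore reversals of right-padded relations for the reversed
  ideal.\<close>

lemma biautomatic_quot:
  assumes "fin_quot I"
  shows "biautomatic (quot A I z)"
proof -
  have finI': "fin_quot (rev ` I)"
    using assms I_lists finite_A by (intro fin_quot_rev[of I A]) blast+
  have rr: "{(rev u, rev v) | u v. (u, v) \<in> rel_right (elt I z) NW x} =
      rel_left (elt (rev ` I) z) (normal_words A (rev ` I) z) x"
    (is "{(rev u, rev v) | u v. (u, v) \<in> ?l} = ?r") if "x \<in> letters_eps A" for x
  proof -
    have mem: "(rev u, rev v) \<in> rel_left (elt (rev ` I) z) (normal_words A (rev ` I) z) x \<longleftrightarrow>
        (u, v) \<in> rel_right (elt I z) NW x" for u v
      using elt_rev_eq_iff[of "u @ x" v] letters_eps_rev[OF that]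
      by (simp add: rel_left_def rel_right_def normal_words_rev rev_mem_iff)
    show ?thesis
    proof (intro equalityI subsetI)
      fix k assume "k \<in> ?r"
      moreover obtain a b where k: "k = (a, b)" by (cases k)
      ultimately have "(rev a, rev b) \<in> ?l" using mem[of "rev a" "rev b"] by simp
      moreover have "k = (rev (rev a), rev (rev b))" using k by simp
      ultimately show "k \<in> {(rev u, rev v) | u v. (u, v) \<in> ?l}" by blast
    qed (use mem in blast)
  qed
  have rl: "{(rev u, rev v) | u v. (u, v) \<in> rel_left (elt I z) NW x} =
      rel_right (elt (rev ` I) z) (normal_words A (rev ` I) z) x"
    (is "{(rev u, rev v) | u v. (u, v) \<in> ?l} = ?r") if "x \<in> letters_eps A" for x
  proof -
    have mem: "(rev u, rev v) \<in> rel_right (elt (rev ` I) z) (normal_words A (rev ` I) z) x \<longleftrightarrow>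
        (u, v) \<in> rel_left (elt I z) NW x" for u v
      using elt_rev_eq_iff[of "x @ u" v] letters_eps_rev[OF that]
      by (simp add: rel_left_def rel_right_def normal_words_rev rev_mem_iff)
    show ?thesis
    proof (intro equalityI subsetI)
      fix k assume "k \<in> ?r"
      moreover obtain a b where k: "k = (a, b)" by (cases k)
      ultimately have "(rev a, rev b) \<in> ?l" using mem[of "rev a" "rev b"] by simp
      moreover have "k = (rev (rev a), rev (rev b))" using k by simp
      ultimately show "k \<in> {(rev u, rev v) | u v. (u, v) \<in> ?l}" by blast
    qed (use mem in blast)
  qed
  have reps: "rep_language (quot A I z) A (elt I z) NW"
    unfolding rep_language_def carrier_quot
  proof (intro conjI finite_A free_hom_quot NW_words refl ballI)
    show "regular_lang NW"
    proof (rule fin_quot_regular[OF fin_quot_NW[OF assms] _ finite_A])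
      show "NW \<subseteq> lists A" using NW_words unfolding plus_words_def by blast
    qed
    fix s assume "s \<in> elt I z ` plus_words A"
    then obtain w where "w \<in> plus_words A" "s = elt I z w" by blast
    then show "\<exists>w\<in>NW. elt I z w = s"
      using z_in_I by (cases "w \<in> I") (auto simp: normal_words_def elt_eq_iff)
  qed
  have "biautomatic_structure (quot A I z) A (elt I z) NW"
    unfolding biautomatic_structure_def
  proof (intro conjI reps ballI)
    fix x assume x: "x \<in> letters_eps A"
    show "regular_lang (deltaR ` rel_right (elt I z) NW x)"
      "regular_lang (deltaR ` rel_left (elt I z) NW x)"
      by (intro regular_deltaR_right regular_deltaR_left assms x)+
    show "regular_lang (deltaL ` rel_right (elt I z) NW x)"
      unfolding deltaL_image rr[OF x]
      by (intro regular_rev word_ideal.regular_deltaR_left[OF rev_word_ideal] finI' x)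
    show "regular_lang (deltaL ` rel_left (elt I z) NW x)"
      unfolding deltaL_image rl[OF x]
      by (intro regular_rev word_ideal.regular_deltaR_right[OF rev_word_ideal] finI' x)
  qed
  then show ?thesis unfolding biautomatic_def by blast
qed

end

lemma biautomatic_imp:
  assumes "biautomatic S"
  shows "automatic S" "async_biautomatic S"
proof -
  from assms obtain A :: "nat set" and \<rho> L where "biautomatic_structure S A \<rho> L"
    unfolding biautomatic_def by blast
  then have "automatic_structure S A \<rho> L" "async_biautomatic_structure S A \<rho> L"
    by (auto simp: biautomatic_structure_def automatic_structure_def
        async_biautomatic_structure_def regular_imp_rational)
  then show "automatic S" "async_biautomatic S"
    unfolding automatic_def async_biautomatic_def by blast+
qed

lemma imp_async_automatic:
  "automatic S \<Longrightarrow> async_automatic S" "async_biautomatic S \<Longrightarrow> async_automatic S"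
proof -
  assume "automatic S"
  then obtain A :: "nat set" and \<rho> L where "automatic_structure S A \<rho> L"
    unfolding automatic_def by blast
  then have "async_automatic_structure S A \<rho> L"
    by (auto simp: automatic_structure_def async_automatic_structure_def regular_imp_rational)
  then show "async_automatic S" unfolding async_automatic_def by blast
next
  assume "async_biautomatic S"
  then obtain A :: "nat set" and \<rho> L where "async_biautomatic_structure S A \<rho> L"
    unfolding async_biautomatic_def by blast
  then have "async_automatic_structure S A \<rho> L"
    by (auto simp: async_biautomatic_structure_def async_automatic_structure_def)
  then show "async_automatic S" unfolding async_automatic_def by blast
qed

section \<open>Context-free languages with holes\<close>

text \<open>\<open>Letter 3\<close> is \<open>Letter (inc 0)\<close>, so these are the wrong inputs
  of a history; \<open>split_runs\<close> is needed where the boundary between the two factors of a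
  product falls inside the input.\<close>

definition runs :: "nat \<Rightarrow> hsym list set" where
  "runs x = {replicate j (Letter 3) | j. j \<noteq> x}"

definition split_runs :: "nat \<Rightarrow> hsym list set" where
  "split_runs x = {replicate a (Letter 3) @ Hash1 # replicate b (Letter 3) | a b. a + b \<noteq> x}"

text \<open>The terminal \<open>Inr False\<close> stands for a run of the letter \<open>3\<close> whose length differs from \<open>x\<close>,
  and \<open>Inr True\<close> for such a run that is split by \<open>Hash1\<close>.\<close>

fun fill :: "nat \<Rightarrow> hsym + bool \<Rightarrow> hsym list set" where
  "fill x (Inl t) = {[t]}"
| "fill x (Inr b) = (if b then split_runs x else runs x)"

primrec fill_word :: "nat \<Rightarrow> (hsym + bool) list \<Rightarrow> hsym list set" where
  "fill_word x [] = {[]}"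
| "fill_word x (a # w) = conc (fill x a) (fill_word x w)"

definition fill_lang :: "nat \<Rightarrow> (hsym + bool) list set \<Rightarrow> hsym list set" where
  "fill_lang x L = (\<Union>w\<in>L. fill_word x w)"

lemma fill_word_append: "fill_word x (u @ v) = conc (fill_word x u) (fill_word x v)"
  by (induction u) (simp_all add: conc_assoc)

lemma fill_word_map_Inl [simp]: "fill_word x (map Inl w) = {w}"
  by (induction w) (auto simp: conc_def)

lemma fill_lang_conc: "fill_lang x (conc X Y) = conc (fill_lang x X) (fill_lang x Y)"
proof (intro equalityI subsetI)
  fix w assume "w \<in> fill_lang x (conc X Y)"
  then obtain u v where "u \<in> X" "v \<in> Y" "w \<in> conc (fill_word x u) (fill_word x v)"
    by (auto simp: fill_lang_def fill_word_append elim!: concE[of _ X Y])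
  then show "w \<in> conc (fill_lang x X) (fill_lang x Y)"
    by (auto simp: fill_lang_def elim!: concE intro!: concI)
next
  fix w assume "w \<in> conc (fill_lang x X) (fill_lang x Y)"
  then obtain a b u v where "w = a @ b" "u \<in> X" "v \<in> Y" "a \<in> fill_word x u" "b \<in> fill_word x v"
    by (auto simp: fill_lang_def elim!: concE)
  then have "w \<in> fill_word x (u @ v)" "u @ v \<in> conc X Y"
    by (auto simp: fill_word_append intro: concI)
  then show "w \<in> fill_lang x (conc X Y)" unfolding fill_lang_def by blast
qed

lemma fill_lang_Un: "fill_lang x (X \<union> Y) = fill_lang x X \<union> fill_lang x Y"
  by (simp add: fill_lang_def)

lemma fill_lang_Cons: "fill_lang x ((#) a ` X) = conc (fill x a) (fill_lang x X)"
proof -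
  have "(#) a ` X = conc {[a]} X" by (auto simp: conc_def)
  then show ?thesis by (simp add: fill_lang_conc) (simp add: fill_lang_def)
qed

text \<open>A family of context-free languages that depends on \<open>x\<close> only through the
  holes of one language \<open>E\<close>. This uniformity is what makes the code of the structure
  computable from \<open>x\<close>.\<close>

definition holey :: "hsym set \<Rightarrow> (nat \<Rightarrow> hsym list set) \<Rightarrow> bool" where
  "holey U F \<longleftrightarrow> (\<exists>E. cfl E \<and> E \<subseteq> lists (Inl ` U \<union> range Inr) \<and> (\<forall>x. F x = fill_lang x E))"

lemma holey_cfl:
  assumes "cfl X" "X \<subseteq> lists U"
  shows "holey U (\<lambda>_. X)"
proof -
  have "cfl (hom (\<lambda>a. [Inl a :: hsym + bool]) ` X)" using assms(1) by (rule cfl_hom)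
  moreover have "hom (\<lambda>a. [Inl a :: hsym + bool]) = map Inl" by (auto simp: hom_def fun_eq_iff)
  ultimately have "cfl (map Inl ` X :: (hsym + bool) list set)" by (simp only:)
  moreover have "map Inl ` X \<subseteq> lists (Inl ` U \<union> range Inr)"
  proof
    fix v assume "v \<in> map Inl ` X"
    then obtain w where "w \<in> X" "v = map Inl w" by blast
    moreover from this assms(2) have "w \<in> lists U" by blast
    ultimately show "v \<in> lists (Inl ` U \<union> range Inr)" by auto
  qed
  moreover have "X = fill_lang x (map Inl ` X)" for x by (simp add: fill_lang_def)
  ultimately show ?thesis unfolding holey_def by blast
qed

lemma holey_conc:
  assumes "holey U F" "holey U G"
  shows "holey U (\<lambda>x. conc (F x) (G x))"
proof -
  from assms obtain D E where *: "cfl D" "D \<subseteq> lists (Inl ` U \<union> range Inr)" "\<forall>x. F x = fill_lang x D"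
    "cfl E" "E \<subseteq> lists (Inl ` U \<union> range Inr)" "\<forall>x. G x = fill_lang x E"
    unfolding holey_def by blast
  have "conc D E \<subseteq> lists (Inl ` U \<union> range Inr)"
    using *(2,5) by (rule conc_lists)
  then show ?thesis unfolding holey_def
    using *(1,3,4,6) cfl_conc[of D E] by (intro exI[of _ "conc D E"]) (simp add: fill_lang_conc)
qed

lemma holey_Un:
  assumes "holey U F" "holey U G"
  shows "holey U (\<lambda>x. F x \<union> G x)"
proof -
  from assms obtain D E where *: "cfl D" "D \<subseteq> lists (Inl ` U \<union> range Inr)" "\<forall>x. F x = fill_lang x D"
    "cfl E" "E \<subseteq> lists (Inl ` U \<union> range Inr)" "\<forall>x. G x = fill_lang x E"
    unfolding holey_def by blast
  then show ?thesis unfolding holey_def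
    using cfl_Un[of D E] by (intro exI[of _ "D \<union> E"]) (simp add: fill_lang_Un)
qed

lemma holey_runs: "holey U runs" "holey U split_runs"
proof -
  have "holey U (fill_lang2 b)" if "\<And>x. fill_lang2 b x = fill x (Inr b)" for b fill_lang2
    unfolding holey_def
  proof (intro exI[of _ "{[Inr b]}"] conjI allI)
    show "cfl {[Inr b :: hsym + bool]}"
      by (rule cfl_fin_quot[of _ "{Inr b}"]) (auto intro: fin_quot_finite)
    show "fill_lang2 b x = fill_lang x {[Inr b]}" for x
      using that by (simp add: fill_lang_def)
  qed simp
  from this[of "\<lambda>b x. fill x (Inr b)" False] this[of "\<lambda>b x. fill x (Inr b)" True]
  show "holey U runs" "holey U split_runs" by simp_all
qed

section \<open>The grammar with filled holes\<close>

text \<open>The nonterminals of the given grammar move to the even numbers from \<open>4\<close> on;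
  \<open>0\<close> and \<open>2\<close> serve the base productions, and odd numbers serve the
  holes.\<close>

definition fill_sym :: "nat + (hsym + bool) \<Rightarrow> nat + hsym" where
  "fill_sym = case_sum (\<lambda>N. Inl (2 * N + 4)) (case_sum Inr (\<lambda>b. Inl (if b then 3 else 1)))"

text \<open>Nonterminal \<open>0\<close> generates all runs and \<open>2\<close> all split runs;
  \<open>5\<close> and \<open>7\<close> generate those of non-zero total length.\<close>

definition base_prods :: "(nat \<times> (nat + hsym) list) list" where
  "base_prods = [(0, []), (0, [Inr (Letter 3), Inl 0]), (2, [Inr (Letter 3), Inl 2]), (2, [Inr Hash1, Inl 0]),
    (5, [Inr (Letter 3), Inl 0]), (7, [Inr (Letter 3), Inl 2]), (7, [Inr Hash1, Inl 5])]"

definition template :: "(hsym + bool) cfg \<Rightarrow> hsym cfg" where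
  "template G = \<lparr>cfg_start = 2 * cfg_start G + 4,
    cfg_prods = base_prods @ map (\<lambda>(N, r). (2 * N + 4, map fill_sym r)) (cfg_prods G)\<rparr>"

lemma set_hole_chain: "set (hole_chain x) = (\<Union>i<x. {(4 * i + 9, [Inr (Letter 3), Inl (4 * i + 5)]),
    (4 * i + 9, []), (4 * i + 11, [Inr (Letter 3), Inl (4 * i + 7)]),
    (4 * i + 11, [Inr Hash1, Inl (4 * i + 9)])})"
  by (induction x) (auto simp: lessThan_Suc)

definition all_runs :: "hsym list set" where
  "all_runs = {replicate j (Letter 3) | j. True}"

definition all_split_runs :: "hsym list set" where
  "all_split_runs = {replicate a (Letter 3) @ Hash1 # replicate b (Letter 3) | a b. True}"

text \<open>Peeling off one letter lowers the forbidden length by one. The four identities for runs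
  and split runs are the productions of the chain read as equations.\<close>

lemma runs_Suc: "runs (Suc i) = insert [] ((#) (Letter 3) ` runs i)"
proof (intro equalityI subsetI)
  fix w assume "w \<in> runs (Suc i)"
  then obtain j where "j \<noteq> Suc i" "w = replicate j (Letter 3)" by (auto simp: runs_def)
  then show "w \<in> insert [] ((#) (Letter 3) ` runs i)" by (cases j) (auto simp: runs_def)
next
  fix w assume "w \<in> insert [] ((#) (Letter 3) ` runs i)"
  then consider "w = replicate 0 (Letter 3)" | j where "w = replicate (Suc j) (Letter 3)" "j \<noteq> i"
    by (auto simp: runs_def)
  then show "w \<in> runs (Suc i)" unfolding runs_def by cases blast+
qed

lemma runs_0: "runs 0 = (#) (Letter 3) ` all_runs"
proof (intro equalityI subsetI)
  fix w assume "w \<in> runs 0"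
  then obtain j where "j \<noteq> 0" "w = replicate j (Letter 3)" by (auto simp: runs_def)
  then show "w \<in> (#) (Letter 3) ` all_runs" by (cases j) (auto simp: all_runs_def)
next
  fix w assume "w \<in> (#) (Letter 3) ` all_runs"
  then obtain j where "w = replicate (Suc j) (Letter 3)" by (auto simp: all_runs_def)
  then show "w \<in> runs 0" unfolding runs_def by blast
qed

lemma split_runs_Suc:
  "split_runs (Suc i) = (#) (Letter 3) ` split_runs i \<union> (#) Hash1 ` runs (Suc i)"
proof (intro equalityI subsetI)
  fix w assume "w \<in> split_runs (Suc i)"
  then obtain a b where ab: "a + b \<noteq> Suc i" "w = replicate a (Letter 3) @ Hash1 # replicate b (Letter 3)"
    by (auto simp: split_runs_def)
  then show "w \<in> (#) (Letter 3) ` split_runs i \<union> (#) Hash1 ` runs (Suc i)"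
    by (cases a) (auto simp: split_runs_def runs_def)
next
  fix w assume "w \<in> (#) (Letter 3) ` split_runs i \<union> (#) Hash1 ` runs (Suc i)"
  then consider a b where "w = replicate (Suc a) (Letter 3) @ Hash1 # replicate b (Letter 3)" "Suc a + b \<noteq> Suc i"
    | b where "w = replicate 0 (Letter 3) @ Hash1 # replicate b (Letter 3)" "0 + b \<noteq> Suc i"
    by (auto simp: split_runs_def runs_def)
  then show "w \<in> split_runs (Suc i)" unfolding split_runs_def by cases blast+
qed

lemma split_runs_0: "split_runs 0 = (#) (Letter 3) ` all_split_runs \<union> (#) Hash1 ` runs 0"
proof (intro equalityI subsetI)
  fix w assume "w \<in> split_runs 0"
  then obtain a b where ab: "a + b \<noteq> 0" "w = replicate a (Letter 3) @ Hash1 # replicate b (Letter 3)"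
    by (auto simp: split_runs_def)
  then show "w \<in> (#) (Letter 3) ` all_split_runs \<union> (#) Hash1 ` runs 0"
    by (cases a) (auto simp: runs_def all_split_runs_def)
next
  fix w assume "w \<in> (#) (Letter 3) ` all_split_runs \<union> (#) Hash1 ` runs 0"
  then consider a b where "w = replicate (Suc a) (Letter 3) @ Hash1 # replicate b (Letter 3)" "Suc a + b \<noteq> 0"
    | b where "w = replicate 0 (Letter 3) @ Hash1 # replicate b (Letter 3)" "0 + b \<noteq> 0"
    by (auto simp: runs_def all_split_runs_def)
  then show "w \<in> split_runs 0" unfolding split_runs_def by cases blast+
qed

lemma fill_template:
  fixes G :: "(hsym + bool) cfg"
  defines "P \<equiv> set (cfg_prods G)" and "Q \<equiv> \<lambda>x. set (hole_prods x @ cfg_prods (template G))"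
  shows "nt (Q x) (2 * cfg_start G + 4) = fill_lang x (nt P (cfg_start G))"
proof -
  \<comment> \<open>The guessed solution, decoded from the residue modulo \<open>4\<close>. The
    holes \<open>1\<close> and \<open>3\<close> have the residues of the chain and are singled out
    before.\<close>
  define K where "K N = (if N = 0 then all_runs else if N = 2 then all_split_runs
    else if N = 1 then runs x else if N = 3 then split_runs x
    else if N mod 4 = 1 then runs ((N - 5) div 4) else if N mod 4 = 3 then split_runs ((N - 7) div 4)
    else fill_lang x (nt P ((N - 4) div 2)))" for N :: nat
  have K: "K 0 = all_runs" "K 2 = all_split_runs" "K 1 = runs x" "K 3 = split_runs x"
    "K (2 * N + 4) = fill_lang x (nt P N)" "K (4 * i + 5) = runs i" "K (4 * i + 7) = split_runs i"
    "K (4 * i + 9) = runs (Suc i)" "K (4 * i + 11) = split_runs (Suc i)" for N i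
  proof -
    show "K 0 = all_runs" "K 2 = all_split_runs" "K 1 = runs x" "K 3 = split_runs x"
      by (simp_all add: K_def)
    have "(2 * N + 4) mod 4 \<noteq> 1" "(2 * N + 4) mod 4 \<noteq> 3" by presburger+
    then show "K (2 * N + 4) = fill_lang x (nt P N)" by (simp add: K_def)
    have "(4 * i + 5) mod 4 = 1" "(4 * i + 9) mod 4 = 1" "(4 * i + 7) mod 4 = 3" "(4 * i + 11) mod 4 = 3"
      "(4 * i + 4) div 4 = Suc i" by presburger+
    then show "K (4 * i + 5) = runs i" "K (4 * i + 7) = split_runs i"
      "K (4 * i + 9) = runs (Suc i)" "K (4 * i + 11) = split_runs (Suc i)" by (simp_all add: K_def)
  qed
  have Qx: "Q x = {(1, [Inl (4 * x + 5)]), (3, [Inl (4 * x + 7)])} \<union> set (hole_chain x) \<union> set base_prods \<union>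
      (\<lambda>(N, r). (2 * N + 4, map fill_sym r)) ` P"
    by (auto simp: Q_def P_def hole_prods_def template_def)
  have sat_fill: "sat K (map fill_sym r) = fill_lang x (sat (nt P) r)" for r
  proof (induction r)
    case Nil
    show ?case by (simp add: fill_lang_def)
  next
    case (Cons a r)
    show ?case
    proof (cases a)
      case (Inl N)
      then show ?thesis using Cons by (simp add: fill_sym_def K(5)[simplified] fill_lang_conc)
    next
      case (Inr s)
      have 1: "(#) t ` X = conc {[t]} X" for t :: hsym and X by (auto simp: conc_def)
      show ?thesis
        using Inr Cons K(3,4)
        by (cases s) (simp_all add: fill_sym_def fill_lang_Cons 1)
    qed
  qed
  have sound: "nt (Q x) N \<subseteq> K N" for N
  proof (rule nt_sound)
    fix N r assume "(N, r) \<in> Q x"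
    then consider "(N, r) \<in> {(1, [Inl (4 * x + 5)]), (3, [Inl (4 * x + 7)])}"
      | i where "(N, r) \<in> {(4 * i + 9, [Inr (Letter 3), Inl (4 * i + 5)]),
        (4 * i + 9, []), (4 * i + 11, [Inr (Letter 3), Inl (4 * i + 7)]),
        (4 * i + 11, [Inr Hash1, Inl (4 * i + 9)])}"
      | "(N, r) \<in> set base_prods" | M s where "(M, s) \<in> P" "N = 2 * M + 4" "r = map fill_sym s"
      unfolding Qx set_hole_chain by (elim UnE UN_E imageE) (auto split: prod.splits)
    then show "sat K r \<subseteq> K N"
    proof cases
      case 1
      then have "(N = 1 \<and> r = [Inl (4 * x + 5)]) \<or> (N = 3 \<and> r = [Inl (4 * x + 7)])" by simp
      then show ?thesis by (elim disjE conjE) (simp_all only: K sat.simps conc_Nil order_refl)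
    next
      case 2
      then have "(N = 4 * i + 9 \<and> r = [Inr (Letter 3), Inl (4 * i + 5)]) \<or> (N = 4 * i + 9 \<and> r = []) \<or>
        (N = 4 * i + 11 \<and> r = [Inr (Letter 3), Inl (4 * i + 7)]) \<or>
        (N = 4 * i + 11 \<and> r = [Inr Hash1, Inl (4 * i + 9)])" by simp
      then show ?thesis
        by (elim disjE conjE; simp only: K sat.simps conc_Nil runs_Suc split_runs_Suc) auto
    next
      case 3
      have "K 5 = runs 0" "K 7 = split_runs 0" using K(6,7)[of 0] by simp_all
      moreover have "(#) (Letter 3) ` all_runs \<subseteq> all_runs"
      proof
        fix w assume "w \<in> (#) (Letter 3) ` all_runs"
        then obtain j where "w = replicate (Suc j) (Letter 3)" by (auto simp: all_runs_def)
        then show "w \<in> all_runs" unfolding all_runs_def by blast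
      qed
      moreover have "(#) (Letter 3) ` all_split_runs \<subseteq> all_split_runs"
      proof
        fix w assume "w \<in> (#) (Letter 3) ` all_split_runs"
        then obtain a b where "w = replicate (Suc a) (Letter 3) @ Hash1 # replicate b (Letter 3)" by (auto simp: all_split_runs_def all_runs_def)
        then show "w \<in> all_split_runs" unfolding all_split_runs_def by blast
      qed
      moreover have "(#) Hash1 ` all_runs \<subseteq> all_split_runs"
      proof
        fix w assume "w \<in> (#) Hash1 ` all_runs"
        then obtain b where "w = replicate 0 (Letter 3) @ Hash1 # replicate b (Letter 3)" by (auto simp: all_split_runs_def all_runs_def)
        then show "w \<in> all_split_runs" unfolding all_split_runs_def by blast
      qed
      moreover have "[] \<in> all_runs" by (auto simp: all_runs_def intro: exI[of _ 0])
      ultimately show ?thesis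
        using 3 unfolding base_prods_def by (auto simp: K(1,2) runs_0 split_runs_0 image_subset_iff)
    next
      case 4
      then have "sat (nt P) s \<subseteq> nt P M" by (auto simp: nt_iff yields_iff_sat)
      then show ?thesis unfolding 4 sat_fill K fill_lang_def by blast
    qed
  qed
  have prod: "(N, r) \<in> Q x \<Longrightarrow> sat (nt (Q x)) r \<subseteq> nt (Q x) N" for N r
    by (auto simp: nt_iff yields_iff_sat)
  have base: "(N, r) \<in> set base_prods \<Longrightarrow> sat (nt (Q x)) r \<subseteq> nt (Q x) N" for N r
    by (rule prod) (simp add: Qx)
  have ar: "all_runs \<subseteq> nt (Q x) 0"
  proof -
    have "[] \<in> nt (Q x) 0" "(#) (Letter 3) ` nt (Q x) 0 \<subseteq> nt (Q x) 0"
      using base[of 0 "[]"] base[of 0 "[Inr (Letter 3), Inl 0]"] by (simp_all add: base_prods_def)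
    then have "replicate j (Letter 3) \<in> nt (Q x) 0" for j by (induction j) auto
    then show ?thesis unfolding all_runs_def by blast
  qed
  have asr: "all_split_runs \<subseteq> nt (Q x) 2"
  proof -
    have 1: "(#) Hash1 ` nt (Q x) 0 \<subseteq> nt (Q x) 2" "(#) (Letter 3) ` nt (Q x) 2 \<subseteq> nt (Q x) 2"
      using base[of 2 "[Inr Hash1, Inl 0]"] base[of 2 "[Inr (Letter 3), Inl 2]"]
      by (simp_all add: base_prods_def)
    have "replicate a (Letter 3) @ Hash1 # replicate b (Letter 3) \<in> nt (Q x) 2" for a b
    proof (induction a)
      case 0
      have "replicate b (Letter 3) \<in> nt (Q x) 0" using ar unfolding all_runs_def by blast
      then show ?case using 1(1) by auto
    next
      case (Suc a)
      then show ?case using 1(2) by auto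
    qed
    then show ?thesis unfolding all_split_runs_def by blast
  qed
  \<comment> \<open>The chain has productions only for indices below \<open>x\<close>, hence the
    bound on \<open>i\<close>.\<close>
  have chain: "i \<le> x \<Longrightarrow> runs i \<subseteq> nt (Q x) (4 * i + 5) \<and> split_runs i \<subseteq> nt (Q x) (4 * i + 7)" for i
  proof (induction i)
    case 0
    have N: "(#) (Letter 3) ` nt (Q x) 0 \<subseteq> nt (Q x) 5" "(#) (Letter 3) ` nt (Q x) 2 \<subseteq> nt (Q x) 7"
      "(#) Hash1 ` nt (Q x) 5 \<subseteq> nt (Q x) 7"
      using base[of 5 "[Inr (Letter 3), Inl 0]"] base[of 7 "[Inr (Letter 3), Inl 2]"]
        base[of 7 "[Inr Hash1, Inl 5]"] by (simp_all add: base_prods_def)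
    have J: "runs 0 \<subseteq> nt (Q x) 5"
      unfolding runs_0 using image_mono[OF ar] N(1) by (rule order_trans)
    have "split_runs 0 \<subseteq> nt (Q x) 7"
      unfolding split_runs_0
    proof (rule Un_least)
      show "(#) (Letter 3) ` all_split_runs \<subseteq> nt (Q x) 7"
        using image_mono[OF asr] N(2) by (rule order_trans)
      show "(#) Hash1 ` runs 0 \<subseteq> nt (Q x) 7"
        using image_mono[OF J] N(3) by (rule order_trans)
    qed
    with J show ?case by simp
  next
    case (Suc i)
    let ?c = "{(4 * i + 9, [Inr (Letter 3), Inl (4 * i + 5)]),
        (4 * i + 9, []), (4 * i + 11, [Inr (Letter 3), Inl (4 * i + 7)]),
        (4 * i + 11, [Inr Hash1, Inl (4 * i + 9)])}"
    have c: "(N, r) \<in> ?c \<Longrightarrow> sat (nt (Q x)) r \<subseteq> nt (Q x) N" for N r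
      by (rule prod) (use Suc.prems in \<open>unfold Qx set_hole_chain, blast intro: Suc_le_lessD\<close>)
    have "(#) (Letter 3) ` nt (Q x) (4 * i + 5) \<subseteq> nt (Q x) (4 * i + 9)" "[] \<in> nt (Q x) (4 * i + 9)"
      "(#) (Letter 3) ` nt (Q x) (4 * i + 7) \<subseteq> nt (Q x) (4 * i + 11)"
      "(#) Hash1 ` nt (Q x) (4 * i + 9) \<subseteq> nt (Q x) (4 * i + 11)"
      using c[of "4 * i + 9" "[Inr (Letter 3), Inl (4 * i + 5)]"] c[of "4 * i + 9" "[]"]
        c[of "4 * i + 11" "[Inr (Letter 3), Inl (4 * i + 7)]"] c[of "4 * i + 11" "[Inr Hash1, Inl (4 * i + 9)]"]
      by simp_all
    moreover from this(1,2) have J: "runs (Suc i) \<subseteq> nt (Q x) (4 * i + 9)"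
      unfolding runs_Suc using Suc by (auto simp: image_subset_iff subset_iff)
    ultimately have S: "split_runs (Suc i) \<subseteq> nt (Q x) (4 * i + 11)"
      unfolding split_runs_Suc using Suc by (auto simp: image_subset_iff subset_iff)
    have "4 * Suc i + 5 = 4 * i + 9" "4 * Suc i + 7 = 4 * i + 11" by simp_all
    then show ?case using J S by (simp only: simp_thms)
  qed
  have holes: "runs x \<subseteq> nt (Q x) 1" "split_runs x \<subseteq> nt (Q x) 3"
    using prod[of 1 "[Inl (4 * x + 5)]"] prod[of 3 "[Inl (4 * x + 7)]"] chain[of x]
    unfolding Qx by (auto simp: conc_def)
  have fill: "w \<in> sat (\<lambda>N. {w. fill_word x w \<subseteq> nt (Q x) (2 * N + 4)}) r \<Longrightarrow>
      fill_word x w \<subseteq> sat (nt (Q x)) (map fill_sym r)" for w r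
  proof (induction r arbitrary: w)
    case (Cons a r)
    show ?case
    proof (cases a)
      case (Inl N)
      with Cons.prems obtain u v where "w = u @ v" "fill_word x u \<subseteq> nt (Q x) (2 * N + 4)"
        "v \<in> sat (\<lambda>N. {w. fill_word x w \<subseteq> nt (Q x) (2 * N + 4)}) r"
        by (auto elim: concE)
      with Cons.IH[of v] Inl show ?thesis
        by (auto simp: fill_word_append fill_sym_def elim!: concE intro!: concI)
    next
      case (Inr s)
      with Cons.prems obtain v where v: "w = s # v"
        "v \<in> sat (\<lambda>N. {w. fill_word x w \<subseteq> nt (Q x) (2 * N + 4)}) r" by auto
      from Cons.IH[OF v(2)] have IH: "fill_word x v \<subseteq> sat (nt (Q x)) (map fill_sym r)" .
      show ?thesis
      proof (cases s)
        case (Inl t)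
        then show ?thesis using IH Inr v(1) by (auto simp: fill_sym_def conc_def)
      next
        case (Inr b)
        then show ?thesis using IH \<open>a = Inr s\<close> v(1) holes
          by (auto simp: fill_sym_def elim!: concE intro!: concI split: if_splits)
      qed
    qed
  qed simp
  \<comment> \<open>Minimality is used for the lower bound too: the words all of whose fillings are
    generated form a solution of the inclusions of \<open>P\<close>.\<close>
  have "nt P N \<subseteq> {w. fill_word x w \<subseteq> nt (Q x) (2 * N + 4)}" for N
  proof (rule nt_sound)
    fix N r assume Nr: "(N, r) \<in> P"
    have "(2 * N + 4, map fill_sym r) \<in> Q x"
      unfolding Qx by (intro UnI2 image_eqI[OF _ Nr]) simp
    from prod[OF this] fill
    show "sat (\<lambda>N. {w. fill_word x w \<subseteq> nt (Q x) (2 * N + 4)}) r \<subseteq> {w. fill_word x w \<subseteq> nt (Q x) (2 * N + 4)}"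
      by blast
  qed
  then have "fill_lang x (nt P (cfg_start G)) \<subseteq> nt (Q x) (2 * cfg_start G + 4)"
    unfolding fill_lang_def by blast
  moreover have "nt (Q x) (2 * cfg_start G + 4) \<subseteq> fill_lang x (nt P (cfg_start G))"
    using sound[of "2 * cfg_start G + 4"] unfolding K .
  ultimately show ?thesis by blast
qed

lemma holey_structure:
  assumes "finite A" "holey (Letter ` A \<union> {Hash1, Hash2}) M" "3 \<in> A"
  obtains \<Sigma> where
    "\<And>x. wh_A (fill_holes x \<Sigma>) = A" "\<And>x. wh_L (fill_holes x \<Sigma>) = plus_words A"
    "\<And>x. wh_M (fill_holes x \<Sigma>) = M x"
    "\<And>x. \<forall>(p, a, q) \<in> set (nfa_trans (wh_aut (fill_holes x \<Sigma>))). a \<in> A"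
    "\<And>x. \<forall>(N, r) \<in> set (cfg_prods (wh_gram (fill_holes x \<Sigma>))). \<forall>t. Inr t \<in> set r \<longrightarrow> t \<in> Letter ` A \<union> {Hash1, Hash2}"
proof -
  let ?U = "Letter ` A \<union> {Hash1, Hash2}"
  from assms(2) obtain E where E: "cfl E" "E \<subseteq> lists (Inl ` ?U \<union> range Inr)" "\<And>x. M x = fill_lang x E"
    unfolding holey_def by blast
  from cfl_terminals[OF E(1,2)] obtain G where G: "E = cfg_lang G"
    "\<forall>(N, r) \<in> set (cfg_prods G). \<forall>t. Inr t \<in> set r \<longrightarrow> t \<in> Inl ` ?U \<union> range Inr" .
  from finite_list[OF assms(1)] obtain as where as: "set as = A" ..
  define aut where "aut = \<lparr>nfa_init = [0], nfa_final = [1 :: nat],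
    nfa_trans = map (\<lambda>a. (0, a, 1)) as @ map (\<lambda>a. (1, a, 1)) as\<rparr>"
  define \<Sigma> where "\<Sigma> = \<lparr>wh_alphabet = as, wh_aut = aut, wh_gram = template G\<rparr>"
  show ?thesis
  proof (rule that[of \<Sigma>])
    fix x
    show "wh_A (fill_holes x \<Sigma>) = A" by (simp add: wh_A_def fill_holes_def \<Sigma>_def as)
    have 1: "nfa_path aut 1 w q \<longleftrightarrow> w \<in> lists A \<and> q = 1" for w q
      by (induction w) (auto simp: nfa_path_Cons aut_def as)
    have 0: "nfa_path aut 0 w 1 \<longleftrightarrow> w \<in> plus_words A" for w
    proof (cases w)
      case (Cons a v)
      have "(0, a, q) \<in> set (nfa_trans aut) \<longleftrightarrow> a \<in> A \<and> q = 1" for q by (auto simp: aut_def as)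
      then show ?thesis unfolding Cons nfa_path_Cons using 1[of v 1] by (auto simp: plus_words_def)
    qed (simp add: plus_words_def)
    have "nfa_init aut = [0]" "nfa_final aut = [1]" by (simp_all add: aut_def)
    then show "wh_L (fill_holes x \<Sigma>) = plus_words A"
      using 0 by (auto simp: wh_L_def fill_holes_def \<Sigma>_def nfa_lang_def)
    show "wh_M (fill_holes x \<Sigma>) = M x"
      unfolding wh_M_def cfg_lang_eq_nt E(3) G(1) using fill_template[where G = G and x = x]
      by (simp add: fill_holes_def \<Sigma>_def template_def)
    show "\<forall>(p, a, q) \<in> set (nfa_trans (wh_aut (fill_holes x \<Sigma>))). a \<in> A"
      by (auto simp: fill_holes_def \<Sigma>_def aut_def as)
    have "t \<in> ?U" if r: "(N, r) \<in> set (cfg_prods (wh_gram (fill_holes x \<Sigma>)))" "Inr t \<in> set r" for N r t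
    proof (rule ccontr)
      assume n: "t \<notin> ?U"
      from r(1) consider "(N, r) \<in> set (hole_prods x)" | "(N, r) \<in> set base_prods"
        | M s where "(M, s) \<in> set (cfg_prods G)" "r = map fill_sym s"
        by (auto simp: fill_holes_def \<Sigma>_def template_def)
      then show False
      proof cases
        case 1
        then show ?thesis using r(2) n assms(3) by (auto simp: hole_prods_def set_hole_chain)
      next
        case 2
        then show ?thesis using r(2) n assms(3) by (auto simp: base_prods_def)
      next
        case 3
        with r(2) obtain a where a: "a \<in> set s" "Inr t = fill_sym a" by auto
        then have "a = Inr (Inl t)" by (auto simp: fill_sym_def split: sum.splits if_splits)
        with G(2) 3(1) a(1) have "Inl t \<in> (Inl ` ?U \<union> range Inr :: (hsym + bool) set)" by blast
        then show ?thesis using n by auto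
      qed
    qed
    then show "\<forall>(N, r) \<in> set (cfg_prods (wh_gram (fill_holes x \<Sigma>))). \<forall>t. Inr t \<in> set r \<longrightarrow> t \<in> ?U" by blast
  qed
qed

section \<open>Inserting a separator\<close>

lemma conc_Un: "conc (X \<union> Y) Z = conc X Z \<union> conc Y Z" "conc Z (X \<union> Y) = conc Z X \<union> conc Z Y"
  by (auto simp: conc_def)

lemma conc_UN: "conc (\<Union>i\<in>J. X i) Z = (\<Union>i\<in>J. conc (X i) Z)" "conc Z (\<Union>i\<in>J. X i) = (\<Union>i\<in>J. conc Z (X i))"
  by (auto simp: conc_def)

lemma map_conc: "map f ` conc X Y = conc (map f ` X) (map f ` Y)"
proof (intro equalityI subsetI)
  fix w assume "w \<in> map f ` conc X Y"
  then show "w \<in> conc (map f ` X) (map f ` Y)" by (auto elim!: concE intro!: concI)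
next
  fix w assume "w \<in> conc (map f ` X) (map f ` Y)"
  then obtain x y where "x \<in> X" "y \<in> Y" "w = map f (x @ y)" by (auto elim!: concE)
  then show "w \<in> map f ` conc X Y" by (auto intro!: imageI concI simp del: map_append)
qed

lemma conc3_iff: "w \<in> conc X (conc Y Z) \<longleftrightarrow> (\<exists>u c v. w = u @ c @ v \<and> u \<in> X \<and> c \<in> Y \<and> v \<in> Z)"
  unfolding conc_def by blast

text \<open>Both factors in the multiplication table are non-empty. The variants record on which
  side of the separator this still has to be required once the word has been decomposed.\<close>

definition insL :: "'a \<Rightarrow> 'a list set \<Rightarrow> 'a list set" where
  "insL h X = {u @ h # v | u v. u @ v \<in> X \<and> u \<noteq> []}"

definition insR :: "'a \<Rightarrow> 'a list set \<Rightarrow> 'a list set" where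
  "insR h X = {u @ h # v | u v. u @ v \<in> X \<and> v \<noteq> []}"

definition insB :: "'a \<Rightarrow> 'a list set \<Rightarrow> 'a list set" where
  "insB h X = {u @ h # v | u v. u @ v \<in> X \<and> u \<noteq> [] \<and> v \<noteq> []}"

lemma insB_Un: "insB h (X \<union> Y) = insB h X \<union> insB h Y"
  by (auto simp: insB_def)

lemma insB_UN: "insB h (\<Union>i\<in>J. X i) = (\<Union>i\<in>J. insB h (X i))"
  by (auto simp: insB_def)

text \<open>The separator falls into one of the two factors, and the other factor, being non-empty,
  guarantees one of the two sides. Only the one-sided variants remain.\<close>

lemma insB_conc:
  assumes "[] \<notin> L" "[] \<notin> Z"
  shows "insB h (conc L Z) = conc (insL h L) Z \<union> conc L (insR h Z)"
proof (intro equalityI subsetI)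
  fix w assume "w \<in> insB h (conc L Z)"
  then obtain u v x y where *: "w = u @ h # v" "u @ v = x @ y" "x \<in> L" "y \<in> Z" "u \<noteq> []" "v \<noteq> []"
    unfolding insB_def conc_def by blast
  from *(2) obtain us where "u = x @ us \<and> us @ v = y \<or> u @ us = x \<and> v = us @ y"
    unfolding append_eq_append_conv2 by blast
  then show "w \<in> conc (insL h L) Z \<union> conc L (insR h Z)"
  proof
    assume "u = x @ us \<and> us @ v = y"
    then have "us @ h # v \<in> insR h Z" "w = x @ (us @ h # v)"
      using * by (auto simp: insR_def)
    then show ?thesis using *(3) by (auto intro: concI)
  next
    assume us: "u @ us = x \<and> v = us @ y"
    then have "u @ h # us \<in> insL h L" "w = (u @ h # us) @ y"
      using * by (auto simp: insL_def)
    then show ?thesis using concI[of "u @ h # us" "insL h L" y Z] *(4) by simp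
  qed
next
  fix w assume "w \<in> conc (insL h L) Z \<union> conc L (insR h Z)"
  then consider u us y where "u @ us \<in> L" "u \<noteq> []" "y \<in> Z" "w = (u @ h # us) @ y"
    | x us v where "us @ v \<in> Z" "v \<noteq> []" "x \<in> L" "w = x @ us @ h # v"
    by (auto simp: insL_def insR_def elim!: concE)
  then show "w \<in> insB h (conc L Z)"
  proof cases
    case 1
    then have "u @ (us @ y) \<in> conc L Z" using concI[of "u @ us" L y Z] by simp
    moreover have "us @ y \<noteq> []" "w = u @ h # (us @ y)" using 1 assms(2) by auto
    ultimately show ?thesis unfolding insB_def using 1(2) by blast
  next
    case 2
    then have "(x @ us) @ v \<in> conc L Z" using concI[of x L "us @ v" Z] by simp
    moreover have "x @ us \<noteq> []" "w = (x @ us) @ h # v" using 2 assms(1) by auto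
    ultimately show ?thesis unfolding insB_def using 2(2) by blast
  qed
qed

lemma insR_conc:
  assumes "[] \<notin> R"
  shows "insR h (conc M R) = conc (ins h M) R \<union> conc M (insR h R)"
proof (intro equalityI subsetI)
  fix w assume "w \<in> insR h (conc M R)"
  then obtain u v x y where *: "w = u @ h # v" "u @ v = x @ y" "x \<in> M" "y \<in> R" "v \<noteq> []"
    unfolding insR_def conc_def by blast
  from *(2) obtain us where "u = x @ us \<and> us @ v = y \<or> u @ us = x \<and> v = us @ y"
    unfolding append_eq_append_conv2 by blast
  then show "w \<in> conc (ins h M) R \<union> conc M (insR h R)"
  proof
    assume "u = x @ us \<and> us @ v = y"
    then have "us @ h # v \<in> insR h R" "w = x @ (us @ h # v)"
      using * by (auto simp: insR_def)
    then show ?thesis using *(3) by (auto intro: concI)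
  next
    assume us: "u @ us = x \<and> v = us @ y"
    then have "u @ h # us \<in> ins h M" "w = (u @ h # us) @ y"
      using * by (auto simp: ins_def)
    then show ?thesis using concI[of "u @ h # us" "ins h M" y R] *(4) by simp
  qed
next
  fix w assume "w \<in> conc (ins h M) R \<union> conc M (insR h R)"
  then consider u us y where "u @ us \<in> M" "y \<in> R" "w = (u @ h # us) @ y"
    | x us v where "us @ v \<in> R" "v \<noteq> []" "x \<in> M" "w = x @ us @ h # v"
    by (auto simp: ins_def insR_def elim!: concE)
  then show "w \<in> insR h (conc M R)"
  proof cases
    case 1
    then have "u @ (us @ y) \<in> conc M R" using concI[of "u @ us" M y R] by simp
    moreover have "us @ y \<noteq> []" "w = u @ h # (us @ y)" using 1 assms by auto
    ultimately show ?thesis unfolding insR_def by blast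
  next
    case 2
    then have "(x @ us) @ v \<in> conc M R" using concI[of x M "us @ v" R] by simp
    moreover have "w = (x @ us) @ h # v" using 2 by auto
    ultimately show ?thesis unfolding insR_def using 2(2) by blast
  qed
qed

text \<open>As \<open>h\<close> does not occur in \<open>X\<close>, an empty side means that the
  word begins or ends with \<open>h\<close>, and such words form a regular set that can be
  subtracted.\<close>

lemma fin_quot_insLRB:
  assumes "fin_quot X" "\<And>w. w \<in> X \<Longrightarrow> h \<notin> set w"
  shows "fin_quot (insL h X)" "fin_quot (insR h X)" "fin_quot (insB h X)"
proof -
  let ?l = "conc {[h]} UNIV" and ?r = "conc UNIV {[h]}"
  have l: "u @ h # v \<in> ?l \<longleftrightarrow> u = []" if "u @ v \<in> X" for u v
    using assms(2)[OF that] by (cases u) (auto simp: conc_def)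
  have r: "u @ h # v \<in> ?r \<longleftrightarrow> v = []" if "u @ v \<in> X" for u v
    using assms(2)[OF that] by (cases v rule: rev_cases) (auto simp: conc_def)
  have eqs: "insL h X = ins h X - ?l" "insR h X = ins h X - ?r" "insB h X = ins h X - ?l - ?r"
    unfolding insL_def insR_def insB_def ins_def using l r by fast+
  show "fin_quot (insL h X)" "fin_quot (insR h X)" "fin_quot (insB h X)"
    unfolding eqs using assms
    by (auto intro!: fin_quot_Diff fin_quot_ins fin_quot_conc[OF _ fin_quot_UNIV]
        fin_quot_conc[OF fin_quot_UNIV] fin_quot_finite[of "{_}"])
qed

lemma ins_lists: "X \<subseteq> lists B \<Longrightarrow> ins h X \<subseteq> lists (insert h B)"
proof
  fix w assume "X \<subseteq> lists B" "w \<in> ins h X"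
  moreover from this(2) obtain u v where w: "w = u @ h # v" "u @ v \<in> X" unfolding ins_def by blast
  ultimately have "u @ v \<in> lists B" by blast
  then show "w \<in> lists (insert h B)" unfolding w by auto
qed

lemma insLRB_subset: "insL h X \<subseteq> ins h X" "insR h X \<subseteq> ins h X" "insB h X \<subseteq> ins h X"
  by (auto simp: insL_def insR_def insB_def ins_def)

lemma holey_fin_quot: "fin_quot X \<Longrightarrow> X \<subseteq> lists U \<Longrightarrow> finite U \<Longrightarrow> holey U (\<lambda>_. X)"
  by (rule holey_cfl[OF cfl_fin_quot])

lemma holey_UN:
  assumes "finite J" "\<And>j. j \<in> J \<Longrightarrow> holey U (F j)"
  shows "holey U (\<lambda>x. \<Union>j\<in>J. F j x)"
  using assms
proof (induction J rule: finite_induct)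
  case empty
  show ?case using holey_cfl[OF cfl_empty, of U] by simp
next
  case (insert j J)
  then show ?case using holey_Un[of U "F j" "\<lambda>x. \<Union>j\<in>J. F j x"] by simp
qed

lemma cfl_palindromes:
  assumes "finite C"
  shows "cfl {u @ Hash1 # v @ Hash2 # rev (u @ v) | u v. u \<in> lists C \<and> v \<in> lists C \<and> u \<noteq> [] \<and> v \<noteq> []}"
proof -
  \<comment> \<open>Four phases of a mirror-image grammar: \<open>0\<close> before the first letter
    of \<open>u\<close>, \<open>1\<close> after it, \<open>2\<close> right after
    \<open>Hash1\<close>, \<open>3\<close> after the first letter of \<open>v\<close>. Separate
    first letters enforce non-emptiness.\<close>
  define P :: "(nat \<times> (nat + hsym) list) set" where
    "P = (\<lambda>(a, N, M). (N, [Inr a, Inl M, Inr a])) ` (C \<times> {(0, 1), (1, 1), (2, 3), (3, 3)}) \<union>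
      {(1, [Inr Hash1, Inl 2]), (3, [Inr Hash2])}"
  define L where "L N = (if N = 0 then {u @ Hash1 # v @ Hash2 # rev (u @ v) | u v. u \<in> lists C \<and> v \<in> lists C \<and> u \<noteq> [] \<and> v \<noteq> []}
    else if N = 1 then {u @ Hash1 # v @ Hash2 # rev (u @ v) | u v. u \<in> lists C \<and> v \<in> lists C \<and> v \<noteq> []}
    else if N = 2 then {v @ Hash2 # rev v | v. v \<in> lists C \<and> v \<noteq> []}
    else {v @ Hash2 # rev v | v. v \<in> lists C})" for N :: nat
  have L: "L 0 = {u @ Hash1 # v @ Hash2 # rev (u @ v) | u v. u \<in> lists C \<and> v \<in> lists C \<and> u \<noteq> [] \<and> v \<noteq> []}"
    "L 1 = {u @ Hash1 # v @ Hash2 # rev (u @ v) | u v. u \<in> lists C \<and> v \<in> lists C \<and> v \<noteq> []}"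
    "L 2 = {v @ Hash2 # rev v | v. v \<in> lists C \<and> v \<noteq> []}" "L 3 = {v @ Hash2 # rev v | v. v \<in> lists C}"
    unfolding L_def by simp_all
  have wrap: "sat K [Inr a, Inl M, Inr a] = {a # w @ [a] | w. w \<in> K M}" for K a and M :: nat
    by (auto simp: conc_def)
  have "nt P N \<subseteq> L N" for N
  proof (rule nt_sound)
    fix N r assume "(N, r) \<in> P"
    then consider a M where "a \<in> C" "(N, M) \<in> {(0, 1), (1, 1), (2, 3), (3, 3)}" "r = [Inr a, Inl M, Inr a]"
      | "N = 1" "r = [Inr Hash1, Inl 2]" | "N = 3" "r = [Inr Hash2]"
      unfolding P_def by auto
    then show "sat L r \<subseteq> L N"
    proof cases
      case 1
      have ext1: "a # (u @ Hash1 # v @ Hash2 # rev (u @ v)) @ [a] = (a # u) @ Hash1 # v @ Hash2 # rev ((a # u) @ v)"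
        for u v by simp
      have ext2: "a # (v @ Hash2 # rev v) @ [a] = (a # v) @ Hash2 # rev (a # v)" for v by simp
      show ?thesis
      proof
        fix w assume "w \<in> sat L r"
        then obtain w' where w': "w = a # w' @ [a]" "w' \<in> L M" unfolding 1(3) wrap by blast
        show "w \<in> L N"
        proof (cases "N < 2")
          case True
          then have M: "M = 1" "N = 0 \<or> N = 1" using 1(2) by auto
          from w'(2) obtain u v where "w' = u @ Hash1 # v @ Hash2 # rev (u @ v)"
            "u \<in> lists C" "v \<in> lists C" "v \<noteq> []" unfolding M(1) L(2) by blast
          then have h: "w = (a # u) @ Hash1 # v @ Hash2 # rev ((a # u) @ v)" "a # u \<in> lists C" "v \<in> lists C"
            "a # u \<noteq> []" "v \<noteq> []" using w'(1) 1(1) ext1 by simp_all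
          from M(2) show ?thesis
          proof
            assume N: "N = 0"
            show ?thesis unfolding N L(1) using h by (intro CollectI exI conjI)
          next
            assume N: "N = 1"
            show ?thesis unfolding N L(2) using h(1,2,3,5) by (intro CollectI exI conjI)
          qed
        next
          case False
          then have M: "M = 3" "N = 2 \<or> N = 3" using 1(2) by auto
          from w'(2) obtain v where "w' = v @ Hash2 # rev v" "v \<in> lists C" unfolding M(1) L(4) by blast
          then have h: "w = (a # v) @ Hash2 # rev (a # v)" "a # v \<in> lists C" "a # v \<noteq> []"
            using w'(1) 1(1) ext2 by simp_all
          from M(2) show ?thesis
          proof
            assume N: "N = 2"
            show ?thesis unfolding N L(3) using h by (intro CollectI exI conjI)
          next
            assume N: "N = 3"
            show ?thesis unfolding N L(4) using h(1,2) by (intro CollectI exI conjI)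
          qed
        qed
      qed
    next
      case 2
      show ?thesis
      proof
        fix w assume "w \<in> sat L r"
        then obtain v where "w = Hash1 # v @ Hash2 # rev v" "v \<in> lists C" "v \<noteq> []"
          unfolding 2(2) by (auto simp: L(3))
        then have "w = [] @ Hash1 # v @ Hash2 # rev ([] @ v)" "[] \<in> lists C" "v \<in> lists C" "v \<noteq> []" by simp_all
        then show "w \<in> L N" unfolding 2(1) L(2) by (intro CollectI exI conjI)
      qed
    next
      case 3
      have "[Hash2] = [] @ Hash2 # rev []" "[] \<in> lists C" by simp_all
      then have "[Hash2] \<in> L 3" unfolding L(4) by (intro CollectI exI conjI)
      then show ?thesis using 3 by simp
    qed
  qed
  have prod: "(N, r) \<in> P \<Longrightarrow> sat (nt P) r \<subseteq> nt P N" for N r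
    by (auto simp: nt_iff yields_iff_sat)
  have ext: "a # w @ [a] \<in> nt P N" if "a \<in> C" "(N, M) \<in> {(0, 1), (1, 1), (2, 3), (3, 3)}" "w \<in> nt P M" for a w N M
  proof -
    have "(N, [Inr a, Inl M, Inr a]) \<in> P"
      unfolding P_def using that(1,2) by (intro UnI1 image_eqI[of _ _ "(a, N, M)"]) auto
    from prod[OF this] show ?thesis using that(3) unfolding wrap by blast
  qed
  have 3: "v @ Hash2 # rev v \<in> nt P 3" if "v \<in> lists C" for v
    using that
  proof (induction v)
    case Nil
    show ?case using prod[of 3 "[Inr Hash2]"] by (simp add: P_def)
  next
    case (Cons a v)
    then show ?case using ext[of a 3 3 "v @ Hash2 # rev v"] by simp
  qed
  have 2: "v @ Hash2 # rev v \<in> nt P 2" if "v \<in> lists C" "v \<noteq> []" for v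
  proof -
    from that obtain a v' where "v = a # v'" "a \<in> C" "v' \<in> lists C" by (cases v) auto
    then show ?thesis using ext[of a 2 3 "v' @ Hash2 # rev v'"] 3 by simp
  qed
  have 1: "u @ Hash1 # v @ Hash2 # rev (u @ v) \<in> nt P 1" if "u \<in> lists C" "v \<in> lists C" "v \<noteq> []" for u v
    using that(1)
  proof (induction u)
    case Nil
    have "(1, [Inr Hash1, Inl 2]) \<in> P" by (simp add: P_def)
    from prod[OF this] show ?case using 2[OF that(2,3)] by auto
  next
    case (Cons a u)
    then show ?case using ext[of a 1 1 "u @ Hash1 # v @ Hash2 # rev (u @ v)"] by simp
  qed
  have "L 0 \<subseteq> nt P 0"
  proof
    fix w assume "w \<in> L 0"
    then obtain u v where w: "w = u @ Hash1 # v @ Hash2 # rev (u @ v)" "u \<in> lists C" "v \<in> lists C" "u \<noteq> []" "v \<noteq> []"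
      unfolding L(1) by blast
    then obtain a u' where "u = a # u'" "a \<in> C" "u' \<in> lists C" by (cases u) auto
    then show "w \<in> nt P 0" using ext[of a 0 1 "u' @ Hash1 # v @ Hash2 # rev (u' @ v)"] 1[of u' v] w by simp
  qed
  with \<open>nt P 0 \<subseteq> L 0\<close> have "L 0 = nt P 0" by blast
  moreover have "finite P" unfolding P_def using assms by simp
  ultimately have "cfl (L 0)" using cfl_nt by metis
  then show ?thesis unfolding L(1) .
qed

section \<open>The ideal of faulty histories\<close>

text \<open>The letter \<open>0\<close> delimits histories, \<open>1\<close> represents the zero element, and \<open>2\<close> separates the
  input, a run of letters \<open>inc 0\<close>, from the operations of a computation. A factor \<open>0 y 0\<close> is a fault
  unless \<open>y\<close> is a legal history in \<open>Q\<close>.\<close>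

definition letters :: "nat \<Rightarrow> nat set" where
  "letters k = {0, 1, 2} \<union> ops k"

abbreviation body :: "nat \<Rightarrow> nat list set" where
  "body k \<equiv> lists (insert 2 (ops k))"

abbreviation start :: "nat \<Rightarrow> int" where
  "start \<equiv> \<lambda>_. 0"

definition faults :: "nat \<Rightarrow> nat list set \<Rightarrow> nat \<Rightarrow> nat list set" where
  "faults k Q x = {[1]} \<union> {0 # replicate j (inc 0) @ [2] | j. j \<noteq> x} \<union>
    {0 # y @ [0] | y. y \<in> body k \<and> (\<not> legal start y \<or> y \<notin> Q)}"

definition faulty :: "nat \<Rightarrow> nat list set \<Rightarrow> nat \<Rightarrow> nat list set" where
  "faulty k Q x = conc (lists (letters k)) (conc (faults k Q x) (lists (letters k)))"

lemma faulty_iff: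
  "w \<in> faulty k Q x \<longleftrightarrow> (\<exists>u c v. w = u @ c @ v \<and> u \<in> lists (letters k) \<and> v \<in> lists (letters k) \<and> c \<in> faults k Q x)"
  unfolding faulty_def conc_def by blast

lemma faultyI:
  "c \<in> faults k Q x \<Longrightarrow> u \<in> lists (letters k) \<Longrightarrow> v \<in> lists (letters k) \<Longrightarrow> u @ c @ v \<in> faulty k Q x"
  unfolding faulty_iff by blast

lemma finite_ops: "finite (ops k)" and finite_letters: "finite (letters k)"
  by (simp_all add: ops_def letters_def)

lemma body_letters: "y \<in> body k \<Longrightarrow> y \<in> lists (letters k)"
  by (auto simp: letters_def)

lemma inc_0_letter: "0 < k \<Longrightarrow> inc 0 \<in> ops k"
  by (auto simp: ops_def)

lemma not_in_ops [simp]: "0 \<notin> ops k" "Suc 0 \<notin> ops k" "2 \<notin> ops k"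
  by (auto simp: ops_def)

lemma faults_letters:
  assumes "0 < k" "c \<in> faults k Q x"
  shows "c \<in> lists (letters k)" "c \<noteq> []"
proof -
  show "c \<in> lists (letters k)" "c \<noteq> []"
    using assms(2) inc_0_letter[OF assms(1)] by (auto simp: faults_def letters_def in_lists_conv_set)
qed

lemma word_ideal_faulty:
  assumes "0 < k"
  shows "word_ideal (letters k) (faulty k Q x) 1"
proof
  show "finite (letters k)" by (rule finite_letters)
  show "1 \<in> letters k" by (simp add: letters_def)
  show "faulty k Q x \<subseteq> plus_words (letters k)"
  proof
    fix w assume "w \<in> faulty k Q x"
    then obtain a c b where "w = a @ c @ b" "a \<in> lists (letters k)" "b \<in> lists (letters k)"
      "c \<in> faults k Q x" unfolding faulty_iff by blast
    then show "w \<in> plus_words (letters k)" using faults_letters[OF assms, of c Q x] by (simp add: plus_words_iff)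
  qed
  show "[1] \<in> faulty k Q x" using faultyI[of "[1]" k Q x "[]" "[]"] by (simp add: faults_def)
  fix w u v assume "w \<in> faulty k Q x" "u \<in> lists (letters k)" "v \<in> lists (letters k)"
  then obtain a c b where "w = a @ c @ b" "u @ a \<in> lists (letters k)" "b @ v \<in> lists (letters k)"
    "c \<in> faults k Q x" unfolding faulty_iff by auto
  then show "u @ w @ v \<in> faulty k Q x" using faultyI[of c k Q x "u @ a" "b @ v"] by simp
qed

lemma single_faulty: "[a] \<in> faulty k Q x \<Longrightarrow> a = 1"
proof -
  assume "[a] \<in> faulty k Q x"
  then obtain u c v where "[a] = u @ c @ v" "c \<in> faults k Q x" unfolding faulty_iff by blast
  then show "a = 1" by (auto simp: faults_def Cons_eq_append_conv append_eq_Cons_conv)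
qed

definition unbalanced :: "nat \<Rightarrow> nat \<Rightarrow> nat list set" where
  "unbalanced k i = {y \<in> body k. cnt i y \<noteq> 0}"

definition nat_runs :: "nat \<Rightarrow> nat list set" where
  "nat_runs x = {replicate j (inc 0) | j. j \<noteq> x}"

text \<open>Illegality is existential: some test, reached with its own counter unbalanced. The input
  is a run of increments and is counted along, so that all counters start at zero.\<close>

lemma illegal_iff:
  assumes "y \<in> body k"
  shows "\<not> legal start y \<longleftrightarrow> y \<in> (\<Union>i<k. conc (unbalanced k i) (conc {[tst i]} (body k)))"
proof
  assume "\<not> legal start y"
  then obtain u v i where y: "y = u @ tst i # v" "cnt i u \<noteq> 0" by (auto simp: legal_def)
  then have "u \<in> unbalanced k i" "v \<in> body k" "i < k"
    using assms by (auto simp: unbalanced_def ops_def)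
  then have "y \<in> conc (unbalanced k i) (conc {[tst i]} (body k))"
    using concI[of u _ "[tst i] @ v"] concI[of "[tst i]" "{[tst i]}" v] y(1) by simp
  with \<open>i < k\<close> show "y \<in> (\<Union>i<k. conc (unbalanced k i) (conc {[tst i]} (body k)))" by blast
next
  assume "y \<in> (\<Union>i<k. conc (unbalanced k i) (conc {[tst i]} (body k)))"
  then obtain i u v where "cnt i u \<noteq> 0" "y = u @ tst i # v"
    by (auto simp: unbalanced_def elim!: concE)
  then show "\<not> legal start y" unfolding legal_def by auto
qed

text \<open>The regular surroundings of the one non-regular or input-dependent factor of a fault;
  \<open>regular_faulty\<close> collects the faults without such a factor.\<close>

definition "left_ctx k = conc (lists (letters k)) {[0]}"
definition "fault_ctx k i = conc {[tst i]} (conc (body k) (conc {[0]} (lists (letters k))))"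
definition "run_ctx k = conc {[2]} (lists (letters k))"
definition "regular_faulty k Q = conc (lists (letters k)) (conc {[0]} (conc (body k - Q) (conc {[0]} (lists (letters k))))) \<union>
  conc (lists (letters k)) (conc {[1]} (lists (letters k)))"

text \<open>The summands are the failing tests, the wrong inputs and the regular rest; only the
  wrong inputs depend on \<open>x\<close>.\<close>

lemma faulty_decomp:
  "faulty k Q x = (\<Union>i<k. conc (left_ctx k) (conc (unbalanced k i) (fault_ctx k i))) \<union>
    conc (left_ctx k) (conc (nat_runs x) (run_ctx k)) \<union> regular_faulty k Q"
proof -
  let ?N = "\<Union>i<k. conc (unbalanced k i) (conc {[tst i]} (body k))"
  have "?N \<subseteq> body k"
  proof
    fix y assume "y \<in> ?N"
    then show "y \<in> body k" by (auto simp: unbalanced_def ops_def elim!: concE)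
  qed
  then have "{y \<in> body k. \<not> legal start y \<or> y \<notin> Q} = ?N \<union> (body k - Q)"
    using illegal_iff[of _ k] by blast
  moreover have "{0 # y @ [0] | y. y \<in> body k \<and> (\<not> legal start y \<or> y \<notin> Q)} =
      conc {[0]} (conc {y \<in> body k. \<not> legal start y \<or> y \<notin> Q} {[0]})"
    by (auto simp: conc_def)
  ultimately have "{0 # y @ [0] | y. y \<in> body k \<and> (\<not> legal start y \<or> y \<notin> Q)} =
      conc {[0]} (conc (?N \<union> (body k - Q)) {[0]})" by (simp only:)
  moreover have "{0 # replicate j (inc 0) @ [2] | j. j \<noteq> x} = conc {[0]} (conc (nat_runs x) {[2]})"
    by (auto simp: conc_def nat_runs_def)
  ultimately have "faults k Q x = {[1]} \<union> conc {[0]} (conc (nat_runs x) {[2]}) \<union>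
      conc {[0]} (conc (?N \<union> (body k - Q)) {[0]})"
    unfolding faults_def by (simp only:)
  then show ?thesis
    unfolding faulty_def left_ctx_def fault_ctx_def run_ctx_def regular_faulty_def
    by (simp only: conc_Un conc_UN conc_assoc) blast
qed

section \<open>The multiplication table is context-free\<close>

definition sym_wt :: "nat \<Rightarrow> hsym \<Rightarrow> int" where
  "sym_wt i t = (case t of Letter a \<Rightarrow> step_wt i a | _ \<Rightarrow> 0)"

lemma weight_Letter [simp]: "weight (sym_wt i) (map Letter w) = cnt i w"
  by (induction w) (auto simp: sym_wt_def)

text \<open>\<open>Hash1\<close> has weight zero, so a separator inside the counted factor leaves
  the count unchanged.\<close>

lemma unbalanced_Letter:
  "map Letter ` unbalanced k i = {y \<in> lists (Letter ` insert 2 (ops k)). weight (sym_wt i) y \<noteq> 0}"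
  "ins Hash1 (map Letter ` unbalanced k i) =
    {y \<in> ins Hash1 (lists (Letter ` insert 2 (ops k))). weight (sym_wt i) y \<noteq> 0}"
proof -
  have l: "lists (Letter ` insert 2 (ops k)) = map Letter ` body k" by (rule lists_image)
  show 1: "map Letter ` unbalanced k i = {y \<in> lists (Letter ` insert 2 (ops k)). weight (sym_wt i) y \<noteq> 0}"
    unfolding l unbalanced_def by auto
  have w: "weight (sym_wt i) (u @ Hash1 # v) = weight (sym_wt i) (u @ v)" for u v
    by (simp add: sym_wt_def)
  show "ins Hash1 (map Letter ` unbalanced k i) =
    {y \<in> ins Hash1 (lists (Letter ` insert 2 (ops k))). weight (sym_wt i) y \<noteq> 0}"
    unfolding 1
  proof (intro equalityI subsetI)
    fix t assume "t \<in> ins Hash1 {y \<in> lists (Letter ` insert 2 (ops k)). weight (sym_wt i) y \<noteq> 0}"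
    then obtain u v where "t = u @ Hash1 # v" "u @ v \<in> lists (Letter ` insert 2 (ops k))"
      "weight (sym_wt i) (u @ v) \<noteq> 0" unfolding ins_def by blast
    moreover from this have "weight (sym_wt i) t \<noteq> 0" using w by simp
    ultimately show "t \<in> {y \<in> ins Hash1 (lists (Letter ` insert 2 (ops k))). weight (sym_wt i) y \<noteq> 0}"
      unfolding ins_def by blast
  next
    fix t assume "t \<in> {y \<in> ins Hash1 (lists (Letter ` insert 2 (ops k))). weight (sym_wt i) y \<noteq> 0}"
    then obtain u v where "t = u @ Hash1 # v" "u @ v \<in> lists (Letter ` insert 2 (ops k))"
      "weight (sym_wt i) t \<noteq> 0" unfolding ins_def by blast
    moreover from this have "weight (sym_wt i) (u @ v) \<noteq> 0" using w by simp
    ultimately show "t \<in> ins Hash1 {y \<in> lists (Letter ` insert 2 (ops k)). weight (sym_wt i) y \<noteq> 0}"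
      unfolding ins_def by blast
  qed
qed

lemma sym_wt_le: "\<bar>sym_wt i t\<bar> \<le> 1"
  by (auto simp: sym_wt_def step_wt_def split: hsym.splits)

lemma map_Letter_nat_runs: "map Letter ` nat_runs x = runs x"
  unfolding nat_runs_def runs_def setcompr_eq_image image_image by (simp add: inc_def)

lemma inj_Letter: "inj Letter"
  by (auto intro: injI)

lemma ins_runs: "ins Hash1 (runs x) = split_runs x"
proof (intro equalityI subsetI)
  fix w assume "w \<in> ins Hash1 (runs x)"
  then obtain u v j where "w = u @ Hash1 # v" "u @ v = replicate j (Letter 3)" "j \<noteq> x"
    by (auto simp: ins_def runs_def)
  moreover from this(2) have "u = replicate (length u) (Letter 3)" "v = replicate (length v) (Letter 3)"
    "length u + length v = j"
    by (auto simp: append_eq_conv_conj min_def split: if_splits)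
  ultimately have "w = replicate (length u) (Letter 3) @ Hash1 # replicate (length v) (Letter 3)"
    "length u + length v \<noteq> x" by simp_all
  then show "w \<in> split_runs x" unfolding split_runs_def by (intro CollectI exI conjI)
next
  fix w assume "w \<in> split_runs x"
  then obtain a b where ab: "a + b \<noteq> x" "w = replicate a (Letter 3) @ Hash1 # replicate b (Letter 3)"
    by (auto simp: split_runs_def)
  then have "replicate a (Letter 3) @ replicate b (Letter 3) \<in> runs x"
    unfolding runs_def replicate_add[symmetric] by blast
  then show "w \<in> ins Hash1 (runs x)" unfolding ins_def using ab(2) by blast
qed

lemma holey_faulty:
  assumes "0 < k" "fin_quot Q"
  shows "holey (Letter ` letters k \<union> {Hash1, Hash2}) (\<lambda>x. insB Hash1 (map Letter ` faulty k Q x))"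
    "holey (Letter ` letters k \<union> {Hash1, Hash2}) (\<lambda>x. rev ` map Letter ` faulty k Q x)"
proof -
  let ?U = "Letter ` letters k \<union> {Hash1, Hash2}"
  let ?A = "lists (letters k)"
  let ?m = "(`) (map Letter)"
  have U: "finite ?U" using finite_letters by simp
  have sub: "?m X \<subseteq> lists ?U" if "X \<subseteq> ?A" for X
  proof -
    have "?m X \<subseteq> lists (Letter ` letters k)" using that unfolding lists_image by blast
    then show ?thesis using lists_mono[of "Letter ` letters k" ?U] by blast
  qed
  have free: "Hash1 \<notin> set w" if "w \<in> ?m X" for w X using that by auto
  have insU: "ins Hash1 (?m X) \<subseteq> lists ?U" if "X \<subseteq> ?A" for X
    using ins_lists[OF sub[OF that], of Hash1] by (simp add: insert_absorb)
  have reg: "holey ?U (\<lambda>_. ?m X)" "holey ?U (\<lambda>_. insL Hash1 (?m X))" "holey ?U (\<lambda>_. insR Hash1 (?m X))"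
    "holey ?U (\<lambda>_. insB Hash1 (?m X))" "cfl (?m X)" if "fin_quot X" "X \<subseteq> ?A" for X
  proof -
    have X: "fin_quot (?m X)" using that(1) inj_Letter by (rule fin_quot_map)
    show "holey ?U (\<lambda>_. ?m X)" using X sub[OF that(2)] U by (rule holey_fin_quot)
    show "cfl (?m X)" using X sub[OF that(2)] U by (rule cfl_fin_quot)
    show "holey ?U (\<lambda>_. insL Hash1 (?m X))" "holey ?U (\<lambda>_. insR Hash1 (?m X))" "holey ?U (\<lambda>_. insB Hash1 (?m X))"
      by (rule holey_fin_quot[OF fin_quot_insLRB(1)[OF X free] order_trans[OF insLRB_subset(1) insU[OF that(2)]] U]
        holey_fin_quot[OF fin_quot_insLRB(2)[OF X free] order_trans[OF insLRB_subset(2) insU[OF that(2)]] U]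
        holey_fin_quot[OF fin_quot_insLRB(3)[OF X free] order_trans[OF insLRB_subset(3) insU[OF that(2)]] U]; assumption)+
  qed
  have body: "body k \<subseteq> ?A" using body_letters by blast
  have sing: "{[a]} \<subseteq> ?A" if "a \<in> letters k" for a using that by simp
  have L: "fin_quot (left_ctx k)" "left_ctx k \<subseteq> ?A" "[] \<notin> left_ctx k"
  proof -
    show "fin_quot (left_ctx k)"
      unfolding left_ctx_def by (intro fin_quot_conc fin_quot_lists fin_quot_finite) simp
    show "left_ctx k \<subseteq> ?A"
      unfolding left_ctx_def by (intro conc_lists sing order_refl) (simp add: letters_def)
  qed (simp add: left_ctx_def conc_def)
  have F: "fin_quot (fault_ctx k i)" "[] \<notin> fault_ctx k i" for i
  proof -
    show "fin_quot (fault_ctx k i)"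
      unfolding fault_ctx_def by (intro fin_quot_conc fin_quot_lists fin_quot_finite[of "{_}"]) simp_all
  qed (simp add: fault_ctx_def conc_def)
  have FA: "fault_ctx k i \<subseteq> ?A" if "i < k" for i
    unfolding fault_ctx_def using that
    by (intro conc_lists body sing order_refl) (simp_all add: letters_def ops_def)
  have R: "fin_quot (run_ctx k)" "run_ctx k \<subseteq> ?A" "[] \<notin> run_ctx k"
  proof -
    show "fin_quot (run_ctx k)"
      unfolding run_ctx_def by (intro fin_quot_conc fin_quot_lists fin_quot_finite) simp
    show "run_ctx k \<subseteq> ?A"
      unfolding run_ctx_def by (intro conc_lists sing order_refl) (simp add: letters_def)
  qed (simp add: run_ctx_def conc_def)
  have G: "fin_quot (regular_faulty k Q)"
    unfolding regular_faulty_def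
    by (intro fin_quot_Un fin_quot_conc fin_quot_Diff fin_quot_lists fin_quot_finite[of "{_}"] assms) simp_all
  have diff: "body k - Q \<subseteq> ?A" using body by blast
  have GA: "regular_faulty k Q \<subseteq> ?A"
    unfolding regular_faulty_def
    by (intro Un_least conc_lists sing diff order_refl) (simp_all add: letters_def)
  have V: "cfl (?m (unbalanced k i))" "cfl (ins Hash1 (?m (unbalanced k i)))" for i
  proof -
    let ?B = "Letter ` insert 2 (ops k)"
    have B: "finite ?B" using finite_ops by simp
    show "cfl (?m (unbalanced k i))"
      unfolding unbalanced_Letter(1)
      by (rule cfl_weight_nonzero[OF fin_quot_lists order_refl B sym_wt_le])
    have "fin_quot (ins Hash1 (lists ?B))" by (rule fin_quot_ins[OF fin_quot_lists]) auto
    then show "cfl (ins Hash1 (?m (unbalanced k i)))"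
      unfolding unbalanced_Letter(2)
      by (rule cfl_weight_nonzero[OF _ ins_lists[OF order_refl] _ sym_wt_le]) (use B in simp)
  qed
  have VA: "unbalanced k i \<subseteq> ?A" for i unfolding unbalanced_def using body by blast
  have hV: "holey ?U (\<lambda>_. ?m (unbalanced k i))" "holey ?U (\<lambda>_. ins Hash1 (?m (unbalanced k i)))" for i
    by (rule holey_cfl[OF V(1) sub[OF VA]], rule holey_cfl[OF V(2) insU[OF VA]])
  have nil: "[] \<notin> ?m X" if "[] \<notin> X" for X :: "nat list set" using that by auto
  have split: "insB Hash1 (conc (?m (left_ctx k)) (conc M (?m Z))) =
      conc (insL Hash1 (?m (left_ctx k))) (conc M (?m Z)) \<union>
      conc (?m (left_ctx k)) (conc (ins Hash1 M) (?m Z) \<union> conc M (insR Hash1 (?m Z)))"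
    if "[] \<notin> Z" for M Z
  proof -
    have "[] \<notin> conc M (?m Z)" using nil[OF that] by (auto elim!: concE)
    from insB_conc[OF nil[OF L(3)] this] show ?thesis unfolding insR_conc[OF nil[OF that]] .
  qed
  \<comment> \<open>The separator falls into the left context, the middle or the right context. The
    contexts are regular, so a hypothesis is required only for the middle.\<close>
  have hsplit: "holey ?U (\<lambda>x. insB Hash1 (conc (?m (left_ctx k)) (conc (M x) (?m Z))))"
    if "[] \<notin> Z" "holey ?U M" "holey ?U (\<lambda>x. ins Hash1 (M x))" "fin_quot Z" "Z \<subseteq> ?A" for M Z
    unfolding split[OF that(1)]
    by (intro holey_Un holey_conc reg L that)
  have decomp: "?m (faulty k Q x) = (\<Union>i<k. conc (?m (left_ctx k)) (conc (?m (unbalanced k i)) (?m (fault_ctx k i)))) \<union>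
    conc (?m (left_ctx k)) (conc (runs x) (?m (run_ctx k))) \<union> ?m (regular_faulty k Q)" for x
    unfolding faulty_decomp image_Un image_UN map_conc map_Letter_nat_runs ..
  \<comment> \<open>A separator inside the input is the reason for the second kind of hole.\<close>
  have "holey ?U (\<lambda>x. insB Hash1 (conc (?m (left_ctx k)) (conc (runs x) (?m (run_ctx k)))))"
    by (rule hsplit[OF R(3) holey_runs(1) _ R(1,2)]) (unfold ins_runs, rule holey_runs(2))
  moreover have "holey ?U (\<lambda>x. \<Union>i<k. insB Hash1 (conc (?m (left_ctx k)) (conc (?m (unbalanced k i)) (?m (fault_ctx k i)))))"
  proof (rule holey_UN[OF finite_lessThan])
    fix i assume "i \<in> {..<k}"
    then have "i < k" by simp
    show "holey ?U (\<lambda>x. insB Hash1 (conc (?m (left_ctx k)) (conc (?m (unbalanced k i)) (?m (fault_ctx k i)))))"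
      by (rule hsplit[OF F(2) hV(1) hV(2) F(1) FA[OF \<open>i < k\<close>]])
  qed
  ultimately show "holey ?U (\<lambda>x. insB Hash1 (?m (faulty k Q x)))"
    unfolding decomp insB_Un insB_UN by (intro holey_Un reg G GA)
  have revU: "rev ` X \<subseteq> lists ?U" if "X \<subseteq> lists ?U" for X
  proof
    fix w assume "w \<in> rev ` X"
    then obtain v where "w = rev v" "v \<in> X" by blast
    moreover from this that have "v \<in> lists ?U" by blast
    ultimately show "w \<in> lists ?U" by (simp only: in_lists_conv_set set_rev)
  qed
  \<comment> \<open>Runs are their own reversals, so the mirrored factor uses the same hole.\<close>
  have rev_runs: "rev ` runs x = runs x" for x
  proof -
    have "rev w = id w" if "w \<in> runs x" for w using that by (auto simp: runs_def)
    then have "rev ` runs x = id ` runs x" by (rule image_cong[OF refl])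
    then show ?thesis by simp
  qed
  have hrev: "holey ?U (\<lambda>_. rev ` ?m X)" if "cfl (?m X)" "X \<subseteq> ?A" for X
    using cfl_rev[OF that(1)] revU[OF sub[OF that(2)]] by (rule holey_cfl)
  have rL: "holey ?U (\<lambda>_. rev ` ?m (left_ctx k))" by (rule hrev[OF reg(5)[OF L(1,2)] L(2)])
  have "holey ?U (\<lambda>x. \<Union>i<k. conc (conc (rev ` ?m (fault_ctx k i)) (rev ` ?m (unbalanced k i))) (rev ` ?m (left_ctx k)))"
  proof (rule holey_UN[OF finite_lessThan])
    fix i assume "i \<in> {..<k}"
    then have "i < k" by simp
    show "holey ?U (\<lambda>x. conc (conc (rev ` ?m (fault_ctx k i)) (rev ` ?m (unbalanced k i))) (rev ` ?m (left_ctx k)))"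
      by (rule holey_conc[OF holey_conc[OF hrev[OF reg(5)[OF F(1) FA[OF \<open>i < k\<close>]] FA[OF \<open>i < k\<close>]]
        hrev[OF V(1) VA]] rL])
  qed
  moreover have "holey ?U (\<lambda>x. conc (conc (rev ` ?m (run_ctx k)) (runs x)) (rev ` ?m (left_ctx k)))"
    by (rule holey_conc[OF holey_conc[OF hrev[OF reg(5)[OF R(1,2)] R(2)] holey_runs(1)] rL])
  moreover have "holey ?U (\<lambda>x. rev ` ?m (regular_faulty k Q))"
    by (rule hrev[OF reg(5)[OF G GA] GA])
  ultimately show "holey ?U (\<lambda>x. rev ` ?m (faulty k Q x))"
    unfolding decomp image_Un image_UN rev_conc rev_runs by (intro holey_Un)
qed

text \<open>If the product is zero, the conditions on \<open>u @ v\<close> and on \<open>w\<close>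
  are independent, and this part of the table is a concatenation across \<open>Hash2\<close>. The
  case \<open>u @ v = w\<close> is a mirror-image language.\<close>

lemma mult_table:
  assumes "0 < k" and I_def: "I = faulty k Q x"
  shows "{hword u v w | u v w. u \<in> plus_words (letters k) \<and> v \<in> plus_words (letters k) \<and>
      w \<in> plus_words (letters k) \<and> (u @ v = w \<or> u @ v \<in> I \<and> w \<in> I)} =
    {u @ Hash1 # v @ Hash2 # rev (u @ v) | u v. u \<in> lists (Letter ` letters k) \<and> v \<in> lists (Letter ` letters k) \<and>
      u \<noteq> [] \<and> v \<noteq> []} \<union> conc (insB Hash1 (map Letter ` I)) (conc {[Hash2]} (rev ` map Letter ` I))"
    (is "?M = ?P \<union> ?Z")
proof (intro equalityI subsetI)
  interpret word_ideal "letters k" I 1 unfolding I_def by (rule word_ideal_faulty[OF assms(1)])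
  {
    fix t assume "t \<in> ?M"
    then obtain u v w where t: "t = hword u v w" "u \<in> lists (letters k)" "u \<noteq> []" "v \<in> lists (letters k)" "v \<noteq> []"
      "u @ v = w \<or> u @ v \<in> I \<and> w \<in> I" by (auto simp: plus_words_iff)
    from t(6) show "t \<in> ?P \<union> ?Z"
    proof
      assume "u @ v = w"
      then have "t = map Letter u @ Hash1 # map Letter v @ Hash2 # rev (map Letter u @ map Letter v)"
        unfolding t(1) hword_def by (auto simp: rev_map)
      moreover have "map Letter u \<in> lists (Letter ` letters k)" "map Letter v \<in> lists (Letter ` letters k)"
        "map Letter u \<noteq> []" "map Letter v \<noteq> []" using t by (auto simp: lists_image)
      ultimately show ?thesis by blast
    next
      assume I: "u @ v \<in> I \<and> w \<in> I"
      have "map Letter u @ Hash1 # map Letter v \<in> insB Hash1 (map Letter ` I)"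
        unfolding insB_def using I t(3,5)
        by (intro CollectI exI[of _ "map Letter u"] exI[of _ "map Letter v"])
           (auto simp del: map_append simp flip: map_append)
      moreover have "rev (map Letter w) \<in> rev ` map Letter ` I" using I by blast
      ultimately have "(map Letter u @ Hash1 # map Letter v) @ [Hash2] @ rev (map Letter w) \<in> ?Z"
        by (intro concI) simp_all
      then show ?thesis unfolding t(1) hword_def by (simp add: rev_map)
    qed
  next
    fix t assume "t \<in> ?P \<union> ?Z"
    then show "t \<in> ?M"
    proof
      assume "t \<in> ?P"
      then obtain u v where "t = map Letter u @ Hash1 # map Letter v @ Hash2 # rev (map Letter u @ map Letter v)"
        "u \<in> lists (letters k)" "v \<in> lists (letters k)" "u \<noteq> []" "v \<noteq> []"
        unfolding lists_image by auto
      then show ?thesis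
        by (intro CollectI exI[of _ u] exI[of _ v] exI[of _ "u @ v"]) (auto simp: hword_def plus_words_iff rev_map)
    next
      assume "t \<in> ?Z"
      then obtain a b y w where t: "t = a @ Hash1 # b @ Hash2 # rev (map Letter w)" "a @ b = map Letter y"
        "a \<noteq> []" "b \<noteq> []" "y \<in> I" "w \<in> I"
        by (auto simp: insB_def elim!: concE)
      from t(2) obtain u v where uv: "y = u @ v" "a = map Letter u" "b = map Letter v"
        by (auto simp: append_eq_map_conv)
      have "u \<in> plus_words (letters k)" "v \<in> plus_words (letters k)" "w \<in> plus_words (letters k)"
        using I_lists[OF t(5)] I_lists[OF t(6)] Nil_not_in_I t(3,4,6) uv by (auto simp: plus_words_iff)
      then show ?thesis using t uv
        by (intro CollectI exI[of _ u] exI[of _ v] exI[of _ w]) (auto simp: hword_def rev_map)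
    qed
  }
qed

lemma faulty_structure:
  assumes "0 < k" "fin_quot Q"
  shows "\<exists>\<Sigma>. \<forall>x. interpreted_wh_structure (fill_holes x \<Sigma>) (quot (letters k) (faulty k Q x) 1)"
proof -
  let ?U = "Letter ` letters k \<union> {Hash1, Hash2}"
  let ?M = "\<lambda>x. {hword u v w | u v w. u \<in> plus_words (letters k) \<and> v \<in> plus_words (letters k) \<and>
      w \<in> plus_words (letters k) \<and> (u @ v = w \<or> u @ v \<in> faulty k Q x \<and> w \<in> faulty k Q x)}"
  have hM: "holey ?U ?M"
    unfolding mult_table[OF assms(1) refl]
  proof (intro holey_Un holey_conc holey_faulty assms)
    show "holey ?U (\<lambda>_. {u @ Hash1 # v @ Hash2 # rev (u @ v) | u v. u \<in> lists (Letter ` letters k) \<and>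
        v \<in> lists (Letter ` letters k) \<and> u \<noteq> [] \<and> v \<noteq> []})"
      by (rule holey_cfl[OF cfl_palindromes]) (use finite_letters in auto)
    show "holey ?U (\<lambda>_. {[Hash2]})"
      by (rule holey_fin_quot) (use finite_letters in \<open>auto intro: fin_quot_finite\<close>)
  qed
  have "3 \<in> letters k"
    using inc_0_letter[OF assms(1)] by (simp add: letters_def inc_def)
  from holey_structure[OF finite_letters hM this] obtain \<Sigma> where \<Sigma>:
    "\<And>x. wh_A (fill_holes x \<Sigma>) = letters k" "\<And>x. wh_L (fill_holes x \<Sigma>) = plus_words (letters k)"
    "\<And>x. wh_M (fill_holes x \<Sigma>) = ?M x"
    "\<And>x. \<forall>(p, a, q) \<in> set (nfa_trans (wh_aut (fill_holes x \<Sigma>))). a \<in> letters k"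
    "\<And>x. \<forall>(N, r) \<in> set (cfg_prods (wh_gram (fill_holes x \<Sigma>))). \<forall>t. Inr t \<in> set r \<longrightarrow> t \<in> ?U"
    by blast
  have "interpreted_wh_structure (fill_holes x \<Sigma>) (quot (letters k) (faulty k Q x) 1)" for x
    by (rule word_ideal.interpreted_quot[OF word_ideal_faulty[OF assms(1)] \<Sigma>]) (rule single_faulty)
  then show ?thesis by blast
qed

section \<open>Computations and automaticity\<close>

text \<open>The regular set \<open>?C\<close>, in which every delimited body counts as a fault,
  generates the same ideal. A delimited body that is legal and in \<open>Q\<close> has an input
  other than \<open>x\<close>, by the assumption on \<open>R\<close>, and so begins with a
  wrong-input fault.\<close>

lemma fin_quot_faulty:
  assumes Q: "Q = conc (star {[inc 0]}) (conc {[2]} R)" and k: "0 < k"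
    and none: "\<And>w. w \<in> R \<Longrightarrow> \<not> legal start (replicate x (inc 0) @ [2] @ w)"
  shows "fin_quot (faulty k Q x)"
proof -
  let ?A = "lists (letters k)"
  let ?C = "{[1]} \<union> conc {[0]} (conc (nat_runs x) {[2]}) \<union> conc {[0]} (conc (body k) {[0]})"
  have sub: "c \<in> ?C" if "c \<in> faults k Q x" for c
    using that by (auto simp: faults_def nat_runs_def conc_def)
  have sup: "c \<in> faulty k Q x" if "c \<in> ?C" for c
  proof (cases "c \<in> faults k Q x")
    case True
    then show ?thesis using faultyI[of c k Q x "[]" "[]"] by simp
  next
    case False
    with that obtain y where y: "c = 0 # y @ [0]" "y \<in> body k" "legal start y" "y \<in> Q"
      by (auto simp: faults_def nat_runs_def conc_def)
    then obtain j w where w: "y = replicate j (inc 0) @ [2] @ w" "w \<in> R"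
      by (auto simp: Q star_single elim!: concE)
    with none y(3) have "j \<noteq> x" by blast
    then have "0 # replicate j (inc 0) @ [2] \<in> faults k Q x" by (auto simp: faults_def)
    moreover have "w @ [0] \<in> ?A" using y(2) w(1) body_letters[of w k] by (auto simp: letters_def)
    ultimately have "[] @ (0 # replicate j (inc 0) @ [2]) @ (w @ [0]) \<in> faulty k Q x"
      by (intro faultyI) simp_all
    then show ?thesis by (simp add: y(1) w(1))
  qed
  interpret word_ideal "letters k" "faulty k Q x" 1 by (rule word_ideal_faulty[OF k])
  have "faulty k Q x = conc ?A (conc ?C ?A)"
  proof (intro equalityI subsetI)
    fix w assume "w \<in> faulty k Q x"
    then obtain u c v where w: "w = u @ c @ v" "u \<in> ?A" "v \<in> ?A" "c \<in> faults k Q x"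
      unfolding faulty_iff by blast
    show "w \<in> conc ?A (conc ?C ?A)" unfolding w(1) by (intro concI w sub)
  next
    fix w assume "w \<in> conc ?A (conc ?C ?A)"
    from iffD1[OF conc3_iff this] obtain u c v where w: "w = u @ c @ v" "u \<in> ?A" "c \<in> ?C" "v \<in> ?A"
      by (elim exE conjE)
    show "w \<in> faulty k Q x" unfolding w(1) by (rule ideal[OF sup[OF w(3)] w(2,4)])
  qed
  then have eq: "faulty k Q x = conc ?A (conc ?C ?A)" .
  have runs: "nat_runs x = star {[inc 0]} - {replicate x (inc 0)}"
    by (auto simp: nat_runs_def star_single)
  show ?thesis
    unfolding eq runs
    by (intro fin_quot_conc fin_quot_Un fin_quot_lists fin_quot_Diff fin_quot_star_single
        fin_quot_finite[of "{_}"]) simp_all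
qed

lemma replicate_marker: "replicate j a @ b # u = replicate x a @ b # v \<Longrightarrow> a \<noteq> b \<Longrightarrow> j = x"
proof (induction j arbitrary: x)
  case 0
  then show ?case by (cases x) auto
next
  case (Suc j)
  then show ?case by (cases x) auto
qed

lemma first_split: "u @ a # r = y @ [a] \<Longrightarrow> a \<notin> set y \<Longrightarrow> u = y \<and> r = []"
  by (cases r rule: rev_cases) auto

text \<open>A history with input \<open>x\<close>, delimited on both sides, contains no fault other than possibly
  itself.\<close>

lemma history_faults:
  assumes y: "y = replicate x (inc 0) @ 2 # t" "y \<in> body k"
    and eq: "0 # y @ [0] = u @ c @ v" and c: "c \<in> faults k Q x"
  shows "v = [] \<and> (\<not> legal start y \<or> y \<notin> Q)"
proof -
  have "0 \<notin> set y" "1 \<notin> set y" using y(2) by auto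
  then have "1 \<notin> set (u @ c @ v)" unfolding eq[symmetric] by simp
  \<comment> \<open>The letter \<open>0\<close> occurs only at the two ends of the word, so a factor
    that starts with \<open>0\<close> before the end starts at the beginning.\<close>
  have first: "u = []" if "c = 0 # c'" "c' @ v \<noteq> []" for c'
  proof (rule ccontr)
    assume "u \<noteq> []"
    with eq obtain u' where "u = 0 # u'" "y @ [0] = u' @ c @ v" by (cases u) auto
    then have "u' @ 0 # (c' @ v) = y @ [0]" using that(1) by simp
    from first_split[OF this \<open>0 \<notin> set y\<close>] that(2) show False by simp
  qed
  from c consider "c = [1]" | j where "c = 0 # replicate j (inc 0) @ [2]" "j \<noteq> x"
    | y' where "c = 0 # y' @ [0]" "\<not> legal start y' \<or> y' \<notin> Q" by (auto simp: faults_def)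
  then show ?thesis
  proof cases
    case 1
    then show ?thesis using \<open>1 \<notin> set (u @ c @ v)\<close> by simp
  next
    case 2
    have "u = []" by (rule first[OF 2(1)]) simp
    then have "replicate j (inc 0) @ 2 # v = replicate x (inc 0) @ 2 # (t @ [0])"
      using eq 2(1) y(1) by simp
    from replicate_marker[OF this] 2(2) show ?thesis by simp
  next
    case 3
    have "u = []" by (rule first[OF 3(1)]) simp
    then have "y' @ 0 # v = y @ [0]" using eq 3(1) by simp
    from first_split[OF this \<open>0 \<notin> set y\<close>] 3(2) show ?thesis by blast
  qed
qed

text \<open>The counter \<open>e\<close> is not used by \<open>w\<close>; comparing \<open>a\<close> increments with \<open>b\<close> decrements makes the
  set of legal histories non-regular.\<close>

lemma not_async_automatic:
  assumes k: "0 < k" and s: "s = replicate x (inc 0) @ [2] @ w"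
    and body: "\<And>a b. s @ replicate a (inc e) @ replicate b (dec e) @ [tst e] \<in> body k"
    and Q: "\<And>a b. s @ replicate a (inc e) @ replicate b (dec e) @ [tst e] \<in> Q"
    and legal: "\<And>a b. legal start (s @ replicate a (inc e) @ replicate b (dec e) @ [tst e]) \<longleftrightarrow> a = b"
  shows "\<not> async_automatic (quot (letters k) (faulty k Q x) 1)"
proof
  assume aa: "async_automatic (quot (letters k) (faulty k Q x) 1)"
  interpret word_ideal "letters k" "faulty k Q x" 1 by (rule word_ideal_faulty[OF k])
  let ?y = "\<lambda>a b. s @ replicate a (inc e) @ replicate b (dec e) @ [tst e]"
  have "[0] \<notin> faulty k Q x" using single_faulty[of 0 k Q x] by auto
  moreover have "0 \<in> letters k" by (simp add: letters_def)
  ultimately obtain X where X: "fin_quot X"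
    "\<And>y. y \<in> plus_words (letters k) \<Longrightarrow> y \<notin> faulty k Q x \<Longrightarrow> y \<in> X \<longleftrightarrow> y @ [0] \<in> faulty k Q x"
    using async_automatic_fin_quot[OF aa] by blast
  have y: "?y a b = replicate x (inc 0) @ 2 # (w @ replicate a (inc e) @ replicate b (dec e) @ [tst e])" for a b
    by (simp add: s)
  \<comment> \<open>The letter \<open>p\<close> is the closing delimiter: \<open>0 # ?y a b\<close>
    contains no fault yet, and appending \<open>0\<close> completes one exactly when the history is
    illegal.\<close>
  have mem: "0 # ?y a b \<in> X \<longleftrightarrow> a \<noteq> b" for a b
  proof -
    have plus: "0 # ?y a b \<in> plus_words (letters k)"
      using body_letters[OF body[of a b]] by (simp add: plus_words_iff letters_def)
    have "0 # ?y a b \<notin> faulty k Q x"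
    proof
      assume "0 # ?y a b \<in> faulty k Q x"
      then obtain u c v where "0 # ?y a b = u @ c @ v" "c \<in> faults k Q x" unfolding faulty_iff by blast
      then have "0 # ?y a b @ [0] = u @ c @ (v @ [0])"
        by (metis append.assoc append_Cons)
      from history_faults[OF y body this \<open>c \<in> faults k Q x\<close>] show False by simp
    qed
    from X(2)[OF plus this] have "0 # ?y a b \<in> X \<longleftrightarrow> 0 # ?y a b @ [0] \<in> faulty k Q x" by simp
    also have "\<dots> \<longleftrightarrow> a \<noteq> b"
    proof
      assume "0 # ?y a b @ [0] \<in> faulty k Q x"
      then obtain u c v where *: "0 # ?y a b @ [0] = u @ c @ v" "c \<in> faults k Q x" unfolding faulty_iff by blast
      from history_faults[OF y body *] Q legal show "a \<noteq> b" by blast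
    next
      assume "a \<noteq> b"
      then have "0 # ?y a b @ [0] \<in> faults k Q x"
        unfolding faults_def using body[of a b] legal[of a b] by blast
      from faultyI[OF this, of "[]" "[]"] show "0 # ?y a b @ [0] \<in> faulty k Q x" by simp
    qed
    finally show ?thesis .
  qed
  \<comment> \<open>If the quotients for \<open>a \<noteq> b\<close> agreed, the continuation with
    \<open>b\<close> decrements would belong to both or to neither, although only \<open>a\<close>
    increments make the history illegal.\<close>
  let ?f = "\<lambda>a. lquot X (0 # s @ replicate a (inc e))"
  have "finite (range ?f)"
    using X(1) unfolding fin_quot_def by (rule finite_subset[rotated]) blast
  then have "\<not> inj ?f" using finite_imageD infinite_UNIV_nat by blast
  then obtain a b where ab: "a \<noteq> b" "?f a = ?f b" unfolding inj_def by blast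
  have "replicate b (dec e) @ [tst e] \<in> ?f a" using mem[of a b] ab(1) by simp
  then have "replicate b (dec e) @ [tst e] \<in> ?f b" using ab(2) by simp
  then show False using mem[of b b] by simp
qed

section \<open>Histories with an extra counter, and the diagonal argument\<close>

lemma legal_no_tst:
  assumes "\<And>i. tst i \<notin> set w"
  shows "legal \<sigma> w"
  unfolding legal_def
proof (intro allI impI)
  fix u v i assume "w = u @ tst i # v"
  with assms[of i] show "\<sigma> i + cnt i u = 0" by simp
qed

lemma cnt_replicate:
  "cnt i (replicate n (inc j)) = (if i = j then int n else 0)"
  "cnt i (replicate n (dec j)) = (if i = j then - int n else 0)"
  by (induction n) (auto simp: step_wt_def)

lemma legal_input:
  "legal start (replicate x (inc 0) @ [2] @ w) \<longleftrightarrow> legal (start(0 := int x)) w"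
proof -
  have "legal start (replicate x (inc 0) @ [2])" by (rule legal_no_tst) auto
  moreover have "after start (replicate x (inc 0) @ [2]) = start(0 := int x)"
    by (auto simp: after_def cnt_replicate step_wt_def fun_eq_iff)
  ultimately show ?thesis using legal_append[of start "replicate x (inc 0) @ [2]" w] by simp
qed

text \<open>Operations in \<open>ops e\<close> leave counter \<open>e\<close> alone, so the final
  test compares \<open>a\<close> with \<open>b\<close> whatever \<open>w\<close> does to the other
  counters.\<close>

lemma legal_counting:
  assumes "w \<in> lists (ops e)" "\<sigma> e = 0"
  shows "legal \<sigma> (w @ replicate a (inc e) @ replicate b (dec e) @ [tst e]) \<longleftrightarrow> legal \<sigma> w \<and> a = b"
proof -
  let ?v = "replicate a (inc e) @ replicate b (dec e)"
  have "cnt e w = 0"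
    using assms(1) by (induction w) (auto simp: step_wt_def ops_def)
  then have "after (after \<sigma> w) ?v e = int a - int b"
    using assms(2) by (simp add: after_def cnt_replicate)
  moreover have "legal (after \<sigma> w) ?v" by (rule legal_no_tst) (auto simp: letter_eq)
  ultimately show ?thesis
    using legal_append[of \<sigma> w "?v @ [tst e]"] legal_append[of "after \<sigma> w" ?v "[tst e]"]
    by (simp add: legal_single)
qed

text \<open>\<open>P\<close> enters only through the two implications: the quotient is biautomatic
  if \<open>g\<close> diverges at \<open>n\<close>, and not even asynchronously automatic if
  \<open>g\<close> converges there.\<close>

lemma undecidable:
  assumes bi: "\<And>S. biautomatic S \<Longrightarrow> P S" and async: "\<And>S. P S \<Longrightarrow> async_automatic S"
  shows "\<not> wh_decidable P"
proof
  assume "wh_decidable P"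
  then obtain f where f: "\<And>\<Sigma> S. interpreted_wh_structure \<Sigma> S \<Longrightarrow> rec_eval f [code_wh \<Sigma>] (if P S then 1 else 0)"
    unfolding wh_decidable_def by blast
  from computable_fill_holes obtain F where
    F: "computable 1 F" "\<And>\<Sigma>. F [code_wh \<Sigma>] = code_wh (fill_holes (code_wh \<Sigma>) \<Sigma>)" by blast
  from semidecides[OF F(1), of f] obtain g where
    g: "\<And>x. (\<exists>y. rec_eval g [x] y) \<longleftrightarrow> (\<exists>v. rec_eval f [F [x]] (Suc v))" by blast
  \<comment> \<open>The argument is in register \<open>0\<close>, which the input letters
    \<open>inc 0\<close> load, and the result goes to register \<open>1\<close>.\<close>
  obtain W where W: "implements g [0] 1 2 W"
    by (rule compilesD[OF compiles, of "[0]" 2 1 g]) auto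
  then have "prog W" by (rule implements_prog)
  then obtain e0 where "fin_quot W" "W \<subseteq> lists (ops e0)" by (auto simp: prog_def)
  \<comment> \<open>The successor ensures \<open>e \<noteq> 0\<close>, so the extra counter differs
    from the input register even if \<open>W\<close> contains no operation.\<close>
  define e where "e = Suc e0"
  have We: "W \<subseteq> lists (ops e)"
    using \<open>W \<subseteq> lists (ops e0)\<close> lists_mono[OF ops_mono[of e0 e]] by (simp add: e_def)
  have defined: "(\<exists>y. rec_eval g [x] y) \<longleftrightarrow> (\<exists>w\<in>W. legal (start(0 := int x)) w)" for x
  proof -
    have "sem W (start(0 := int x)) = {(start(0 := int x))(1 := int y) | y. rec_eval g [x] y}"
      by (rule implementsD[OF W]) auto
    then show ?thesis unfolding sem_def by blast
  qed
  define k where "k = Suc e"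
  have k: "0 < k" by (simp add: k_def)
  define R where "R = conc W (conc (star {[inc e]}) (conc (star {[dec e]}) {[tst e]}))"
  define Q where "Q = conc (star {[inc 0]}) (conc {[2]} R)"
  have "fin_quot Q"
    unfolding Q_def R_def
    by (intro fin_quot_conc fin_quot_star_single \<open>fin_quot W\<close> fin_quot_finite[of "{_}"]) simp_all
  from faulty_structure[OF k this]
  obtain \<Sigma> where \<Sigma>: "\<And>x. interpreted_wh_structure (fill_holes x \<Sigma>) (quot (letters k) (faulty k Q x) 1)" by blast
  \<comment> \<open>The diagonal input: \<open>fill_holes n \<Sigma>\<close> is the template filled
    with its own code. It is an interpreted structure, so \<open>f\<close> must answer correctly on
    it.\<close>
  define n where "n = code_wh \<Sigma>"
  define S where "S = quot (letters k) (faulty k Q n) 1"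
  have "F [n] = code_wh (fill_holes n \<Sigma>)" unfolding n_def by (rule F(2))
  then have fS: "rec_eval f [F [n]] (if P S then 1 else 0)"
    using f[OF \<Sigma>[of n]] by (simp add: S_def)
  have R_iff: "v \<in> R \<longleftrightarrow> (\<exists>w a b. w \<in> W \<and> v = w @ replicate a (inc e) @ replicate b (dec e) @ [tst e])" for v
    unfolding R_def star_single conc_def by blast
  have start_e: "(start(0 := int n)) e = 0" by (simp add: e_def)
  show False
  proof (cases "P S")
    case True
    with fS have "\<exists>v. rec_eval f [F [n]] (Suc v)" by auto
    then obtain w where w: "w \<in> W" "legal (start(0 := int n)) w" using g defined by blast
    define s where "s = replicate n (inc 0) @ [2] @ w"
    have "\<not> async_automatic S"
      unfolding S_def
    proof (rule not_async_automatic[OF k s_def])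
      fix a b
      let ?v = "w @ replicate a (inc e) @ replicate b (dec e) @ [tst e]"
      have sv: "s @ replicate a (inc e) @ replicate b (dec e) @ [tst e] = replicate n (inc 0) @ [2] @ ?v"
        by (simp add: s_def)
      have "lists (ops e) \<subseteq> lists (ops k)" by (rule lists_mono[OF ops_mono]) (simp add: k_def)
      then have "w \<in> lists (ops k)" using w(1) We by blast
      moreover have "inc e \<in> ops k" "dec e \<in> ops k" "tst e \<in> ops k" "inc 0 \<in> ops k"
        by (auto simp: ops_def k_def)
      ultimately show "s @ replicate a (inc e) @ replicate b (dec e) @ [tst e] \<in> body k"
        unfolding sv by (auto simp: in_lists_conv_set)
      have "?v \<in> R" unfolding R_iff using w(1) by blast
      then show "s @ replicate a (inc e) @ replicate b (dec e) @ [tst e] \<in> Q"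
        unfolding sv Q_def by (intro concI) (auto simp: star_single)
      show "legal start (s @ replicate a (inc e) @ replicate b (dec e) @ [tst e]) \<longleftrightarrow> a = b"
        unfolding sv legal_input using legal_counting[of w e "start(0 := int n)"] w We start_e by blast
    qed
    with async True show False by blast
  next
    case False
    \<comment> \<open>Here \<open>f\<close> returns \<open>0\<close>, and by determinism no positive
      value as well, so \<open>g\<close> diverges at \<open>n\<close>.\<close>
    have "\<not> (\<exists>v. rec_eval f [F [n]] (Suc v))"
      using fS False rec_eval_deterministic by fastforce
    then have none: "\<not> legal (start(0 := int n)) w" if "w \<in> W" for w
      using that g defined by blast
    have "fin_quot (faulty k Q n)"
    proof (rule fin_quot_faulty[OF Q_def k])
      fix v assume "v \<in> R"
      then obtain w a b where v: "w \<in> W" "v = w @ replicate a (inc e) @ replicate b (dec e) @ [tst e]"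
        unfolding R_iff by blast
      then show "\<not> legal start (replicate n (inc 0) @ [2] @ v)"
        unfolding legal_input using legal_counting[of w e "start(0 := int n)"] none[OF v(1)] We start_e by blast
    qed
    then have "biautomatic S"
      unfolding S_def by (rule word_ideal.biautomatic_quot[OF word_ideal_faulty[OF k]])
    with bi False show False by blast
  qed
qed

theorem theorem5p6:
  shows "\<not> wh_decidable automatic \<and> \<not> wh_decidable async_automatic \<and>
    \<not> wh_decidable biautomatic \<and> \<not> wh_decidable async_biautomatic"
  by (intro conjI undecidable) (blast intro: biautomatic_imp imp_async_automatic)+

end
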